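(* Let $(H,\mu,\nu,\Delta,\varepsilon)$ be a finite-dimensional bialgebra over a field $\Bbbk$. The bigraded vector space $T(H)\otimes T(H^* )=\bigoplus_{n,m\in\mathbb N}H^{\otimes n}\otimes(H^* )^{\otimes m}$ is endowed with four bicomplex structures, with $d_{n,m}\colon H^{\otimes n}\otimes(H^* )^{\otimes m}\to H^{\otimes (n-1)}\otimes(H^* )^{\otimes m}$ and $d'_{n,m}\colon H^{\otimes n}\otimes(H^* )^{\otimes m}\to H^{\otimes n}\otimes(H^* )^{\otimes (m-1)}$ given by: 1. $d=d_{bar}$, $\ d'=(-1)^nd_{cob}$; 2. $d=d_{bar}+(-1)^n\pi^H$, $\ d'=(-1)^nd_{cob}+(-1)^n({}^{H^*}\!\pi)$; 3. $d=d_{bar}+{}^H\!\pi$, $\ d'=(-1)^nd_{cob}+(-1)^{n+m}\pi^{H^*}$; 4. $d=d_{bar}+(-1)^n\pi^H+{}^H\!\pi$, $\ d'=(-1)^nd_{cob}+(-1)^n({}^{H^*}\!\pi)+(-1)^{n+m}\pi^{H^*}$. That is, in each case, $d_{n-1,m}d_{n,m}=0$, $d'_{n,m-1}d'_{n,m}=0$, and $d_{n,m-1}d'_{n,m}+d'_{n-1,m}d_{n,m}=0$.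
   Context: Elements of $H$ are denoted $h_i$, of $H^*$ by $l_j$; pure tensors are written $h_1\ldots h_n\otimes l_1\ldots l_m$; a dot is multiplication. Sweedler notation is used, and $\langle l,h\rangle=l(h)$. The dual bialgebra $H^*$ has the structure $\langle l_1\cdot l_2,h\rangle=\langle l_1,h_{(2)}\rangle\langle l_2,h_{(1)}\rangle$, $\langle l,h_1\cdot h_2\rangle=\langle l_{(1)},h_2\rangle\langle l_{(2)},h_1\rangle$, unit $\varepsilon$, counit $l\mapsto l(1)$. The maps on $H^{\otimes n}\otimes(H^* )^{\otimes m}$ are: $$d_{bar}(h_1\ldots h_n\otimes l_1\ldots l_m)=\sum_{i=1}^{n-1}(-1)^ih_1\ldots(h_i\cdot h_{i+1})\ldots h_n\otimes l_1\ldots l_m,$$ $$d_{cob}(h_1\ldots h_n\otimes l_1\ldots l_m)=\sum_{i=1}^{m-1}(-1)^ih_1\ldots h_n\otimes l_1\ldots(l_i\cdot l_{i+1})\ldots l_m,$$ $${}^{H^*}\!\pi(h_1\ldots h_n\otimes l_1\ldots l_m)=\langle l_{1(1)},h_{n(2)}\rangle\cdots\langle l_{1(n)},h_{1(2)}\rangle\,h_{1(1)}\ldots h_{n(1)}\otimes l_2\ldots l_m,$$ $$\pi^{H^*}(h_1\ldots h_n\otimes l_1\ldots l_m)=\langle l_{m(1)},h_{n(1)}\rangle\cdots\langle l_{m(n)},h_{1(1)}\rangle\,h_{1(2)}\ldots h_{n(2)}\otimes l_1\ldots l_{m-1},$$ $$\pi^{H}(h_1\ldots h_n\otimes l_1\ldots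 l_m)=\langle l_{m(1)},h_{n(1)}\rangle\cdots\langle l_{1(1)},h_{n(m)}\rangle\,h_1\ldots h_{n-1}\otimes l_{1(2)}\ldots l_{m(2)},$$ $${}^{H}\!\pi(h_1\ldots h_n\otimes l_1\ldots l_m)=\langle l_{m(2)},h_{1(1)}\rangle\cdots\langle l_{1(2)},h_{1(m)}\rangle\,h_2\ldots h_n\otimes l_{1(1)}\ldots l_{m(1)}.$$ Here $d_{bar},\pi^H,{}^H\!\pi$ are taken for $n\ge1$, and $d_{cob},{}^{H^*}\!\pi,\pi^{H^*}$ for $m\ge1$ (and are zero otherwise). When $n=0$, ${}^{H^*}\!\pi$ and $\pi^{H^*}$ are understood as applying the counit $l\mapsto l(1)$ to $l_1$, resp. $l_m$; when $m=0$, $\pi^H$ and ${}^H\!\pi$ apply $\varepsilon$ to $h_n$, resp. $h_1$. *)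

theory Defs
  imports Complex_Main "HOL-Library.Function_Algebras"
begin

section \<open>Tensor products of copies of a vector space and of its dual\<close>

text \<open>
  Addition on function types is pointwise (\<^theory>\<open>HOL-Library.Function_Algebras\<close>).  A vector
  space over \<open>'k\<close> is given by a scalar multiplication \<open>s\<close> on a type \<open>'h\<close>.
\<close>

definition dual :: "('k::field \<Rightarrow> 'h::ab_group_add \<Rightarrow> 'h) \<Rightarrow> ('h \<Rightarrow> 'k) set" where
  "dual s = {l. Vector_Spaces.linear s (*) l}"

definition multilinear ::
  "('k::field \<Rightarrow> 'h::ab_group_add \<Rightarrow> 'h) \<Rightarrow> ('k \<Rightarrow> 'w::ab_group_add \<Rightarrow> 'w) \<Rightarrow> nat \<Rightarrow> nat \<Rightarrow>
    ('h list \<Rightarrow> ('h \<Rightarrow> 'k) list \<Rightarrow> 'w) \<Rightarrow> bool" where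
  "multilinear s t n m f \<longleftrightarrow>
    (\<forall>hs ls. length hs = n \<longrightarrow> length ls = m \<longrightarrow> set ls \<subseteq> dual s \<longrightarrow>
      (\<forall>i<n. \<forall>x y. f (hs[i := x + y]) ls = f (hs[i := x]) ls + f (hs[i := y]) ls) \<and>
      (\<forall>i<n. \<forall>c x. f (hs[i := s c x]) ls = t c (f (hs[i := x]) ls)) \<and>
      (\<forall>j<m. \<forall>l\<in>dual s. \<forall>l'\<in>dual s.
         f hs (ls[j := l + l']) = f hs (ls[j := l]) + f hs (ls[j := l'])) \<and>
      (\<forall>j<m. \<forall>c. \<forall>l\<in>dual s. f hs (ls[j := (\<lambda>h. c * l h)]) = t c (f hs (ls[j := l]))))"

text \<open>
  The tensor product of \<open>n\<close> copies of \<open>H\<close> and \<open>m\<close> copies of its dual is realised as the space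
  spanned by the evaluations at \<open>(h\<^sub>1, \<dots>, h\<^sub>n, l\<^sub>1, \<dots>, l\<^sub>m)\<close> inside the linear functionals on the
  multilinear forms in \<open>n + m\<close> variables.  No finiteness is needed for this; see
  \<open>tensor_space_universal\<close> below for the universal property.
\<close>

type_synonym ('k, 'h) tensor = "('h list \<Rightarrow> ('h \<Rightarrow> 'k) list \<Rightarrow> 'k) \<Rightarrow> 'k"

definition tensor_scale :: "'k::field \<Rightarrow> ('k, 'h) tensor \<Rightarrow> ('k, 'h) tensor" where
  "tensor_scale c x = (\<lambda>\<phi>. c * x \<phi>)"

definition pure_tensor ::
  "('k::field \<Rightarrow> 'h::ab_group_add \<Rightarrow> 'h) \<Rightarrow> 'h list \<Rightarrow> ('h \<Rightarrow> 'k) list \<Rightarrow> ('k, 'h) tensor" where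
  "pure_tensor s hs ls =
    (\<lambda>\<phi>. if multilinear s (*) (length hs) (length ls) \<phi> then \<phi> hs ls else 0)"

definition tensor_space ::
  "('k::field \<Rightarrow> 'h::ab_group_add \<Rightarrow> 'h) \<Rightarrow> nat \<Rightarrow> nat \<Rightarrow> ('k, 'h) tensor set" where
  "tensor_space s n m =
    module.span tensor_scale
      {pure_tensor s hs ls | hs ls. length hs = n \<and> length ls = m \<and> set ls \<subseteq> dual s}"

text \<open>
  The linear extension of a multilinear formula \<open>f\<close> for the image of pure tensors
  (see \<open>linear_ext_pure_tensor\<close>).
\<close>

definition linear_ext ::
  "('h list \<Rightarrow> ('h \<Rightarrow> 'k) list \<Rightarrow> ('k, 'h) tensor) \<Rightarrow> ('k, 'h) tensor \<Rightarrow> ('k, 'h) tensor" where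
  "linear_ext f x = (\<lambda>\<phi>. x (\<lambda>hs ls. f hs ls \<phi>))"

lemma vector_space_tensor_scale: "vector_space (tensor_scale :: 'k::field \<Rightarrow> ('k, 'h) tensor \<Rightarrow> _)"
  by unfold_locales (auto simp: tensor_scale_def fun_eq_iff algebra_simps)

lemma vector_space_field: "vector_space ((*) :: 'k::field \<Rightarrow> 'k \<Rightarrow> 'k)"
  by unfold_locales (auto simp: algebra_simps)

lemma pure_tensor_multilinear: "multilinear s tensor_scale n m (pure_tensor s)"
  unfolding multilinear_def pure_tensor_def tensor_scale_def
  by (auto simp: fun_eq_iff)

lemma linear_ext_pure_tensor:
  assumes "multilinear s tensor_scale n m f" "length hs = n" "length ls = m"
  shows "linear_ext f (pure_tensor s hs ls) = f hs ls"
proof -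
  have "multilinear s (*) n m (\<lambda>hs ls. f hs ls \<phi>)" for \<phi>
    using assms(1) by (simp add: multilinear_def tensor_scale_def)
  then show ?thesis
    using assms(2,3) by (simp add: linear_ext_def pure_tensor_def)
qed

theorem tensor_space_universal:
  fixes s :: "'k::field \<Rightarrow> 'h::ab_group_add \<Rightarrow> 'h" and t :: "'k \<Rightarrow> 'w::ab_group_add \<Rightarrow> 'w"
  assumes t: "vector_space t" and f: "multilinear s t n m f"
  shows "\<exists>g. Vector_Spaces.linear tensor_scale t g \<and>
    (\<forall>hs ls. length hs = n \<longrightarrow> length ls = m \<longrightarrow> set ls \<subseteq> dual s \<longrightarrow>
       g (pure_tensor s hs ls) = f hs ls)"
proof -
  interpret T: vector_space "tensor_scale :: 'k \<Rightarrow> ('k, 'h) tensor \<Rightarrow> _"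
    by (rule vector_space_tensor_scale)
  interpret W: vector_space t by (rule t)
  interpret TW: vector_space_pair "tensor_scale :: 'k \<Rightarrow> ('k, 'h) tensor \<Rightarrow> _" t ..
  interpret K: vector_space "(*) :: 'k \<Rightarrow> 'k \<Rightarrow> 'k" by (rule vector_space_field)
  interpret WK: vector_space_pair t "(*) :: 'k \<Rightarrow> 'k \<Rightarrow> 'k" ..
  define G where "G = {pure_tensor s hs ls | hs ls. length hs = n \<and> length ls = m \<and> set ls \<subseteq> dual s}"
  obtain C where C: "C \<subseteq> G" "T.independent C" "G \<subseteq> T.span C"
    using T.maximal_independent_subset by blast
  have "\<forall>x\<in>C. \<exists>w. x = pure_tensor s (fst w) (snd w) \<and> length (fst w) = n \<and> length (snd w) = m
      \<and> set (snd w) \<subseteq> dual s"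
    using C(1) by (auto simp: G_def)
  then obtain w where w: "\<And>x. x \<in> C \<Longrightarrow> x = pure_tensor s (fst (w x)) (snd (w x)) \<and>
      length (fst (w x)) = n \<and> length (snd (w x)) = m \<and> set (snd (w x)) \<subseteq> dual s"
    by metis
  define g where "g = TW.construct C (\<lambda>x. f (fst (w x)) (snd (w x)))"
  have g: "Vector_Spaces.linear tensor_scale t g"
    unfolding g_def by (rule TW.linear_construct[OF C(2)])
  have gC: "g x = f (fst (w x)) (snd (w x))" if "x \<in> C" for x
    unfolding g_def by (rule TW.construct_basis[OF C(2) that])
  have form: "multilinear s (*) n m (\<lambda>hs ls. \<alpha> (f hs ls))"
    if "Vector_Spaces.linear t (*) \<alpha>" for \<alpha>
  proof -
    interpret \<alpha>: Vector_Spaces.linear t "(*)" \<alpha> by (rule that)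
    show ?thesis using f by (simp add: multilinear_def \<alpha>.add \<alpha>.scale)
  qed
  have key: "\<alpha> (g x) = x (\<lambda>hs ls. \<alpha> (f hs ls))"
    if \<alpha>: "Vector_Spaces.linear t (*) \<alpha>" and "x \<in> T.span C" for \<alpha> x
    using that(2)
  proof (induction rule: T.span_induct_alt)
    interpret g: Vector_Spaces.linear tensor_scale t g by (rule g)
    interpret \<alpha>: Vector_Spaces.linear t "(*)" \<alpha> by (rule \<alpha>)
    {
      case base
      have "g (\<lambda>_. 0) = 0" using g.zero by (simp add: zero_fun_def)
      then show ?case by (simp add: zero_fun_def \<alpha>.zero[unfolded zero_fun_def])
    next
      case (step c x y)
      have "\<alpha> (g x) = x (\<lambda>hs ls. \<alpha> (f hs ls))"
        using gC[OF step(1)] w[OF step(1)] form[OF \<alpha>]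
        by (metis (no_types, lifting) pure_tensor_def)
      moreover have "\<alpha> (g (tensor_scale c x + y)) = c * \<alpha> (g x) + \<alpha> (g y)"
        by (simp only: g.add g.scale \<alpha>.add \<alpha>.scale)
      ultimately show ?case
        using step by (simp add: tensor_scale_def plus_fun_def)
    }
  qed
  have sep: "v = 0" if "\<And>\<alpha>. Vector_Spaces.linear t (*) \<alpha> \<Longrightarrow> \<alpha> v = 0" for v
  proof (rule ccontr)
    assume "v \<noteq> 0"
    then have ind: "W.independent {v}" by simp
    from that[OF WK.linear_construct[OF ind, of "\<lambda>_. 1"]] WK.construct_basis[OF ind, of v "\<lambda>_. 1"]
    show False by simp
  qed
  have "g (pure_tensor s hs ls) = f hs ls"
    if h: "length hs = n" "length ls = m" "set ls \<subseteq> dual s" for hs ls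
  proof -
    have "pure_tensor s hs ls \<in> T.span C" using C(3) h by (auto simp: G_def)
    have "\<alpha> (g (pure_tensor s hs ls) - f hs ls) = 0" if \<alpha>: "Vector_Spaces.linear t (*) \<alpha>" for \<alpha>
    proof -
      interpret \<alpha>: Vector_Spaces.linear t "(*)" \<alpha> by (rule \<alpha>)
      show ?thesis
        using key[OF \<alpha> \<open>pure_tensor s hs ls \<in> T.span C\<close>] form[OF \<alpha>] h
        by (simp add: \<alpha>.diff pure_tensor_def)
    qed
    then have "g (pure_tensor s hs ls) - f hs ls = 0" by (rule sep)
    then show ?thesis by simp
  qed
  with g show "\<exists>g. Vector_Spaces.linear tensor_scale t g \<and>
    (\<forall>hs ls. length hs = n \<longrightarrow> length ls = m \<longrightarrow> set ls \<subseteq> dual s \<longrightarrow>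
       g (pure_tensor s hs ls) = f hs ls)" by blast
qed

lemma tensor_space_linear_eqI:
  fixes s :: "'k::field \<Rightarrow> 'h::ab_group_add \<Rightarrow> 'h" and t :: "'k \<Rightarrow> 'w::ab_group_add \<Rightarrow> 'w"
  assumes g: "Vector_Spaces.linear tensor_scale t g" and g': "Vector_Spaces.linear tensor_scale t g'"
    and eq: "\<And>hs ls. \<lbrakk>length hs = n; length ls = m; set ls \<subseteq> dual s\<rbrakk> \<Longrightarrow>
      g (pure_tensor s hs ls) = g' (pure_tensor s hs ls)"
    and x: "x \<in> tensor_space s n m"
  shows "g x = g' x"
proof -
  interpret TW: vector_space_pair "tensor_scale :: 'k \<Rightarrow> ('k, 'h) tensor \<Rightarrow> _" t
    using g by (simp add: Vector_Spaces.linear_def vector_space_pair_def)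
  show ?thesis
    by (rule TW.linear_eq_on_span[OF g g' _ x[unfolded tensor_space_def]]) (auto simp: eq)
qed


section \<open>Bialgebras\<close>

text \<open>
  The multiplication \<open>H \<otimes> H \<rightarrow> H\<close> is given as a bilinear map, and the comultiplication takes values
  in \<^term>\<open>tensor_space s 2 0\<close>.
\<close>

record ('k, 'h) bialgebra =
  smult :: "'k \<Rightarrow> 'h \<Rightarrow> 'h"
  mul :: "'h \<Rightarrow> 'h \<Rightarrow> 'h"
  unit_map :: "'k \<Rightarrow> 'h"
  comul :: "'h \<Rightarrow> ('k, 'h) tensor"
  counit :: "'h \<Rightarrow> 'k"

text \<open>
  The Sweedler sum \<open>\<Sum> F h\<^sub>(\<^sub>1\<^sub>) h\<^sub>(\<^sub>2\<^sub>)\<close> for a bilinear form \<open>F\<close> is the value at \<open>F\<close> of the tensor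
  \<open>\<Delta>(h)\<close>.  An equation between Sweedler sums of tensors is expressed by evaluating both sides at
  all \<open>\<phi>\<close>.
\<close>

definition sweedler :: "('k, 'h) bialgebra \<Rightarrow> 'h \<Rightarrow> ('h \<Rightarrow> 'h \<Rightarrow> 'k) \<Rightarrow> 'k" where
  "sweedler H h F = comul H h (\<lambda>hs ls. F (hs ! 0) (hs ! 1))"

abbreviation pure :: "('k::field, 'h::ab_group_add) bialgebra \<Rightarrow> 'h list \<Rightarrow> ('h \<Rightarrow> 'k) list \<Rightarrow> ('k, 'h) tensor"
  where "pure H \<equiv> pure_tensor (smult H)"

abbreviation one_of :: "('k::field, 'h) bialgebra \<Rightarrow> 'h" where
  "one_of H \<equiv> unit_map H 1"

definition is_algebra :: "('k::field, 'h::ab_group_add) bialgebra \<Rightarrow> bool" where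
  "is_algebra H \<longleftrightarrow>
    (\<forall>x. Vector_Spaces.linear (smult H) (smult H) (\<lambda>y. mul H x y)) \<and>
    (\<forall>y. Vector_Spaces.linear (smult H) (smult H) (\<lambda>x. mul H x y)) \<and>
    Vector_Spaces.linear (*) (smult H) (unit_map H) \<and>
    (\<forall>x y z. mul H (mul H x y) z = mul H x (mul H y z)) \<and>
    (\<forall>x. mul H (one_of H) x = x \<and> mul H x (one_of H) = x)"

definition is_coalgebra :: "('k::field, 'h::ab_group_add) bialgebra \<Rightarrow> bool" where
  "is_coalgebra H \<longleftrightarrow>
    Vector_Spaces.linear (smult H) tensor_scale (comul H) \<and>
    range (comul H) \<subseteq> tensor_space (smult H) 2 0 \<and>
    Vector_Spaces.linear (smult H) (*) (counit H) \<and>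
    (\<forall>h \<phi>. sweedler H h (\<lambda>a b. sweedler H a (\<lambda>c d. pure H [c, d, b] [] \<phi>)) =
           sweedler H h (\<lambda>a b. sweedler H b (\<lambda>c d. pure H [a, c, d] [] \<phi>))) \<and>
    (\<forall>h \<phi>. sweedler H h (\<lambda>a b. counit H a * pure H [b] [] \<phi>) = pure H [h] [] \<phi>) \<and>
    (\<forall>h \<phi>. sweedler H h (\<lambda>a b. counit H b * pure H [a] [] \<phi>) = pure H [h] [] \<phi>)"

definition is_bialgebra :: "('k::field, 'h::ab_group_add) bialgebra \<Rightarrow> bool" where
  "is_bialgebra H \<longleftrightarrow> is_algebra H \<and> is_coalgebra H \<and>
    (\<forall>x y \<phi>. comul H (mul H x y) \<phi> =
       sweedler H x (\<lambda>a b. sweedler H y (\<lambda>c d. pure H [mul H a c, mul H b d] [] \<phi>))) \<and>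
    comul H (one_of H) = pure H [one_of H, one_of H] [] \<and>
    (\<forall>x y. counit H (mul H x y) = counit H x * counit H y) \<and>
    counit H (one_of H) = 1"

definition finite_dim_bialgebra :: "('k::field, 'h::ab_group_add) bialgebra \<Rightarrow> bool" where
  "finite_dim_bialgebra H \<longleftrightarrow>
    (\<exists>B. finite_dimensional_vector_space (smult H) B) \<and> is_bialgebra H"


subsection \<open>The dual bialgebra\<close>

text \<open>
  Both structure maps are transposed with a flip:
  \<open>\<langle>l \<cdot> l', h\<rangle> = \<langle>l, h\<^sub>(\<^sub>2\<^sub>)\<rangle> \<langle>l', h\<^sub>(\<^sub>1\<^sub>)\<rangle>\<close> and \<open>\<langle>l, h \<cdot> h'\<rangle> = \<langle>l\<^sub>(\<^sub>1\<^sub>), h'\<rangle> \<langle>l\<^sub>(\<^sub>2\<^sub>), h\<rangle>\<close>.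
\<close>

definition dual_mul :: "('k::field, 'h) bialgebra \<Rightarrow> ('h \<Rightarrow> 'k) \<Rightarrow> ('h \<Rightarrow> 'k) \<Rightarrow> ('h \<Rightarrow> 'k)" where
  "dual_mul H l l' = (\<lambda>h. sweedler H h (\<lambda>a b. l b * l' a))"

definition dual_counit :: "('k::field, 'h) bialgebra \<Rightarrow> ('h \<Rightarrow> 'k) \<Rightarrow> 'k" where
  "dual_counit H l = l (one_of H)"

definition dual_comul ::
  "('k::field, 'h::ab_group_add) bialgebra \<Rightarrow> ('h \<Rightarrow> 'k) \<Rightarrow> ('k, 'h) tensor" where
  "dual_comul H l = (THE t. t \<in> tensor_space (smult H) 0 2 \<and>
     (\<forall>h h'. l (mul H h h') = t (\<lambda>hs ls. (ls ! 0) h' * (ls ! 1) h)))"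

lemma dual_linear_sum:
  fixes s :: "'k::field \<Rightarrow> 'h::ab_group_add \<Rightarrow> 'h" and g :: "('h \<Rightarrow> 'k) \<Rightarrow> 'k"
  assumes s: "vector_space s" and B: "finite B" and e: "\<And>b. b \<in> B \<Longrightarrow> e b \<in> dual s"
    and add: "\<And>l l'. l \<in> dual s \<Longrightarrow> l' \<in> dual s \<Longrightarrow> g (l + l') = g l + g l'"
    and scale: "\<And>c l. l \<in> dual s \<Longrightarrow> g (\<lambda>h. c * l h) = c * g l"
  shows "g (\<lambda>h. \<Sum>b\<in>B. a b * e b h) = (\<Sum>b\<in>B. a b * g (e b)) \<and>
    (\<lambda>h. \<Sum>b\<in>B. a b * e b h) \<in> dual s"
proof -
  interpret vector_space_pair s "(*) :: 'k \<Rightarrow> 'k \<Rightarrow> 'k"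
    by (intro vector_space_pair.intro s vector_space_field)
  have dual_add: "l + l' \<in> dual s" if "l \<in> dual s" "l' \<in> dual s" for l l'
    using that linear_compose_add[of l l'] by (simp add: dual_def plus_fun_def)
  have dual_scale: "(\<lambda>h. c * l h) \<in> dual s" if "l \<in> dual s" for c l
    using that module_hom_scale[of l c] by (simp add: dual_def linear_iff_module_hom)
  have zero: "(\<lambda>h. 0) \<in> dual s"
    using linear_zero by (simp add: dual_def)
  show ?thesis
    using B e
  proof (induction B rule: finite_induct)
    case empty
    show ?case using scale[OF zero, of 0] zero by simp
  next
    case (insert b B)
    have IH: "g (\<lambda>h. \<Sum>b\<in>B. a b * e b h) = (\<Sum>b\<in>B. a b * g (e b))"
      "(\<lambda>h. \<Sum>b\<in>B. a b * e b h) \<in> dual s"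
      using insert by auto
    have eq: "(\<lambda>h. \<Sum>b\<in>insert b B. a b * e b h) = (\<lambda>h. a b * e b h) + (\<lambda>h. \<Sum>b\<in>B. a b * e b h)"
      using insert by (simp add: plus_fun_def)
    have eb: "e b \<in> dual s" using insert by simp
    show ?case
      unfolding eq using insert(1,2) add[OF dual_scale[OF eb] IH(2)] scale[OF eb] IH
        dual_add[OF dual_scale[OF eb] IH(2)] by simp
  qed
qed

lemma dual_comul_exists_unique:
  fixes H :: "('k::field, 'h::ab_group_add) bialgebra"
  assumes "finite_dimensional_vector_space (smult H) B" "is_algebra H" "l \<in> dual (smult H)"
  shows "\<exists>!t. t \<in> tensor_space (smult H) 0 2 \<and>
     (\<forall>h h'. l (mul H h h') = t (\<lambda>hs ls. (ls ! 0) h' * (ls ! 1) h))"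
proof -
  define s where "s = smult H"
  interpret finite_dimensional_vector_space s B using assms(1) by (simp add: s_def)
  interpret T: vector_space "tensor_scale :: 'k \<Rightarrow> ('k, 'h) tensor \<Rightarrow> _"
    by (rule vector_space_tensor_scale)
  define e where "e = (\<lambda>b h. representation B h b)"
  have repr: "(\<Sum>b\<in>B. s (e b h) b) = h" for h
    unfolding e_def using sum_representation_eq[OF independent_Basis, of h B] finite_Basis span_Basis
    by auto
  have e: "e b \<in> dual s" for b
    using vector_space_axioms vector_space_field
    by (simp add: dual_def e_def Vector_Spaces.linear_iff representation_add representation_scale
        independent_Basis span_Basis)
  have l_eq: "\<alpha> = (\<lambda>h. \<Sum>b\<in>B. \<alpha> b * e b h)" if "\<alpha> \<in> dual s" for \<alpha>
  proof
    fix h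
    interpret \<alpha>: Vector_Spaces.linear s "(*)" \<alpha> using that by (simp add: dual_def)
    have "\<alpha> h = \<alpha> (\<Sum>b\<in>B. s (e b h) b)" by (simp add: repr)
    also have "\<dots> = (\<Sum>b\<in>B. \<alpha> b * e b h)" by (simp add: \<alpha>.sum \<alpha>.scale mult.commute)
    finally show "\<alpha> h = (\<Sum>b\<in>B. \<alpha> b * e b h)" .
  qed
  have expand: "\<phi> [] [p, q] = (\<Sum>b\<in>B. \<Sum>c\<in>B. \<phi> [] [e b, e c] * (p b * q c))"
    if \<phi>: "multilinear s (*) 0 2 \<phi>" and pq: "p \<in> dual s" "q \<in> dual s" for \<phi> :: "'h list \<Rightarrow> ('h \<Rightarrow> 'k) list \<Rightarrow> 'k" and p q
  proof -
    have L: "\<phi> [] [x + y, z] = \<phi> [] [x, z] + \<phi> [] [y, z]" "\<phi> [] [\<lambda>h. a * x h, z] = a * \<phi> [] [x, z]"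
      "\<phi> [] [z, x + y] = \<phi> [] [z, x] + \<phi> [] [z, y]" "\<phi> [] [z, \<lambda>h. a * x h] = a * \<phi> [] [z, x]"
      if "x \<in> dual s" "y \<in> dual s" "z \<in> dual s" for x y z a
    proof -
      have M: "\<phi> [] (ls[j := l + l']) = \<phi> [] (ls[j := l]) + \<phi> [] (ls[j := l'])"
        "\<phi> [] (ls[j := (\<lambda>h. a * l h)]) = a * \<phi> [] (ls[j := l])"
        if "length ls = 2" "set ls \<subseteq> dual s" "j < 2" "l \<in> dual s" "l' \<in> dual s" for ls j l l' a
        using \<phi>[unfolded multilinear_def, THEN spec[of _ "[]"], THEN spec[of _ ls]] that by simp_all
      show "\<phi> [] [x + y, z] = \<phi> [] [x, z] + \<phi> [] [y, z]" "\<phi> [] [\<lambda>h. a * x h, z] = a * \<phi> [] [x, z]"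
        using M[of "[x, z]" 0 x y] M(2)[of "[x, z]" 0 x y a] that by auto
      show "\<phi> [] [z, x + y] = \<phi> [] [z, x] + \<phi> [] [z, y]" "\<phi> [] [z, \<lambda>h. a * x h] = a * \<phi> [] [z, x]"
        using M[of "[z, x]" 1 x y] M(2)[of "[z, x]" 1 x y a] that by auto
    qed
    note S = dual_linear_sum[OF vector_space_axioms finite_Basis e, THEN conjunct1]
    have "\<phi> [] [\<lambda>h. \<Sum>b\<in>B. p b * e b h, q] = (\<Sum>b\<in>B. p b * \<phi> [] [e b, q])"
      by (rule S[of "\<lambda>l. \<phi> [] [l, q]"]) (use L pq in auto)
    moreover have "\<phi> [] [e b, \<lambda>h. \<Sum>c\<in>B. q c * e c h] = (\<Sum>c\<in>B. q c * \<phi> [] [e b, e c])" for b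
      by (rule S[of "\<lambda>l. \<phi> [] [e b, l]"]) (use L e in auto)
    ultimately have "\<phi> [] [p, q] = (\<Sum>b\<in>B. p b * (\<Sum>c\<in>B. q c * \<phi> [] [e b, e c]))"
      unfolding l_eq[OF pq(1), symmetric] l_eq[OF pq(2), symmetric] by simp
    then show ?thesis by (simp add: sum_distrib_left mult_ac)
  qed
  define G where "G = {pure_tensor s hs ls | hs ls. length hs = 0 \<and> length ls = 2 \<and> set ls \<subseteq> dual s}"
  have T: "tensor_space s 0 2 = T.span G" by (simp add: tensor_space_def G_def)
  have mult2: "multilinear s (*) 0 2 (\<lambda>hs ls. (ls ! 0) b * (ls ! 1) c)" for b c
    unfolding multilinear_def by (auto simp: less_2_cases_iff algebra_simps)
  have det: "t \<phi> = (if multilinear s (*) 0 2 \<phi>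
      then \<Sum>b\<in>B. \<Sum>c\<in>B. \<phi> [] [e b, e c] * t (\<lambda>hs ls. (ls ! 0) b * (ls ! 1) c) else 0)"
    if "t \<in> tensor_space s 0 2" for t \<phi>
    using that unfolding T
  proof (induction rule: T.span_induct_alt)
    case base
    show ?case by (simp add: zero_fun_def)
  next
    case (step c x y)
    from step(1) obtain ls where ls: "x = pure_tensor s [] ls" "length ls = 2" "set ls \<subseteq> dual s"
      by (auto simp: G_def)
    then obtain p q where pq: "ls = [p, q]" "p \<in> dual s" "q \<in> dual s"
      by (auto simp: numeral_2_eq_2 length_Suc_conv)
    show ?case
    proof (cases "multilinear s (*) 0 2 \<phi>")
      case True
      then show ?thesis
        using step(2) expand[OF True pq(2,3)] mult2
        by (simp add: ls(1) pq(1) numeral_2_eq_2 pure_tensor_def tensor_scale_def plus_fun_def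
            algebra_simps sum.distrib sum_distrib_left)
    next
      case False
      then show ?thesis
        using step(2) by (simp add: ls(1) pq(1) numeral_2_eq_2 pure_tensor_def tensor_scale_def plus_fun_def)
    qed
  qed
  define t0 where "t0 = (\<Sum>b\<in>B. \<Sum>c\<in>B. tensor_scale (l (mul H c b)) (pure_tensor s [] [e b, e c]))"
  have fun_sum: "(\<Sum>b\<in>B. F b) \<phi> = (\<Sum>b\<in>B. F b \<phi>)" for F :: "'h \<Rightarrow> ('k, 'h) tensor" and \<phi>
    using finite_Basis by (induction B rule: finite_induct) auto
  have t0: "t0 \<in> tensor_space s 0 2"
    unfolding t0_def T
    by (intro T.span_sum T.span_scale T.span_base) (use e in \<open>auto simp: G_def intro!: exI[of _ "[_, _]"]\<close>)
  have "t0 (\<lambda>hs ls. (ls ! 0) h' * (ls ! 1) h) = l (mul H h h')" for h h'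
  proof -
    interpret l: Vector_Spaces.linear s "(*)" l using assms(3) by (simp add: dual_def s_def)
    interpret m1: Vector_Spaces.linear s s "\<lambda>x. mul H x y" for y
      using assms(2) by (simp add: is_algebra_def s_def)
    interpret m2: Vector_Spaces.linear s s "\<lambda>y. mul H x y" for x
      using assms(2) by (simp add: is_algebra_def s_def)
    have pe: "pure_tensor s [] [e b, e c] (\<lambda>hs ls. (ls ! 0) h' * (ls ! 1) h) = e b h' * e c h" for b c
      using mult2[of h' h] by (simp add: pure_tensor_def numeral_2_eq_2)
    have "l (mul H h h') = l (mul H (\<Sum>c\<in>B. s (e c h) c) (\<Sum>b\<in>B. s (e b h') b))"
      by (simp add: repr)
    also have "\<dots> = (\<Sum>b\<in>B. \<Sum>c\<in>B. e b h' * (e c h * l (mul H c b)))"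
      by (simp only: m1.sum m1.scale m2.sum m2.scale l.sum l.scale sum_distrib_left)
    also have "\<dots> = (\<Sum>b\<in>B. \<Sum>c\<in>B. l (mul H c b) * (e b h' * e c h))"
      by (intro sum.cong refl) (simp only: mult_ac)
    also have "\<dots> = t0 (\<lambda>hs ls. (ls ! 0) h' * (ls ! 1) h)"
      by (simp only: t0_def fun_sum tensor_scale_def pe)
    finally show ?thesis by simp
  qed
  show ?thesis
    unfolding s_def[symmetric]
  proof (rule ex1I[of _ t0])
    show "t0 \<in> tensor_space s 0 2 \<and> (\<forall>h h'. l (mul H h h') = t0 (\<lambda>hs ls. (ls ! 0) h' * (ls ! 1) h))"
      using t0 \<open>\<And>h h'. t0 (\<lambda>hs ls. (ls ! 0) h' * (ls ! 1) h) = l (mul H h h')\<close> by simp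
    fix t
    assume t: "t \<in> tensor_space s 0 2 \<and> (\<forall>h h'. l (mul H h h') = t (\<lambda>hs ls. (ls ! 0) h' * (ls ! 1) h))"
    show "t = t0"
    proof
      fix \<phi>
      show "t \<phi> = t0 \<phi>"
        using det[of t \<phi>] det[OF t0, of \<phi>] t \<open>\<And>h h'. t0 (\<lambda>hs ls. (ls ! 0) h' * (ls ! 1) h) = l (mul H h h')\<close>
        by auto
    qed
  qed
qed

definition dual_sweedler ::
  "('k::field, 'h::ab_group_add) bialgebra \<Rightarrow> ('h \<Rightarrow> 'k) \<Rightarrow>
    (('h \<Rightarrow> 'k) \<Rightarrow> ('h \<Rightarrow> 'k) \<Rightarrow> 'k) \<Rightarrow> 'k" where
  "dual_sweedler H l F = dual_comul H l (\<lambda>hs ls. F (ls ! 0) (ls ! 1))"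


subsection \<open>Iterated Sweedler sums\<close>

text \<open>
  For a coalgebra with Sweedler sums \<open>D\<close> and counit \<open>e\<close>,
  \<open>sweedler_list D [v\<^sub>1, \<dots>, v\<^sub>n] F\<close> is the sum of
  \<open>F [v\<^sub>1\<^sub>(\<^sub>1\<^sub>), \<dots>, v\<^sub>n\<^sub>(\<^sub>1\<^sub>)] [v\<^sub>1\<^sub>(\<^sub>2\<^sub>), \<dots>, v\<^sub>n\<^sub>(\<^sub>2\<^sub>)]\<close> and
  \<open>sweedler_iter D e k v F\<close> is the sum of \<open>F [v\<^sub>(\<^sub>1\<^sub>), \<dots>, v\<^sub>(\<^sub>k\<^sub>)]\<close>; the 0-fold iterate is the counit.
\<close>

primrec sweedler_list ::
  "('v \<Rightarrow> ('v \<Rightarrow> 'v \<Rightarrow> 'k) \<Rightarrow> 'k) \<Rightarrow> 'v list \<Rightarrow> ('v list \<Rightarrow> 'v list \<Rightarrow> 'k) \<Rightarrow> 'k" where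
  "sweedler_list D [] F = F [] []"
| "sweedler_list D (v # vs) F = D v (\<lambda>a b. sweedler_list D vs (\<lambda>as bs. F (a # as) (b # bs)))"

primrec sweedler_iter ::
  "('v \<Rightarrow> ('v \<Rightarrow> 'v \<Rightarrow> 'k) \<Rightarrow> 'k) \<Rightarrow> ('v \<Rightarrow> 'k::times) \<Rightarrow> nat \<Rightarrow> 'v \<Rightarrow> ('v list \<Rightarrow> 'k) \<Rightarrow> 'k"
where
  "sweedler_iter D e 0 v F = e v * F []"
| "sweedler_iter D e (Suc k) v F = D v (\<lambda>a b. sweedler_iter D e k b (\<lambda>vs. F (a # vs)))"

definition pairing :: "('h \<Rightarrow> 'k) list \<Rightarrow> 'h list \<Rightarrow> 'k::monoid_mult" where
  "pairing ls hs = (\<Prod>(l, h)\<leftarrow>zip ls hs. l h)"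


section \<open>The structure maps\<close>

text \<open>\<open>contract f i [v\<^sub>1, \<dots>, v\<^sub>n] = [v\<^sub>1, \<dots>, f v\<^sub>i v\<^sub>i\<^sub>+\<^sub>1, \<dots>, v\<^sub>n]\<close> for \<open>1 \<le> i < n\<close>.\<close>

definition contract :: "('v \<Rightarrow> 'v \<Rightarrow> 'v) \<Rightarrow> nat \<Rightarrow> 'v list \<Rightarrow> 'v list" where
  "contract f i vs = take (i - 1) vs @ f (vs ! (i - 1)) (vs ! i) # drop (i + 1) vs"

definition d_bar :: "('k::field, 'h::ab_group_add) bialgebra \<Rightarrow> ('k, 'h) tensor \<Rightarrow> ('k, 'h) tensor" where
  "d_bar H = linear_ext (\<lambda>hs ls. \<Sum>i\<in>{1..<length hs}.
     tensor_scale ((-1) ^ i) (pure H (contract (mul H) i hs) ls))"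

definition d_cob :: "('k::field, 'h::ab_group_add) bialgebra \<Rightarrow> ('k, 'h) tensor \<Rightarrow> ('k, 'h) tensor" where
  "d_cob H = linear_ext (\<lambda>hs ls. \<Sum>i\<in>{1..<length ls}.
     tensor_scale ((-1) ^ i) (pure H hs (contract (dual_mul H) i ls)))"

text \<open>
  In \<open>pi_\<close> the subscripts \<open>L\<close>, \<open>R\<close> give the side on which the superscript \<open>H\<close> or \<open>H\<^sup>*\<close> is written.
  \<open>rev\<close> accounts for the pairings \<open>\<langle>l\<^sub>m, h\<^sub>(\<^sub>1\<^sub>)\<rangle> \<dots> \<langle>l\<^sub>1, h\<^sub>(\<^sub>m\<^sub>)\<rangle>\<close> being in reverse order.
\<close>

definition pi_L_dual :: "('k::field, 'h::ab_group_add) bialgebra \<Rightarrow> ('k, 'h) tensor \<Rightarrow> ('k, 'h) tensor" where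
  "pi_L_dual H = linear_ext (\<lambda>hs ls. if ls = [] then 0 else
     (\<lambda>\<phi>. sweedler_list (sweedler H) hs (\<lambda>as bs.
       sweedler_iter (dual_sweedler H) (dual_counit H) (length hs) (hd ls) (\<lambda>ps.
         pairing ps (rev bs) * pure H as (tl ls) \<phi>))))"

definition pi_R_dual :: "('k::field, 'h::ab_group_add) bialgebra \<Rightarrow> ('k, 'h) tensor \<Rightarrow> ('k, 'h) tensor" where
  "pi_R_dual H = linear_ext (\<lambda>hs ls. if ls = [] then 0 else
     (\<lambda>\<phi>. sweedler_list (sweedler H) hs (\<lambda>as bs.
       sweedler_iter (dual_sweedler H) (dual_counit H) (length hs) (last ls) (\<lambda>ps.
         pairing ps (rev as) * pure H bs (butlast ls) \<phi>))))"

definition pi_R :: "('k::field, 'h::ab_group_add) bialgebra \<Rightarrow> ('k, 'h) tensor \<Rightarrow> ('k, 'h) tensor" where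
  "pi_R H = linear_ext (\<lambda>hs ls. if hs = [] then 0 else
     (\<lambda>\<phi>. sweedler_list (dual_sweedler H) ls (\<lambda>ps qs.
       sweedler_iter (sweedler H) (counit H) (length ls) (last hs) (\<lambda>as.
         pairing (rev ps) as * pure H (butlast hs) qs \<phi>))))"

definition pi_L :: "('k::field, 'h::ab_group_add) bialgebra \<Rightarrow> ('k, 'h) tensor \<Rightarrow> ('k, 'h) tensor" where
  "pi_L H = linear_ext (\<lambda>hs ls. if hs = [] then 0 else
     (\<lambda>\<phi>. sweedler_list (dual_sweedler H) ls (\<lambda>ps qs.
       sweedler_iter (sweedler H) (counit H) (length ls) (hd hs) (\<lambda>as.
         pairing (rev qs) as * pure H (tl hs) ps \<phi>))))"


section \<open>Bicomplexes\<close>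

text \<open>
  \<open>C n m\<close>, for natural \<open>n\<close> and \<open>m\<close>, are the components of the bigraded space; components with a
  negative index are zero, so \<open>d 0 m\<close> and \<open>d' n 0\<close> are required to vanish.
\<close>

definition graded_map ::
  "('k \<Rightarrow> 'v \<Rightarrow> 'v) \<Rightarrow> 'v set \<Rightarrow> 'v set \<Rightarrow> ('v \<Rightarrow> 'v::ab_group_add) \<Rightarrow> bool" where
  "graded_map t A B f \<longleftrightarrow> f ` A \<subseteq> B \<and>
    (\<forall>x\<in>A. \<forall>y\<in>A. f (x + y) = f x + f y) \<and> (\<forall>c. \<forall>x\<in>A. f (t c x) = t c (f x))"

definition bicomplex ::
  "('k::field \<Rightarrow> 'v::ab_group_add \<Rightarrow> 'v) \<Rightarrow> (nat \<Rightarrow> nat \<Rightarrow> 'v set) \<Rightarrow>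
    (nat \<Rightarrow> nat \<Rightarrow> 'v \<Rightarrow> 'v) \<Rightarrow> (nat \<Rightarrow> nat \<Rightarrow> 'v \<Rightarrow> 'v) \<Rightarrow> bool" where
  "bicomplex t C d d' \<longleftrightarrow>
    vector_space t \<and> (\<forall>n m. module.subspace t (C n m)) \<and>
    (\<forall>n m. graded_map t (C n m) (if n = 0 then {0} else C (n - 1) m) (d n m)) \<and>
    (\<forall>n m. graded_map t (C n m) (if m = 0 then {0} else C n (m - 1)) (d' n m)) \<and>
    (\<forall>n m. \<forall>x\<in>C n m. d (n - 1) m (d n m x) = 0) \<and>
    (\<forall>n m. \<forall>x\<in>C n m. d' n (m - 1) (d' n m x) = 0) \<and>
    (\<forall>n m. \<forall>x\<in>C n m. d n (m - 1) (d' n m x) + d' (n - 1) m (d n m x) = 0)"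

end

theory Submission
  imports Defs
begin

text \<open>
  Fix \<open>m\<close>.  Since \<open>H\<close> acts on its dual from both sides by translation, and on a tensor power of
  the dual through the iterated coproduct, \<open>(H\<^sup>*)\<^sup>\<otimes>\<^sup>m\<close> is an \<open>H\<close>-bimodule, and
  \<open>d\<^sub>b\<^sub>a\<^sub>r + (-1)\<^sup>n \<pi>\<^sup>H + \<^sup>H\<pi>\<close> is the Hochschild differential with coefficients in it: an alternating
  sum of \<open>n + 1\<close> faces, of which the inner ones multiply two neighbours and the two outer ones act on
  the coefficients.  Exchanging the roles of \<open>H\<close> and its dual gives \<open>d'\<close>, up to the sign \<open>(-1)\<^sup>n\<close>.
  The four pairs of differentials differ only in which outer faces are replaced by zero.  Giving
  each outer face an idempotent coefficient (0 or 1) makes them instances of one statement,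
  because the presimplicial identities between the faces survive such a replacement.

  The squares vanish by the presimplicial identities (\<open>face_face\<close>), which express the
  associativity of the product, the two module axioms, and the fact that the left and the right
  action commute.  For the mixed equation it suffices, thanks to the sign \<open>(-1)\<^sup>n\<close>, that every face
  in one direction commutes with every face in the other (\<open>face_coface\<close>):
  \<^item> two inner faces affect different tensor factors;
  \<^item> an inner and an outer face commute because the dual is a module algebra, that is, because
    the coproduct is multiplicative (\<open>act_contract\<close>);
  \<^item> two outer faces remove a factor \<open>h\<close> and a factor \<open>l\<close>; in either order one of the two Sweedler
    components of \<open>h\<close> is paired with one of \<open>l\<close>, while the remaining components act on the other
    tensor factors, and this description does not depend on the order
    (\<open>act_last_R\<close> and its three variants).

  Two devices reduce the work.  First, the statement is invariant under exchanging \<open>H\<close> with its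
  dual, flips included, so the argument is carried out for an abstract symmetric pair of bialgebras in
  perfect duality and every lemma is available for the exchanged pair as well.  Secondly, elements of
  the tensor spaces are functionals on multilinear forms, so a map between tensor spaces is
  determined by its transpose on forms, and all identities are checked for forms
  evaluated on lists; no manipulation of tensors is involved.
\<close>

section \<open>Multilinear functions of lists\<close>

definition linear_on :: "'v::ab_group_add set \<Rightarrow> ('k::field \<Rightarrow> 'v \<Rightarrow> 'v) \<Rightarrow> ('v \<Rightarrow> 'k) \<Rightarrow> bool" where
  "linear_on V s f \<longleftrightarrow>
    (\<forall>x\<in>V. \<forall>y\<in>V. f (x + y) = f x + f y) \<and> (\<forall>c. \<forall>x\<in>V. f (s c x) = c * f x)"

definition tuples :: "'v set \<Rightarrow> nat \<Rightarrow> 'v list set" where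
  "tuples V n = {vs. set vs \<subseteq> V \<and> length vs = n}"

text \<open>
  The slot is given by the lists before and after it, since splitting off the first or the last
  entry of a list is how all inductions below proceed.
\<close>

definition multilinear_on ::
  "'v::ab_group_add set \<Rightarrow> ('k::field \<Rightarrow> 'v \<Rightarrow> 'v) \<Rightarrow> nat \<Rightarrow> ('v list \<Rightarrow> 'k) \<Rightarrow> bool" where
  "multilinear_on V s n F \<longleftrightarrow>
    (\<forall>us zs. us @ zs \<in> tuples V (n - 1) \<longrightarrow> 0 < n \<longrightarrow> linear_on V s (\<lambda>v. F (us @ v # zs)))"

lemma tuples_simps [simp]:
  "[] \<in> tuples V n \<longleftrightarrow> n = 0"
  "v # vs \<in> tuples V (Suc n) \<longleftrightarrow> v \<in> V \<and> vs \<in> tuples V n"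
  "vs \<in> tuples V 0 \<longleftrightarrow> vs = []"
  "vs @ [v] \<in> tuples V (Suc n) \<longleftrightarrow> v \<in> V \<and> vs \<in> tuples V n"
  by (auto simp: tuples_def)

lemma tuples_length: "vs \<in> tuples V n \<Longrightarrow> length vs = n"
  by (simp add: tuples_def)

lemma linear_onD:
  assumes "linear_on V s f"
  shows "x \<in> V \<Longrightarrow> y \<in> V \<Longrightarrow> f (x + y) = f x + f y" "x \<in> V \<Longrightarrow> f (s c x) = c * f x"
  using assms by (auto simp: linear_on_def)

lemma linear_on_cmult: "linear_on V s f \<Longrightarrow> linear_on V s (\<lambda>v. c * f v)"
  by (simp add: linear_on_def distrib_left mult.left_commute)

lemma linear_on_multc: "linear_on V s f \<Longrightarrow> linear_on V s (\<lambda>v. f v * c)"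
  by (simp add: linear_on_def distrib_right mult.assoc)

lemma linear_on_sum: "(\<And>i. i \<in> J \<Longrightarrow> linear_on V s (f i)) \<Longrightarrow> linear_on V s (\<lambda>v. \<Sum>i\<in>J. f i v)"
  by (simp add: linear_on_def sum.distrib sum_distrib_left)

lemma linear_on_cong:
  assumes "linear_on V s f" "\<And>x. x \<in> V \<Longrightarrow> g x = f x"
    and "\<And>x y. x \<in> V \<Longrightarrow> y \<in> V \<Longrightarrow> x + y \<in> V" "\<And>c x. x \<in> V \<Longrightarrow> s c x \<in> V"
  shows "linear_on V s g"
  using assms by (simp add: linear_on_def)

lemma multilinear_onD:
  assumes "multilinear_on V s n F" "us @ zs \<in> tuples V (n - 1)" "0 < n"
  shows "linear_on V s (\<lambda>v. F (us @ v # zs))"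
  using assms by (simp add: multilinear_on_def)

lemma multilinear_on_0 [simp]: "multilinear_on V s 0 F"
  by (simp add: multilinear_on_def)

lemma multilinear_on_Cons:
  assumes "multilinear_on V s (Suc n) F" "v \<in> V"
  shows "multilinear_on V s n (\<lambda>vs. F (v # vs))"
  unfolding multilinear_on_def
proof (intro allI impI)
  fix us zs assume "us @ zs \<in> tuples V (n - 1)" "0 < n"
  then show "linear_on V s (\<lambda>x. F (v # us @ x # zs))"
    using multilinear_onD[OF assms(1), of "v # us" zs] assms(2) by (auto simp: tuples_def)
qed

lemma multilinear_on_hd:
  "multilinear_on V s (Suc n) F \<Longrightarrow> vs \<in> tuples V n \<Longrightarrow> linear_on V s (\<lambda>v. F (v # vs))"
  using multilinear_onD[of V s "Suc n" F "[]" vs] by simp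

lemma multilinear_on_last:
  "multilinear_on V s (Suc n) F \<Longrightarrow> vs \<in> tuples V n \<Longrightarrow> linear_on V s (\<lambda>v. F (vs @ [v]))"
  using multilinear_onD[of V s "Suc n" F vs "[]"] by simp

lemma multilinear_on_SucI:
  assumes "\<And>vs. vs \<in> tuples V n \<Longrightarrow> linear_on V s (\<lambda>v. F (v # vs))"
    and "\<And>v. v \<in> V \<Longrightarrow> multilinear_on V s n (\<lambda>vs. F (v # vs))"
  shows "multilinear_on V s (Suc n) F"
  unfolding multilinear_on_def
proof (intro allI impI)
  fix us zs assume us: "us @ zs \<in> tuples V (Suc n - 1)"
  show "linear_on V s (\<lambda>x. F (us @ x # zs))"
  proof (cases us)
    case Nil then show ?thesis using us assms(1) by simp
  next
    case (Cons u us')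
    with us obtain k where "n = Suc k" "u \<in> V" "us' @ zs \<in> tuples V k"
      by (auto simp: tuples_def)
    with assms(2) show ?thesis using multilinear_onD[of V s n "\<lambda>vs. F (u # vs)" us' zs] Cons by simp
  qed
qed

lemma multilinear_on_Suc_snocI:
  assumes "\<And>vs. vs \<in> tuples V n \<Longrightarrow> linear_on V s (\<lambda>v. F (vs @ [v]))"
    and "\<And>v. v \<in> V \<Longrightarrow> multilinear_on V s n (\<lambda>vs. F (vs @ [v]))"
  shows "multilinear_on V s (Suc n) F"
  unfolding multilinear_on_def
proof (intro allI impI)
  fix us zs assume us: "us @ zs \<in> tuples V (Suc n - 1)"
  show "linear_on V s (\<lambda>x. F (us @ x # zs))"
  proof (cases zs rule: rev_cases)
    case Nil then show ?thesis using us assms(1) by simp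
  next
    case (snoc zs' z)
    with us obtain k where "n = Suc k" "z \<in> V" "us @ zs' \<in> tuples V k"
      by (auto simp: tuples_def)
    with assms(2) show ?thesis using multilinear_onD[of V s n "\<lambda>vs. F (vs @ [z])" us zs'] snoc by simp
  qed
qed

lemma multilinear_on_cong:
  assumes "multilinear_on V s n F" "\<And>vs. vs \<in> tuples V n \<Longrightarrow> F' vs = F vs"
    and V: "\<And>x y. x \<in> V \<Longrightarrow> y \<in> V \<Longrightarrow> x + y \<in> V" "\<And>c x. x \<in> V \<Longrightarrow> s c x \<in> V"
  shows "multilinear_on V s n F'"
  unfolding multilinear_on_def
proof (intro allI impI)
  fix us zs assume us: "us @ zs \<in> tuples V (n - 1)" "0 < n"
  then have "us @ v # zs \<in> tuples V n" if "v \<in> V" for v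
    using that by (auto simp: tuples_def)
  then show "linear_on V s (\<lambda>x. F' (us @ x # zs))"
    using multilinear_onD[OF assms(1) us] assms(2) V by (simp add: linear_on_def)
qed

lemma multilinear_on_cmult: "multilinear_on V s n F \<Longrightarrow> multilinear_on V s n (\<lambda>vs. c * F vs)"
  by (simp add: multilinear_on_def linear_on_cmult)

lemma multilinear_on_multc: "multilinear_on V s n F \<Longrightarrow> multilinear_on V s n (\<lambda>vs. F vs * c)"
  by (simp add: multilinear_on_def linear_on_multc)

lemma multilinear_on_sum:
  "(\<And>i. i \<in> J \<Longrightarrow> multilinear_on V s n (F i)) \<Longrightarrow> multilinear_on V s n (\<lambda>vs. \<Sum>i\<in>J. F i vs)"
  by (simp add: multilinear_on_def linear_on_sum)

lemma contract_append:
  "contract f (Suc (length us)) (us @ x # y # zs) = us @ f x y # zs"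
  by (simp add: contract_def nth_append)

lemma contract_Suc_Cons: "0 < i \<Longrightarrow> contract f (Suc i) (v # vs) = v # contract f i vs"
  by (cases i) (simp_all add: contract_def)

lemma contract_snoc: "0 < i \<Longrightarrow> i < length vs \<Longrightarrow> contract f i (vs @ [v]) = contract f i vs @ [v]"
  by (cases i) (simp_all add: contract_def nth_append)

lemma contract_shape:
  assumes "0 < i" "i < length vs"
  obtains us x y zs where "vs = us @ x # y # zs" "i = Suc (length us)"
proof
  show "vs = take (i - 1) vs @ vs ! (i - 1) # vs ! i # drop (Suc i) vs"
    using assms by (metis Cons_nth_drop_Suc One_nat_def Suc_pred append_take_drop_id less_imp_diff_less
        diff_less_Suc)
  show "i = Suc (length (take (i - 1) vs))" using assms by simp
qed

lemma contract_tuples: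
  assumes "vs \<in> tuples V (Suc n)" "0 < i" "i \<le> n" "\<And>x y. x \<in> V \<Longrightarrow> y \<in> V \<Longrightarrow> f x y \<in> V"
  shows "contract f i vs \<in> tuples V n"
proof -
  have "i < length vs" using assms by (simp add: tuples_def)
  then obtain us x y zs where "vs = us @ x # y # zs" "i = Suc (length us)"
    using assms(2) by (blast elim: contract_shape)
  then show ?thesis using assms by (auto simp: contract_append tuples_def)
qed

text \<open>
  Adjacent contractions (\<open>j = i + 1\<close>) are the associative law; all others do not overlap.
\<close>

lemma contract_contract:
  assumes "vs \<in> tuples V n" "0 < i" "i < j" "j < n"
    and "\<And>x y z. x \<in> V \<Longrightarrow> y \<in> V \<Longrightarrow> z \<in> V \<Longrightarrow> f (f x y) z = f x (f y z)"
  shows "contract f i (contract f j vs) = contract f (j - 1) (contract f i vs)"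
proof (cases "j = Suc i")
  case True
  have "i < length vs" using assms by (simp add: tuples_def)
  then obtain us x y zs where vs: "vs = us @ x # y # zs" "i = Suc (length us)"
    using assms(2) by (blast elim: contract_shape)
  then obtain z zs' where "zs = z # zs'" using assms True by (cases zs) (auto simp: tuples_def)
  moreover have "contract f j (us @ x # y # z # zs') = us @ x # f y z # zs'"
    using contract_append[of f "us @ [x]" y z zs'] vs True by simp
  ultimately show ?thesis
    using assms vs True by (simp add: contract_append tuples_def)
next
  case False
  have "i < length vs" using assms by (simp add: tuples_def)
  then obtain us x y zs where vs: "vs = us @ x # y # zs" "i = Suc (length us)"
    using assms(2) by (blast elim: contract_shape)
  have "0 < j - i - 1" "j - i - 1 < length zs" using assms False vs by (auto simp: tuples_def)
  then obtain us' x' y' zs' where zs: "zs = us' @ x' # y' # zs'" "j - i - 1 = Suc (length us')"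
    by (blast elim: contract_shape)
  have j: "j = Suc (Suc (Suc (length us + length us')))" using vs zs assms(3) by simp
  have "contract f j vs = us @ x # y # us' @ f x' y' # zs'"
    using contract_append[of f "us @ x # y # us'" x' y' zs'] vs zs j by simp
  moreover have "contract f (j - 1) (us @ f x y # zs) = us @ f x y # us' @ f x' y' # zs'"
    using contract_append[of f "us @ f x y # us'" x' y' zs'] vs zs j by simp
  ultimately show ?thesis using vs by (simp add: contract_append)
qed

lemma multilinear_on_contract:
  assumes F: "multilinear_on V s n F" and i: "0 < i" "i \<le> n"
    and f: "\<And>x y. x \<in> V \<Longrightarrow> y \<in> V \<Longrightarrow> f x y \<in> V"
      "\<And>x y z. x \<in> V \<Longrightarrow> y \<in> V \<Longrightarrow> z \<in> V \<Longrightarrow> f (x + y) z = f x z + f y z"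
      "\<And>x y z. x \<in> V \<Longrightarrow> y \<in> V \<Longrightarrow> z \<in> V \<Longrightarrow> f x (y + z) = f x y + f x z"
      "\<And>c x y. x \<in> V \<Longrightarrow> y \<in> V \<Longrightarrow> f (s c x) y = s c (f x y)"
      "\<And>c x y. x \<in> V \<Longrightarrow> y \<in> V \<Longrightarrow> f x (s c y) = s c (f x y)"
  shows "multilinear_on V s (Suc n) (\<lambda>vs. F (contract f i vs))"
  using F i
proof (induction i arbitrary: n F)
  case (Suc i)
  show ?case
  proof (cases "i = 0")
    case True
    obtain k where n: "n = Suc k" using Suc by (cases n) auto
    note lin = multilinear_on_hd[OF Suc(2)[unfolded n]]
    show ?thesis
      unfolding True n
    proof (rule multilinear_on_SucI)
      fix vs assume "vs \<in> tuples V (Suc k)"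
      then obtain v zs where "vs = v # zs" "v \<in> V" "zs \<in> tuples V k" by (cases vs) auto
      then show "linear_on V s (\<lambda>x. F (contract f (Suc 0) (x # vs)))"
        using lin[of zs] f by (simp add: contract_def linear_on_def)
    next
      fix v assume v: "v \<in> V"
      show "multilinear_on V s (Suc k) (\<lambda>vs. F (contract f (Suc 0) (v # vs)))"
      proof (rule multilinear_on_SucI)
        fix zs assume "zs \<in> tuples V k"
        then show "linear_on V s (\<lambda>x. F (contract f (Suc 0) (v # x # zs)))"
          using lin[of zs] f v by (simp add: contract_def linear_on_def)
      next
        fix x assume x: "x \<in> V"
        show "multilinear_on V s k (\<lambda>vs. F (contract f (Suc 0) (v # x # vs)))"
          using multilinear_on_Cons[OF Suc(2)[unfolded n] f(1)[OF v x]] by (simp add: contract_def)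
      qed
    qed
  next
    case False
    then obtain k where n: "n = Suc k" "i \<le> k" using Suc by (cases n) auto
    show ?thesis
      unfolding n
    proof (rule multilinear_on_SucI)
      fix vs assume "vs \<in> tuples V (Suc k)"
      then have "contract f i vs \<in> tuples V k" using contract_tuples f(1) n False by blast
      then show "linear_on V s (\<lambda>x. F (contract f (Suc i) (x # vs)))"
        using multilinear_on_hd[OF Suc(2)[unfolded n]] False by (simp add: contract_Suc_Cons)
    next
      fix v assume v: "v \<in> V"
      show "multilinear_on V s (Suc k) (\<lambda>vs. F (contract f (Suc i) (v # vs)))"
        using Suc.IH[OF multilinear_on_Cons[OF Suc(2)[unfolded n(1)] v]] False n(2)
        by (simp add: contract_Suc_Cons)
    qed
  qed
qed simp

section \<open>Two algebras in perfect duality\<close>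

text \<open>
  The carrier is a subset because the dual of \<open>H\<close> is a subset of a function type; the algebra \<open>H\<close>
  itself will be carried by the whole type.
\<close>

locale subspace_algebra =
  fixes V :: "'v::ab_group_add set" and s :: "'k::field \<Rightarrow> 'v \<Rightarrow> 'v"
    and mul :: "'v \<Rightarrow> 'v \<Rightarrow> 'v" and one :: 'v
  assumes add_closed: "x \<in> V \<Longrightarrow> y \<in> V \<Longrightarrow> x + y \<in> V"
    and scale_closed: "x \<in> V \<Longrightarrow> s c x \<in> V"
    and zero_closed: "0 \<in> V"
    and mul_closed: "x \<in> V \<Longrightarrow> y \<in> V \<Longrightarrow> mul x y \<in> V"
    and one_closed: "one \<in> V"
    and mul_add: "x \<in> V \<Longrightarrow> y \<in> V \<Longrightarrow> z \<in> V \<Longrightarrow> mul (x + y) z = mul x z + mul y z"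
      "x \<in> V \<Longrightarrow> y \<in> V \<Longrightarrow> z \<in> V \<Longrightarrow> mul x (y + z) = mul x y + mul x z"
    and mul_scale: "x \<in> V \<Longrightarrow> y \<in> V \<Longrightarrow> mul (s c x) y = s c (mul x y)"
      "x \<in> V \<Longrightarrow> y \<in> V \<Longrightarrow> mul x (s c y) = s c (mul x y)"
    and mul_assoc: "x \<in> V \<Longrightarrow> y \<in> V \<Longrightarrow> z \<in> V \<Longrightarrow> mul (mul x y) z = mul x (mul y z)"
    and one_mul: "x \<in> V \<Longrightarrow> mul one x = x" "x \<in> V \<Longrightarrow> mul x one = x"
begin

lemma sum_scale_closed: "finite J \<Longrightarrow> (\<And>i. i \<in> J \<Longrightarrow> x i \<in> V) \<Longrightarrow> (\<Sum>i\<in>J. s (c i) (x i)) \<in> V"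
  by (induction J rule: finite_induct) (simp_all add: zero_closed add_closed scale_closed)

lemma linear_on_sum_scale:
  assumes f: "linear_on V s f" and "finite J" "\<And>i. i \<in> J \<Longrightarrow> x i \<in> V"
  shows "f (\<Sum>i\<in>J. s (c i) (x i)) = (\<Sum>i\<in>J. c i * f (x i))"
  using assms(2,3)
proof (induction J rule: finite_induct)
  case empty
  have "f (0 + 0) = f 0 + f 0" using f zero_closed by (simp only: linear_on_def)
  then have "f 0 = 0" by (metis add.right_neutral add_left_cancel)
  then show ?case by simp
next
  case (insert i J)
  then show ?case
    using linear_onD[OF f] sum_scale_closed[of J x c] scale_closed by simp
qed

lemma linear_on_mul:
  assumes "linear_on V s f" "v \<in> V"
  shows "linear_on V s (\<lambda>x. f (mul x v))" "linear_on V s (\<lambda>x. f (mul v x))"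
  using assms by (auto simp: linear_on_def mul_add mul_scale mul_closed)

end

text \<open>
  The families \<open>b\<close> and \<open>e\<close> are dual bases, so that the pairing is perfect.  No coproducts are
  given: the one on \<open>V\<close> is the transpose of the product on \<open>W\<close>, and conversely.  This is what makes
  the assumptions symmetric.
\<close>

locale dual_pair =
  A: subspace_algebra V sV mV oV + B: subspace_algebra W sW mW oW
  for V :: "'v::ab_group_add set" and sV :: "'k::field \<Rightarrow> 'v \<Rightarrow> 'v" and mV oV
    and W :: "'w::ab_group_add set" and sW :: "'k \<Rightarrow> 'w \<Rightarrow> 'w" and mW oW +
  fixes pr :: "'v \<Rightarrow> 'w \<Rightarrow> 'k" and I :: "'i set" and b :: "'i \<Rightarrow> 'v" and e :: "'i \<Rightarrow> 'w"
  assumes finite_I: "finite I" and b: "i \<in> I \<Longrightarrow> b i \<in> V" and e: "i \<in> I \<Longrightarrow> e i \<in> W"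
    and pr_left: "w \<in> W \<Longrightarrow> linear_on V sV (\<lambda>v. pr v w)"
    and pr_right: "v \<in> V \<Longrightarrow> linear_on W sW (\<lambda>w. pr v w)"
    and expand_left: "v \<in> V \<Longrightarrow> (\<Sum>i\<in>I. sV (pr v (e i)) (b i)) = v"
    and expand_right: "w \<in> W \<Longrightarrow> (\<Sum>i\<in>I. sW (pr (b i) w) (e i)) = w"
begin

text \<open>
  The Sweedler sum of \<open>F v\<^sub>(\<^sub>1\<^sub>) v\<^sub>(\<^sub>2\<^sub>)\<close>, expanded in the basis; the order of the factors
  \<open>e j\<close> and \<open>e i\<close> is the flip in \<open>\<langle>l \<cdot> l', h\<rangle> = \<langle>l, h\<^sub>(\<^sub>2\<^sub>)\<rangle> \<langle>l', h\<^sub>(\<^sub>1\<^sub>)\<rangle>\<close>.  As a finite sum it makes sense,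
  is linear in \<open>v\<close> and commutes with other such sums for every \<open>F\<close>; only coassociativity and the
  like need \<open>F\<close> to be multilinear.
\<close>

definition D :: "'v \<Rightarrow> ('v \<Rightarrow> 'v \<Rightarrow> 'k) \<Rightarrow> 'k" where
  "D v F = (\<Sum>i\<in>I. \<Sum>j\<in>I. pr v (mW (e j) (e i)) * F (b i) (b j))"

definition eps :: "'v \<Rightarrow> 'k" where
  "eps v = pr v oW"

text \<open>
  The two translation actions of \<open>V\<close> on \<open>W\<close>: as functionals, \<open>R v w\<close> is \<open>x \<mapsto> \<langle>w, x \<cdot> v\<rangle>\<close> and
  \<open>L v w\<close> is \<open>x \<mapsto> \<langle>w, v \<cdot> x\<rangle>\<close> (see \<open>pr_R\<close> and \<open>pr_L\<close>).  In Sweedler notation they are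
  \<open>\<langle>w\<^sub>(\<^sub>1\<^sub>), v\<rangle> w\<^sub>(\<^sub>2\<^sub>)\<close> and \<open>\<langle>w\<^sub>(\<^sub>2\<^sub>), v\<rangle> w\<^sub>(\<^sub>1\<^sub>)\<close> (see \<open>linear_R\<close> and \<open>linear_L\<close>), which is how
  they enter \<open>\<pi>\<^sup>H\<close> and \<open>\<^sup>H\<pi>\<close>.
\<close>

definition R :: "'v \<Rightarrow> 'w \<Rightarrow> 'w" where
  "R v w = (\<Sum>j\<in>I. sW (pr (mV (b j) v) w) (e j))"

definition L :: "'v \<Rightarrow> 'w \<Rightarrow> 'w" where
  "L v w = (\<Sum>j\<in>I. sW (pr (mV v (b j)) w) (e j))"

lemma linear_expand:
  assumes "linear_on V sV f" "v \<in> V"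
  shows "(\<Sum>i\<in>I. pr v (e i) * f (b i)) = f v"
  using A.linear_on_sum_scale[OF assms(1) finite_I b, of "\<lambda>i. i" "\<lambda>i. pr v (e i)"] expand_left[OF assms(2)]
  by simp

lemma linear_expand_right:
  assumes "linear_on W sW f" "w \<in> W"
  shows "(\<Sum>i\<in>I. pr (b i) w * f (e i)) = f w"
  using B.linear_on_sum_scale[OF assms(1) finite_I e, of "\<lambda>i. i" "\<lambda>i. pr (b i) w"] expand_right[OF assms(2)]
  by simp

lemma separated_right:
  assumes "w \<in> W" "w' \<in> W" "\<And>x. x \<in> V \<Longrightarrow> pr x w = pr x w'"
  shows "w = w'"
proof -
  have "(\<Sum>i\<in>I. sW (pr (b i) w) (e i)) = (\<Sum>i\<in>I. sW (pr (b i) w') (e i))"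
    using assms(3) b by simp
  then show ?thesis using expand_right assms(1,2) by simp
qed

lemma D_cong:
  "(\<And>x y. x \<in> V \<Longrightarrow> y \<in> V \<Longrightarrow> F x y = G x y) \<Longrightarrow> D v F = D v G"
  by (simp add: D_def b)

lemma D_cmult: "D v (\<lambda>x y. c * F x y) = c * D v F"
  by (simp add: D_def sum_distrib_left mult.left_commute)

lemma D_multc: "D v (\<lambda>x y. F x y * c) = D v F * c"
  by (simp add: D_def sum_distrib_right mult.assoc)

lemma D_add: "D v (\<lambda>x y. F x y + G x y) = D v F + D v G"
  by (simp add: D_def sum.distrib distrib_left)

lemma D_zero: "D v (\<lambda>x y. 0) = 0"
  by (simp add: D_def)

lemma D_sum: "D v (\<lambda>x y. \<Sum>i\<in>J. F i x y) = (\<Sum>i\<in>J. D v (F i))"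
  by (induction J rule: infinite_finite_induct) (simp_all add: D_zero D_add)

lemma D_linear: "linear_on V sV (\<lambda>v. D v F)"
  unfolding D_def
  by (intro linear_on_sum linear_on_multc pr_left B.mul_closed e)

lemma linear_on_D:
  assumes "\<And>x y. x \<in> V \<Longrightarrow> y \<in> V \<Longrightarrow> linear_on U t (\<lambda>u. F u x y)"
  shows "linear_on U t (\<lambda>u. D v (F u))"
  unfolding D_def using assms b by (intro linear_on_sum linear_on_cmult) auto

lemma D_swap: "D v (\<lambda>x y. D v' (F x y)) = D v' (\<lambda>x' y'. D v (\<lambda>x y. F x y x' y'))"
  by (simp add: D_def[of v'] D_sum D_cmult)

lemma D_pair:
  assumes "v \<in> V" "w \<in> W" "w' \<in> W"
  shows "D v (\<lambda>x y. pr x w * pr y w') = pr v (mW w' w)"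
proof -
  have "D v (\<lambda>x y. pr x w * pr y w')
      = (\<Sum>i\<in>I. pr (b i) w * (\<Sum>j\<in>I. pr (b j) w' * pr v (mW (e j) (e i))))"
    by (simp add: D_def sum_distrib_left mult_ac)
  also have "\<dots> = (\<Sum>i\<in>I. pr (b i) w * pr v (mW w' (e i)))"
    using linear_expand_right[OF B.linear_on_mul(1)[OF pr_right]] assms e by simp
  also have "\<dots> = pr v (mW w' w)"
    using linear_expand_right[OF B.linear_on_mul(2)[OF pr_right]] assms by simp
  finally show ?thesis .
qed

lemma D_eps:
  assumes "v \<in> V" "linear_on V sV f"
  shows "D v (\<lambda>x y. eps x * f y) = f v" "D v (\<lambda>x y. f x * eps y) = f v"
proof -
  have "D v (\<lambda>x y. eps x * f y) = D v (\<lambda>x y. \<Sum>i\<in>I. (pr x oW * pr y (e i)) * f (b i))"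
    by (rule D_cong)
      (simp add: eps_def mult.assoc linear_expand[OF assms(2)] flip: sum_distrib_left)
  also have "\<dots> = f v"
    using assms B.one_closed e
    by (simp add: D_sum D_multc D_pair B.one_mul linear_expand)
  finally show "D v (\<lambda>x y. eps x * f y) = f v" .
  have "D v (\<lambda>x y. f x * eps y) = D v (\<lambda>x y. \<Sum>i\<in>I. (pr x (e i) * pr y oW) * f (b i))"
  proof (rule D_cong)
    fix x y assume "x \<in> V" "y \<in> V"
    have "(\<Sum>i\<in>I. (pr x (e i) * pr y oW) * f (b i)) = pr y oW * (\<Sum>i\<in>I. pr x (e i) * f (b i))"
      by (simp add: sum_distrib_left mult_ac)
    then show "f x * eps y = (\<Sum>i\<in>I. (pr x (e i) * pr y oW) * f (b i))"
      by (simp add: linear_expand[OF assms(2) \<open>x \<in> V\<close>] eps_def)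
  qed
  also have "\<dots> = f v"
    using assms B.one_closed e
    by (simp add: D_sum D_multc D_pair B.one_mul linear_expand)
  finally show "D v (\<lambda>x y. f x * eps y) = f v" .
qed

text \<open>
  A trilinear \<open>F\<close> is a combination of products of three functionals \<open>e i\<close>, and for such a product
  the claim is the associative law of \<open>W\<close>.
\<close>

lemma D_coassoc:
  assumes v: "v \<in> V"
    and F: "\<And>y z. y \<in> V \<Longrightarrow> z \<in> V \<Longrightarrow> linear_on V sV (\<lambda>x. F x y z)"
      "\<And>x y. x \<in> V \<Longrightarrow> y \<in> V \<Longrightarrow> linear_on V sV (\<lambda>z. F x y z)"
  shows "D v (\<lambda>x y. D x (\<lambda>x1 x2. F x1 x2 y)) = D v (\<lambda>x y. D y (\<lambda>y1 y2. F x y1 y2))"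
proof -
  have "D v (\<lambda>x y. D x (\<lambda>x1 x2. F x1 x2 y))
      = D v (\<lambda>x y. \<Sum>i\<in>I. \<Sum>j\<in>I. \<Sum>k\<in>I. (pr x (mW (e j) (e i)) * pr y (e k)) * F (b i) (b j) (b k))"
  proof (rule D_cong)
    fix x y assume "x \<in> V" "y \<in> V"
    then have "F (b i) (b j) y = (\<Sum>k\<in>I. pr y (e k) * F (b i) (b j) (b k))"
      if "i \<in> I" "j \<in> I" for i j
      using linear_expand[OF F(2)] b that by simp
    then show "D x (\<lambda>x1 x2. F x1 x2 y)
      = (\<Sum>i\<in>I. \<Sum>j\<in>I. \<Sum>k\<in>I. (pr x (mW (e j) (e i)) * pr y (e k)) * F (b i) (b j) (b k))"
      by (simp add: D_def sum_distrib_left mult.assoc)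
  qed
  also have "\<dots> = (\<Sum>i\<in>I. \<Sum>j\<in>I. \<Sum>k\<in>I. pr v (mW (e k) (mW (e j) (e i))) * F (b i) (b j) (b k))"
    using v e B.mul_closed by (simp add: D_sum D_multc D_pair)
  also have "\<dots> = (\<Sum>j\<in>I. \<Sum>i\<in>I. \<Sum>k\<in>I. pr v (mW (mW (e k) (e j)) (e i)) * F (b i) (b j) (b k))"
    using e by (subst sum.swap) (simp add: B.mul_assoc)
  also have "\<dots> = (\<Sum>j\<in>I. \<Sum>k\<in>I. \<Sum>i\<in>I. pr v (mW (mW (e k) (e j)) (e i)) * F (b i) (b j) (b k))"
    by (intro sum.cong refl sum.swap)
  also have "\<dots> = D v (\<lambda>x y. \<Sum>j\<in>I. \<Sum>k\<in>I. \<Sum>i\<in>I. (pr x (e i) * pr y (mW (e k) (e j))) * F (b i) (b j) (b k))"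
    using v e B.mul_closed by (simp add: D_sum D_multc D_pair)
  also have "\<dots> = D v (\<lambda>x y. D y (\<lambda>y1 y2. F x y1 y2))"
  proof (rule D_cong)
    fix x y assume "x \<in> V" "y \<in> V"
    then have "F x (b j) (b k) = (\<Sum>i\<in>I. pr x (e i) * F (b i) (b j) (b k))"
      if "j \<in> I" "k \<in> I" for j k
      using linear_expand[OF F(1)] b that by simp
    then show "(\<Sum>j\<in>I. \<Sum>k\<in>I. \<Sum>i\<in>I. (pr x (e i) * pr y (mW (e k) (e j))) * F (b i) (b j) (b k))
      = D y (\<lambda>y1 y2. F x y1 y2)"
      by (simp add: D_def sum_distrib_left mult_ac)
  qed
  finally show ?thesis .
qed

lemma R_closed: "R v w \<in> W" and L_closed: "L v w \<in> W"
  using B.sum_scale_closed[OF finite_I e] by (simp_all add: R_def L_def)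

lemma pr_R: assumes "x \<in> V" "v \<in> V" "w \<in> W" shows "pr x (R v w) = pr (mV x v) w"
proof -
  have "pr x (R v w) = (\<Sum>j\<in>I. pr (mV (b j) v) w * pr x (e j))"
    unfolding R_def by (rule B.linear_on_sum_scale[OF pr_right[OF assms(1)] finite_I e])
  also have "\<dots> = pr (mV x v) w"
    using linear_expand[OF A.linear_on_mul(1)[OF pr_left], of w v x] assms by (simp add: mult.commute)
  finally show ?thesis .
qed

lemma pr_L: assumes "x \<in> V" "v \<in> V" "w \<in> W" shows "pr x (L v w) = pr (mV v x) w"
proof -
  have "pr x (L v w) = (\<Sum>j\<in>I. pr (mV v (b j)) w * pr x (e j))"
    unfolding L_def by (rule B.linear_on_sum_scale[OF pr_right[OF assms(1)] finite_I e])
  also have "\<dots> = pr (mV v x) w"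
    using linear_expand[OF A.linear_on_mul(2)[OF pr_left], of w v x] assms by (simp add: mult.commute)
  finally show ?thesis .
qed

text \<open>
  Linearity is only ever used after applying a functional, so it is stated in that form.
\<close>

definition bilinear_action :: "('v \<Rightarrow> 'w \<Rightarrow> 'w) \<Rightarrow> bool" where
  "bilinear_action a \<longleftrightarrow> (\<forall>v\<in>V. \<forall>w\<in>W. a v w \<in> W) \<and>
    (\<forall>f. linear_on W sW f \<longrightarrow>
      (\<forall>w\<in>W. linear_on V sV (\<lambda>v. f (a v w))) \<and> (\<forall>v\<in>V. linear_on W sW (\<lambda>w. f (a v w))))"

lemma bilinear_actionD:
  assumes "bilinear_action a"
  shows "v \<in> V \<Longrightarrow> w \<in> W \<Longrightarrow> a v w \<in> W"
    "linear_on W sW f \<Longrightarrow> w \<in> W \<Longrightarrow> linear_on V sV (\<lambda>v. f (a v w))"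
    "linear_on W sW f \<Longrightarrow> v \<in> V \<Longrightarrow> linear_on W sW (\<lambda>w. f (a v w))"
  using assms by (auto simp: bilinear_action_def)

lemma bilinear_action_R: "bilinear_action R"
  unfolding bilinear_action_def
proof (intro conjI ballI allI impI)
  fix f v w assume f: "linear_on W sW f"
  have "f (R v w) = (\<Sum>j\<in>I. pr (mV (b j) v) w * f (e j))" for v w
    unfolding R_def by (rule B.linear_on_sum_scale[OF f finite_I e])
  then show "w \<in> W \<Longrightarrow> linear_on V sV (\<lambda>v. f (R v w))" "v \<in> V \<Longrightarrow> linear_on W sW (\<lambda>w. f (R v w))"
    by (auto intro!: linear_on_sum linear_on_multc A.linear_on_mul pr_left pr_right A.mul_closed b)
qed (rule R_closed)

lemma bilinear_action_L: "bilinear_action L"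
  unfolding bilinear_action_def
proof (intro conjI ballI allI impI)
  fix f v w assume f: "linear_on W sW f"
  have "f (L v w) = (\<Sum>j\<in>I. pr (mV v (b j)) w * f (e j))" for v w
    unfolding L_def by (rule B.linear_on_sum_scale[OF f finite_I e])
  then show "w \<in> W \<Longrightarrow> linear_on V sV (\<lambda>v. f (L v w))" "v \<in> V \<Longrightarrow> linear_on W sW (\<lambda>w. f (L v w))"
    by (auto intro!: linear_on_sum linear_on_multc A.linear_on_mul pr_left pr_right A.mul_closed b)
qed (rule L_closed)

text \<open>
  Elements of \<open>W\<close> are separated by the pairing, so identities between the actions reduce to
  associativity in \<open>V\<close>.
\<close>

lemma R_R: assumes "v \<in> V" "v' \<in> V" "w \<in> W" shows "R v (R v' w) = R (mV v v') w"
  by (rule separated_right) (use assms in \<open>simp_all add: R_closed pr_R A.mul_closed A.mul_assoc\<close>)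

lemma L_L: assumes "v \<in> V" "v' \<in> V" "w \<in> W" shows "L v (L v' w) = L (mV v' v) w"
  by (rule separated_right) (use assms in \<open>simp_all add: L_closed pr_L A.mul_closed A.mul_assoc\<close>)

lemma R_L: assumes "v \<in> V" "v' \<in> V" "w \<in> W" shows "R v (L v' w) = L v' (R v w)"
  by (rule separated_right)
    (use assms in \<open>simp_all add: R_closed L_closed pr_R pr_L A.mul_closed A.mul_assoc\<close>)

text \<open>
  Exchanging the two algebras gives such a pair again; the prefix \<open>swap\<close> refers to it.  Contexts
  are closed and reopened below where results proved in them are needed for the exchanged pair.
\<close>

sublocale swap: dual_pair W sW mW oW V sV mV oV "\<lambda>w v. pr v w" I e b
  by unfold_locales
    (simp_all add: finite_I b e pr_left pr_right expand_left expand_right)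

lemma linear_R:
  assumes "linear_on W sW f" "v \<in> V" "w \<in> W"
  shows "f (R v w) = swap.D w (\<lambda>p q. pr v p * f q)"
proof -
  have "f (R v w) = (\<Sum>j\<in>I. pr (mV (b j) v) w * f (e j))"
    unfolding R_def by (rule B.linear_on_sum_scale[OF assms(1) finite_I e])
  also have "\<dots> = (\<Sum>j\<in>I. swap.D w (\<lambda>p q. pr v p * pr (b j) q) * f (e j))"
    using swap.D_pair assms b by simp
  also have "\<dots> = swap.D w (\<lambda>p q. \<Sum>j\<in>I. (pr v p * pr (b j) q) * f (e j))"
    by (simp add: swap.D_sum swap.D_multc)
  also have "\<dots> = swap.D w (\<lambda>p q. pr v p * (\<Sum>j\<in>I. pr (b j) q * f (e j)))"
    by (simp add: sum_distrib_left mult.assoc)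
  also have "\<dots> = swap.D w (\<lambda>p q. pr v p * f q)"
    by (rule swap.D_cong) (simp add: linear_expand_right[OF assms(1)])
  finally show ?thesis .
qed

lemma linear_L:
  assumes "linear_on W sW f" "v \<in> V" "w \<in> W"
  shows "f (L v w) = swap.D w (\<lambda>p q. pr v q * f p)"
proof -
  have "f (L v w) = (\<Sum>j\<in>I. pr (mV v (b j)) w * f (e j))"
    unfolding L_def by (rule B.linear_on_sum_scale[OF assms(1) finite_I e])
  also have "\<dots> = (\<Sum>j\<in>I. swap.D w (\<lambda>p q. pr (b j) p * pr v q) * f (e j))"
    using swap.D_pair assms b by simp
  also have "\<dots> = swap.D w (\<lambda>p q. \<Sum>j\<in>I. (pr (b j) p * pr v q) * f (e j))"
    by (simp add: swap.D_sum swap.D_multc)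
  also have "\<dots> = swap.D w (\<lambda>p q. pr v q * (\<Sum>j\<in>I. pr (b j) p * f (e j)))"
    by (simp add: sum_distrib_left mult_ac)
  also have "\<dots> = swap.D w (\<lambda>p q. pr v q * f p)"
    by (rule swap.D_cong) (simp add: linear_expand_right[OF assms(1)])
  finally show ?thesis .
qed

end

section \<open>Dual bialgebras and their actions on tuples\<close>

text \<open>
  The first assumption says that the coproduct of \<open>V\<close> is multiplicative, tested against two elements
  of \<open>W\<close>; expanding its right-hand side once more shows that it says the same about \<open>W\<close>.
\<close>

locale dual_bialgebras = dual_pair V sV mV oV W sW mW oW pr I b e
  for V :: "'v::ab_group_add set" and sV :: "'k::field \<Rightarrow> 'v \<Rightarrow> 'v" and mV oV
    and W :: "'w::ab_group_add set" and sW :: "'k \<Rightarrow> 'w \<Rightarrow> 'w" and mW oW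
    and pr :: "'v \<Rightarrow> 'w \<Rightarrow> 'k" and I :: "'i set" and b :: "'i \<Rightarrow> 'v" and e :: "'i \<Rightarrow> 'w" +
  assumes pr_mul_mul: "\<lbrakk>v \<in> V; v' \<in> V; w \<in> W; w' \<in> W\<rbrakk> \<Longrightarrow>
      pr (mV v v') (mW w w') = D v (\<lambda>x y. D v' (\<lambda>x' y'. pr (mV y y') w * pr (mV x x') w'))"
    and pr_mul_one: "v \<in> V \<Longrightarrow> v' \<in> V \<Longrightarrow> pr (mV v v') oW = pr v oW * pr v' oW"
    and pr_one_mul: "w \<in> W \<Longrightarrow> w' \<in> W \<Longrightarrow> pr oV (mW w w') = pr oV w * pr oV w'"
begin

text \<open>
  The multiplicativity of the coproduct, from functionals of the form \<open>\<langle>\<cdot>, w\<rangle> \<langle>\<cdot>, w'\<rangle>\<close> to all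
  bilinear \<open>F\<close>.
\<close>

lemma D_mul:
  assumes v: "v \<in> V" "v' \<in> V"
    and F: "\<And>y. y \<in> V \<Longrightarrow> linear_on V sV (\<lambda>x. F x y)" "\<And>x. x \<in> V \<Longrightarrow> linear_on V sV (F x)"
  shows "D (mV v v') F = D v (\<lambda>x y. D v' (\<lambda>x' y'. F (mV x x') (mV y y')))"
proof -
  have F_eq: "F x y = (\<Sum>i\<in>I. \<Sum>j\<in>I. pr y (e j) * pr x (e i) * F (b i) (b j))"
    if "x \<in> V" "y \<in> V" for x y
  proof -
    have "F x y = (\<Sum>i\<in>I. pr x (e i) * F (b i) y)"
      using linear_expand[OF F(1)] that by simp
    also have "\<dots> = (\<Sum>i\<in>I. pr x (e i) * (\<Sum>j\<in>I. pr y (e j) * F (b i) (b j)))"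
      using linear_expand[OF F(2)] that b by simp
    finally show ?thesis by (simp add: sum_distrib_left mult_ac)
  qed
  have "D (mV v v') F = (\<Sum>i\<in>I. \<Sum>j\<in>I.
      D v (\<lambda>x y. D v' (\<lambda>x' y'. pr (mV y y') (e j) * pr (mV x x') (e i))) * F (b i) (b j))"
    unfolding D_def[of "mV v v'"] using v e by (simp add: pr_mul_mul)
  also have "\<dots> = D v (\<lambda>x y. D v' (\<lambda>x' y'. \<Sum>i\<in>I. \<Sum>j\<in>I.
      pr (mV y y') (e j) * pr (mV x x') (e i) * F (b i) (b j)))"
    by (simp add: D_sum D_multc)
  also have "\<dots> = D v (\<lambda>x y. D v' (\<lambda>x' y'. F (mV x x') (mV y y')))"
    by (intro D_cong) (simp add: F_eq A.mul_closed)
  finally show ?thesis .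
qed

text \<open>
  The action of \<open>v\<close> on a tuple through the iterated coproduct, followed by \<open>F\<close>: the sum of
  \<open>F [a v\<^sub>(\<^sub>m\<^sub>) w\<^sub>1, \<dots>, a v\<^sub>(\<^sub>1\<^sub>) w\<^sub>m]\<close>.  The reversed order of the components is that of the pairings
  in \<open>\<pi>\<^sup>H\<close> and \<open>\<^sup>H\<pi>\<close>.
\<close>

primrec act :: "('v \<Rightarrow> 'w \<Rightarrow> 'w) \<Rightarrow> 'w list \<Rightarrow> 'v \<Rightarrow> ('w list \<Rightarrow> 'k) \<Rightarrow> 'k" where
  "act a [] v F = eps v * F []"
| "act a (w # ws) v F = D v (\<lambda>x y. act a ws x (\<lambda>qs. F (a y w # qs)))"

lemma eps_linear: "linear_on V sV eps"
  unfolding eps_def by (rule pr_left[OF B.one_closed])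

lemma act_cong:
  assumes "bilinear_action a" "ws \<in> tuples W m" "\<And>qs. qs \<in> tuples W m \<Longrightarrow> F qs = G qs"
  shows "act a ws v F = act a ws v G"
  using assms(2,3)
proof (induction ws arbitrary: m v F G)
  case (Cons w ws)
  then obtain m' where "m = Suc m'" "w \<in> W" "ws \<in> tuples W m'" by (cases m) auto
  then show ?case
    unfolding act.simps
    by (intro D_cong Cons.IH[of m'] Cons.prems(2)) (simp_all add: bilinear_actionD(1)[OF assms(1)])
qed simp

lemma act_cmult: "act a ws v (\<lambda>qs. c * F qs) = c * act a ws v F"
  by (induction ws arbitrary: v F) (simp_all add: D_cmult)

lemma act_add: "act a ws v (\<lambda>qs. F qs + G qs) = act a ws v F + act a ws v G"
  by (induction ws arbitrary: v F G) (simp_all add: D_add distrib_left)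

lemma act_zero: "act a ws v (\<lambda>qs. 0) = 0"
  by (induction ws arbitrary: v) (simp_all add: D_zero)

lemma act_sum: "act a ws v (\<lambda>qs. \<Sum>i\<in>J. F i qs) = (\<Sum>i\<in>J. act a ws v (F i))"
  by (induction J rule: infinite_finite_induct) (simp_all add: act_zero act_add)

lemma act_D: "act a ws v (\<lambda>qs. D v' (\<lambda>x y. F x y qs)) = D v' (\<lambda>x y. act a ws v (F x y))"
  by (simp add: D_def act_sum act_cmult)

lemma act_swap_D: "act a ws v (\<lambda>qs. swap.D w (\<lambda>x y. F x y qs)) = swap.D w (\<lambda>x y. act a ws v (F x y))"
  by (simp add: swap.D_def act_sum act_cmult)

lemma act_linear: "linear_on V sV (\<lambda>v. act a ws v F)"
  by (cases ws) (simp_all add: D_linear linear_on_multc eps_linear)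

lemma linear_on_act:
  assumes "bilinear_action a" "ws \<in> tuples W m"
    and "\<And>qs. qs \<in> tuples W m \<Longrightarrow> linear_on U t (\<lambda>u. F u qs)"
  shows "linear_on U t (\<lambda>u. act a ws v (F u))"
proof -
  have "act a ws v (F (x + y)) = act a ws v (F x) + act a ws v (F y)" if "x \<in> U" "y \<in> U" for x y
    unfolding act_add[symmetric]
    by (rule act_cong[OF assms(1,2)]) (rule linear_onD[OF assms(3)], auto simp: that)
  moreover have "act a ws v (F (t c x)) = c * act a ws v (F x)" if "x \<in> U" for c x
    unfolding act_cmult[symmetric]
    by (rule act_cong[OF assms(1,2)]) (rule linear_onD[OF assms(3)], auto simp: that)
  ultimately show ?thesis by (simp add: linear_on_def)
qed

lemma multilinear_on_act:
  assumes a: "bilinear_action a" and F: "multilinear_on W sW m F"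
  shows "multilinear_on W sW m (\<lambda>ws. act a ws v F)"
  using F
proof (induction m arbitrary: v F)
  case (Suc m)
  show ?case
  proof (rule multilinear_on_SucI)
    fix ws assume ws: "ws \<in> tuples W m"
    show "linear_on W sW (\<lambda>w. act a (w # ws) v F)"
      by (auto intro!: linear_on_D linear_on_act[OF a ws] bilinear_actionD(3)[OF a]
          intro: multilinear_on_hd[OF Suc.prems])
  next
    fix w assume w: "w \<in> W"
    have "multilinear_on W sW m (\<lambda>ws. act a ws x (\<lambda>qs. F (a y w # qs)))" if "y \<in> V" for x y
      using Suc.IH multilinear_on_Cons[OF Suc.prems] bilinear_actionD(1)[OF a] that w by blast
    then show "multilinear_on W sW m (\<lambda>vs. act a (w # vs) v F)"
      by (auto simp: D_def intro!: multilinear_on_sum multilinear_on_cmult b)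
  qed
qed simp

text \<open>
  Splitting off the last instead of the first entry is coassociativity; it is needed because the
  outer faces of the other direction remove either end of the tuple.
\<close>

lemma act_snoc:
  assumes a: "bilinear_action a" and "multilinear_on W sW (Suc m) F" "ws \<in> tuples W m" "w \<in> W" "v \<in> V"
  shows "act a (ws @ [w]) v F = D v (\<lambda>x y. act a ws y (\<lambda>qs. F (qs @ [a x w])))"
  using assms(2-)
proof (induction ws arbitrary: m v F)
  case Nil
  then have "linear_on V sV (\<lambda>y. F [a y w])"
    using bilinear_actionD(2)[OF a multilinear_on_hd[OF Nil(1)]] by simp
  then show ?case using D_eps[OF \<open>v \<in> V\<close>, of "\<lambda>y. F [a y w]"] by (simp add: mult.commute)
next
  case (Cons u us)
  then obtain k where m: "m = Suc k" "u \<in> W" "us \<in> tuples W k" by (cases m) auto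
  note F = Cons.prems(1)[unfolded m(1)]
  note cl = bilinear_actionD(1)[OF a]
  have "act a ((u # us) @ [w]) v F
      = D v (\<lambda>x y. D x (\<lambda>x1 x2. act a us x2 (\<lambda>qs. F (a y u # qs @ [a x1 w]))))"
    unfolding append_Cons act.simps using Cons.prems m cl
    by (intro D_cong) (simp add: Cons.IH[of k] multilinear_on_Cons[OF F])
  also have "\<dots> = D v (\<lambda>x y. D y (\<lambda>y1 y2. act a us y1 (\<lambda>qs. F (a y2 u # qs @ [a x w]))))"
  proof (rule D_coassoc[OF \<open>v \<in> V\<close>])
    fix y z assume *: "y \<in> V" "z \<in> V"
    then show "linear_on V sV (\<lambda>x. act a us y (\<lambda>qs. F (a z u # qs @ [a x w])))"
      using m Cons.prems cl
      by (auto intro!: linear_on_act[OF a m(3)] bilinear_actionD(2)[OF a]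
          multilinear_on_last multilinear_on_Cons[OF F])
    show "linear_on V sV (\<lambda>z. act a us y (\<lambda>qs. F (a z u # qs @ [a x w])))" if "x \<in> V" for x
      using m Cons.prems cl that
      by (auto intro!: linear_on_act[OF a m(3)] bilinear_actionD(2)[OF a] multilinear_on_hd[OF F])
  qed
  finally show ?case by simp
qed

text \<open>
  The module algebra law, with the flip that comes from the convention for the product on the dual.
\<close>

definition multiplicative :: "('v \<Rightarrow> 'w \<Rightarrow> 'w) \<Rightarrow> bool" where
  "multiplicative a \<longleftrightarrow> (\<forall>f. linear_on W sW f \<longrightarrow> (\<forall>v\<in>V. \<forall>w\<in>W. \<forall>w'\<in>W.
     f (a v (mW w w')) = D v (\<lambda>x y. f (mW (a y w) (a x w')))))"

lemma multiplicativeD: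
  assumes "multiplicative a" "linear_on W sW f" "v \<in> V" "w \<in> W" "w' \<in> W"
  shows "f (a v (mW w w')) = D v (\<lambda>x y. f (mW (a y w) (a x w')))"
  using assms by (simp add: multiplicative_def)

text \<open>
  Both sides are compared on the basis elements \<open>b j\<close>: \<open>\<langle>w \<cdot> w', b j \<cdot> v\<rangle>\<close> splits into four
  pairings by the multiplicativity of the coproduct, and these reassemble to the pairing of \<open>b j\<close>
  with a product in \<open>W\<close>.
\<close>

lemma multiplicative_R: "multiplicative R"
  unfolding multiplicative_def
proof (intro allI impI ballI)
  fix f v w w' assume f: "linear_on W sW f" and *: "v \<in> V" "w \<in> W" "w' \<in> W"
  have "f (R v (mW w w')) = (\<Sum>j\<in>I. pr (mV (b j) v) (mW w w') * f (e j))"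
    unfolding R_def by (rule B.linear_on_sum_scale[OF f finite_I e])
  also have "\<dots> = (\<Sum>j\<in>I. D v (\<lambda>x y. pr (b j) (mW (R y w) (R x w'))) * f (e j))"
  proof (intro sum.cong refl arg_cong2[where f = "(*)"])
    fix j assume j: "j \<in> I"
    have "pr (mV (b j) v) (mW w w') = D (b j) (\<lambda>x y. D v (\<lambda>x' y'. pr y (R y' w) * pr x (R x' w')))"
      using * b[OF j] by (simp add: pr_mul_mul pr_R cong: D_cong)
    also have "\<dots> = D v (\<lambda>x' y'. D (b j) (\<lambda>x y. pr x (R x' w') * pr y (R y' w)))"
      by (subst D_swap) (simp add: mult.commute)
    also have "\<dots> = D v (\<lambda>x y. pr (b j) (mW (R y w) (R x w')))"
      using b[OF j] R_closed by (simp add: D_pair)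
    finally show "pr (mV (b j) v) (mW w w') = D v (\<lambda>x y. pr (b j) (mW (R y w) (R x w')))" .
  qed
  also have "\<dots> = D v (\<lambda>x y. f (mW (R y w) (R x w')))"
    unfolding D_multc[symmetric] D_sum[symmetric]
    by (rule D_cong) (simp add: linear_expand_right[OF f] B.mul_closed R_closed)
  finally show "f (R v (mW w w')) = D v (\<lambda>x y. f (mW (R y w) (R x w')))" .
qed

lemma multiplicative_L: "multiplicative L"
  unfolding multiplicative_def
proof (intro allI impI ballI)
  fix f v w w' assume f: "linear_on W sW f" and *: "v \<in> V" "w \<in> W" "w' \<in> W"
  have "f (L v (mW w w')) = (\<Sum>j\<in>I. pr (mV v (b j)) (mW w w') * f (e j))"
    unfolding L_def by (rule B.linear_on_sum_scale[OF f finite_I e])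
  also have "\<dots> = (\<Sum>j\<in>I. D v (\<lambda>x y. pr (b j) (mW (L y w) (L x w'))) * f (e j))"
  proof (intro sum.cong refl arg_cong2[where f = "(*)"])
    fix j assume j: "j \<in> I"
    have "pr (mV v (b j)) (mW w w') = D v (\<lambda>x y. D (b j) (\<lambda>x' y'. pr x' (L x w') * pr y' (L y w)))"
      using * b[OF j] by (simp add: pr_mul_mul pr_L mult.commute cong: D_cong)
    also have "\<dots> = D v (\<lambda>x y. pr (b j) (mW (L y w) (L x w')))"
      using b[OF j] L_closed by (simp add: D_pair)
    finally show "pr (mV v (b j)) (mW w w') = D v (\<lambda>x y. pr (b j) (mW (L y w) (L x w')))" .
  qed
  also have "\<dots> = D v (\<lambda>x y. f (mW (L y w) (L x w')))"
    unfolding D_multc[symmetric] D_sum[symmetric]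
    by (rule D_cong) (simp add: linear_expand_right[OF f] B.mul_closed L_closed)
  finally show "f (L v (mW w w')) = D v (\<lambda>x y. f (mW (L y w) (L x w')))" .
qed

text \<open>
  The module algebra law at the contracted entry uses a coproduct of the component that acts there;
  by coassociativity the two parts become the neighbouring components of the longer tuple.
\<close>

lemma act_contract:
  assumes a: "bilinear_action a" "multiplicative a"
    and "multilinear_on W sW m F" "ws \<in> tuples W (Suc m)" "0 < i" "i \<le> m" "v \<in> V"
  shows "act a (contract mW i ws) v F = act a ws v (\<lambda>qs. F (contract mW i qs))"
  using assms(3-)
proof (induction i arbitrary: m ws v F)
  case (Suc i)
  then obtain k w ws' where k: "m = Suc k" "ws = w # ws'" "w \<in> W" "ws' \<in> tuples W (Suc k)"
    by (cases m; cases ws) auto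
  note F = Suc.prems(1)[unfolded k(1)]
  note cl = bilinear_actionD(1)[OF a(1)]
  show ?case
  proof (cases "i = 0")
    case True
    obtain w' zs where w': "ws' = w' # zs" "w' \<in> W" "zs \<in> tuples W k"
      using k by (cases ws') auto
    have "act a (contract mW (Suc i) ws) v F = D v (\<lambda>x y. act a zs x (\<lambda>qs. F (a y (mW w w') # qs)))"
      using k w' True by (simp add: contract_def)
    also have "\<dots> = D v (\<lambda>x y. D y (\<lambda>y1 y2. act a zs x (\<lambda>qs. F (mW (a y2 w) (a y1 w') # qs))))"
    proof (rule D_cong)
      fix x y assume "x \<in> V" "y \<in> V"
      have "act a zs x (\<lambda>qs. F (a y (mW w w') # qs))
          = act a zs x (\<lambda>qs. D y (\<lambda>y1 y2. F (mW (a y2 w) (a y1 w') # qs)))"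
      proof (rule act_cong[OF a(1) w'(3)])
        fix qs assume "qs \<in> tuples W k"
        then show "F (a y (mW w w') # qs) = D y (\<lambda>y1 y2. F (mW (a y2 w) (a y1 w') # qs))"
          by (rule multiplicativeD[OF a(2) multilinear_on_hd[OF F] \<open>y \<in> V\<close> k(3) w'(2)])
      qed
      then show "act a zs x (\<lambda>qs. F (a y (mW w w') # qs))
          = D y (\<lambda>y1 y2. act a zs x (\<lambda>qs. F (mW (a y2 w) (a y1 w') # qs)))"
        by (simp add: act_D)
    qed
    also have "\<dots> = D v (\<lambda>x y. D x (\<lambda>x1 x2. act a zs x1 (\<lambda>qs. F (mW (a y w) (a x2 w') # qs))))"
    proof (rule D_coassoc[OF \<open>v \<in> V\<close>, symmetric])
      fix x y assume "x \<in> V" "y \<in> V"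
      then show "linear_on V sV (\<lambda>z. act a zs x (\<lambda>qs. F (mW (a z w) (a y w') # qs)))"
        using k w' cl
        by (auto intro!: linear_on_act[OF a(1) w'(3)] bilinear_actionD(2)[OF a(1)]
            B.linear_on_mul multilinear_on_hd[OF F])
    qed (rule act_linear)
    also have "\<dots> = act a ws v (\<lambda>qs. F (contract mW (Suc i) qs))"
      using k w' True by (simp add: contract_def)
    finally show ?thesis .
  next
    case False
    have "act a (contract mW (Suc i) ws) v F = D v (\<lambda>x y. act a (contract mW i ws') x (\<lambda>qs. F (a y w # qs)))"
      using k False by (simp add: contract_Suc_Cons)
    also have "\<dots> = D v (\<lambda>x y. act a ws' x (\<lambda>qs. F (a y w # contract mW i qs)))"
      using k False Suc.prems(4) cl
      by (intro D_cong Suc.IH[of k]) (auto intro!: multilinear_on_Cons[OF F])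
    finally show ?thesis using k False by (simp add: contract_Suc_Cons)
  qed
qed simp

text \<open>
  A left and a right action differ only in the order of the product, so the module axiom for
  tuples is proved for a product \<open>p\<close> that may be \<open>mV\<close> or its opposite.
\<close>

lemma act_act:
  assumes a: "bilinear_action a"
    and p: "\<And>v v' w. v \<in> V \<Longrightarrow> v' \<in> V \<Longrightarrow> w \<in> W \<Longrightarrow> a v (a v' w) = a (p v v') w"
      "\<And>v v' F. \<lbrakk>v \<in> V; v' \<in> V; \<And>y. y \<in> V \<Longrightarrow> linear_on V sV (\<lambda>x. F x y);
          \<And>x. x \<in> V \<Longrightarrow> linear_on V sV (F x)\<rbrakk> \<Longrightarrow>
        D (p v v') F = D v' (\<lambda>x y. D v (\<lambda>x' y'. F (p x' x) (p y' y)))"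
      "\<And>v v'. v \<in> V \<Longrightarrow> v' \<in> V \<Longrightarrow> eps (p v v') = eps v * eps v'"
    and "multilinear_on W sW m F" "ws \<in> tuples W m" "v \<in> V" "v' \<in> V"
  shows "act a ws v' (\<lambda>qs. act a qs v F) = act a ws (p v v') F"
  using assms(5-)
proof (induction ws arbitrary: m v v' F)
  case Nil
  then show ?case by (simp add: p(3) mult_ac)
next
  case (Cons w ws)
  then obtain k where k: "m = Suc k" "w \<in> W" "ws \<in> tuples W k" by (cases m) auto
  note F = Cons.prems(1)[unfolded k(1)]
  note cl = bilinear_actionD(1)[OF a]
  have "act a (w # ws) v' (\<lambda>qs. act a qs v F) = D v' (\<lambda>x y. D v (\<lambda>x' y'.
      act a ws x (\<lambda>qs. act a qs x' (\<lambda>rs. F (a y' (a y w) # rs)))))"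
    by (simp add: act_D)
  also have "\<dots> = D v' (\<lambda>x y. D v (\<lambda>x' y'. act a ws (p x' x) (\<lambda>rs. F (a (p y' y) w # rs))))"
  proof (intro D_cong)
    fix x y x' y' assume *: "x \<in> V" "y \<in> V" "x' \<in> V" "y' \<in> V"
    have "act a ws x (\<lambda>qs. act a qs x' (\<lambda>rs. F (a y' (a y w) # rs)))
        = act a ws (p x' x) (\<lambda>rs. F (a y' (a y w) # rs))"
      by (rule Cons.IH[OF multilinear_on_Cons[OF F cl[OF *(4) cl[OF *(2) k(2)]]] k(3) *(3,1)])
    then show "act a ws x (\<lambda>qs. act a qs x' (\<lambda>rs. F (a y' (a y w) # rs)))
        = act a ws (p x' x) (\<lambda>rs. F (a (p y' y) w # rs))"
      using p(1) * k by simp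
  qed
  also have "\<dots> = D (p v v') (\<lambda>x y. act a ws x (\<lambda>rs. F (a y w # rs)))"
    using Cons.prems k
    by (intro p(2)[symmetric] act_linear linear_on_act[OF a k(3)] bilinear_actionD(2)[OF a]
        multilinear_on_hd[OF F]) auto
  finally show ?case by simp
qed

lemma act_R_act_R:
  assumes "multilinear_on W sW m F" "ws \<in> tuples W m" "v \<in> V" "v' \<in> V"
  shows "act R ws v' (\<lambda>qs. act R qs v F) = act R ws (mV v v') F"
proof (rule act_act[OF bilinear_action_R _ _ _ assms])
  fix v v' :: 'v and F :: "'v \<Rightarrow> 'v \<Rightarrow> 'k"
  assume "v \<in> V" "v' \<in> V" "\<And>y. y \<in> V \<Longrightarrow> linear_on V sV (\<lambda>x. F x y)"
    "\<And>x. x \<in> V \<Longrightarrow> linear_on V sV (F x)"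
  then show "D (mV v v') F = D v' (\<lambda>x y. D v (\<lambda>x' y'. F (mV x' x) (mV y' y)))"
    by (subst D_swap) (rule D_mul)
qed (simp_all add: R_R eps_def pr_mul_one)

lemma act_L_act_L:
  assumes "multilinear_on W sW m F" "ws \<in> tuples W m" "v \<in> V" "v' \<in> V"
  shows "act L ws v' (\<lambda>qs. act L qs v F) = act L ws (mV v' v) F"
  by (rule act_act[OF bilinear_action_L _ _ _ assms])
    (simp_all add: L_L eps_def pr_mul_one mult.commute D_mul)

lemma act_R_act_L:
  assumes "ws \<in> tuples W m" "v \<in> V" "v' \<in> V"
  shows "act R ws v (\<lambda>qs. act L qs v' F) = act L ws v' (\<lambda>qs. act R qs v F)"
  using assms
proof (induction ws arbitrary: m v v' F)
  case (Cons w ws)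
  then obtain k where k: "w \<in> W" "ws \<in> tuples W k" by (cases m) auto
  have "act R (w # ws) v (\<lambda>qs. act L qs v' F)
      = D v (\<lambda>x y. D v' (\<lambda>x' y'. act R ws x (\<lambda>qs. act L qs x' (\<lambda>rs. F (L y' (R y w) # rs)))))"
    by (simp add: act_D)
  also have "\<dots> = D v (\<lambda>x y. D v' (\<lambda>x' y'. act L ws x' (\<lambda>qs. act R qs x (\<lambda>rs. F (R y (L y' w) # rs)))))"
    using k by (intro D_cong) (simp add: R_L Cons.IH)
  also have "\<dots> = act L (w # ws) v' (\<lambda>qs. act R qs v F)"
    by (subst D_swap) (simp add: act_D)
  finally show ?case .
qed (simp add: mult.left_commute)

text \<open>
  Both sides of the multiplicativity law are the sum of four pairings of components, once the two
  pairings with products are split.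
\<close>

sublocale swap: dual_bialgebras W sW mW oW V sV mV oV "\<lambda>w v. pr v w" I e b
proof unfold_locales
  fix v v' w w' assume *: "v \<in> W" "v' \<in> W" "w \<in> V" "w' \<in> V"
  have "pr (mV w w') (mW v v') = D w (\<lambda>x y. D w' (\<lambda>x' y'. pr (mV y y') v * pr (mV x x') v'))"
    using * by (simp add: pr_mul_mul)
  also have "\<dots> = D w (\<lambda>x y. D w' (\<lambda>x' y'. swap.D v (\<lambda>p q. pr y' p * pr y q) *
      swap.D v' (\<lambda>p' q'. pr x' p' * pr x q')))"
    using * by (intro D_cong) (simp add: swap.D_pair)
  also have "\<dots> = D w (\<lambda>x y. D w' (\<lambda>x' y'. swap.D v (\<lambda>p q. swap.D v' (\<lambda>p' q'.
      (pr x q' * pr y q) * (pr x' p' * pr y' p)))))"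
    by (simp add: swap.D_multc[symmetric] swap.D_cmult[symmetric] mult_ac)
  also have "\<dots> = swap.D v (\<lambda>p q. swap.D v' (\<lambda>p' q'. D w (\<lambda>x y. D w' (\<lambda>x' y'.
      (pr x q' * pr y q) * (pr x' p' * pr y' p)))))"
    by (simp add: swap.D_def D_sum D_cmult)
  also have "\<dots> = swap.D v (\<lambda>p q. swap.D v' (\<lambda>p' q'. pr w (mW q q') * pr w' (mW p p')))"
    using * by (intro swap.D_cong) (simp add: D_cmult D_multc D_pair)
  finally show "pr (mV w w') (mW v v') =
    swap.D v (\<lambda>x y. swap.D v' (\<lambda>x' y'. pr w (mW y y') * pr w' (mW x x')))" .
qed (simp_all add: pr_mul_one pr_one_mul)

end

context dual_bialgebras
begin

text \<open>
  Here \<open>V\<close> acts on a tuple over \<open>W\<close> and \<open>W\<close> on an unrelated tuple over \<open>V\<close>; both are finite sums, so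
  they can be interchanged for arbitrary \<open>F\<close>.
\<close>

lemma act_swap_act:
  "act a ws v (\<lambda>qs. swap.act a' vs w (\<lambda>us. F us qs)) = swap.act a' vs w (\<lambda>us. act a ws v (F us))"
  by (induction vs arbitrary: w F) (simp_all add: act_cmult act_swap_D)

end

section \<open>Faces of multilinear forms\<close>

text \<open>
  The usual cancellation: the pairs with \<open>i < j\<close> are matched with the remaining ones by
  \<open>(j, i) \<mapsto> (i, j - 1)\<close>, which reverses the sign.
\<close>

lemma presimplicial_sum_zero:
  fixes f :: "nat \<Rightarrow> nat \<Rightarrow> 'a::comm_ring_1"
  assumes "\<And>i j. i < j \<Longrightarrow> j \<le> Suc n \<Longrightarrow> f j i = f i (j - 1)"
  shows "(\<Sum>j\<le>Suc n. \<Sum>i\<le>n. (-1) ^ (i + j) * f j i) = 0"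
proof -
  let ?A = "{(j, i). i < j \<and> j \<le> Suc n}" and ?B = "{(j, i). j \<le> i \<and> i \<le> n}"
  have fin: "finite ?A" "finite ?B"
    by (rule finite_subset[of _ "{..Suc n} \<times> {..Suc n}"], auto)+
  have sign: "- ((-1) ^ (j + i - Suc 0) * x) = (-1) ^ (j + i) * x" if "i < j" for i j and x :: 'a
    using that by (cases j) auto
  have "(\<Sum>j\<le>Suc n. \<Sum>i\<le>n. (-1) ^ (i + j) * f j i) = (\<Sum>(j, i)\<in>?A \<union> ?B. (-1) ^ (i + j) * f j i)"
    unfolding sum.cartesian_product by (rule sum.cong) auto
  also have "\<dots> = (\<Sum>(j, i)\<in>?A. (-1) ^ (i + j) * f j i) + (\<Sum>(j, i)\<in>?B. (-1) ^ (i + j) * f j i)"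
    using fin by (intro sum.union_disjoint) auto
  also have "(\<Sum>(j, i)\<in>?A. (-1) ^ (i + j) * f j i) = (\<Sum>(j, i)\<in>?B. - ((-1) ^ (i + j) * f j i))"
    by (rule sum.reindex_bij_witness[of _ "\<lambda>(j, i). (Suc i, j)" "\<lambda>(j, i). (i, j - 1)"])
      (auto simp: assms sign add.commute)
  finally show ?thesis by (simp add: sum_negf case_prod_unfold)
qed

context dual_bialgebras
begin

definition form :: "nat \<Rightarrow> nat \<Rightarrow> ('v list \<Rightarrow> 'w list \<Rightarrow> 'k) \<Rightarrow> bool" where
  "form n m \<phi> \<longleftrightarrow> (\<forall>ws\<in>tuples W m. multilinear_on V sV n (\<lambda>vs. \<phi> vs ws)) \<and>
     (\<forall>vs\<in>tuples V n. multilinear_on W sW m (\<phi> vs))"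

text \<open>
  The transposes of the faces of the Hochschild complex of \<open>V\<close> with coefficients in tuples over
  \<open>W\<close>.  The coefficients \<open>\<alpha>\<close> and \<open>\<beta>\<close> switch the outer faces on or off.
\<close>

definition face :: "'k \<Rightarrow> 'k \<Rightarrow> nat \<Rightarrow> ('v list \<Rightarrow> 'w list \<Rightarrow> 'k) \<Rightarrow> 'v list \<Rightarrow> 'w list \<Rightarrow> 'k" where
  "face \<alpha> \<beta> i \<phi> vs ws =
    (if i = 0 then \<alpha> * act L ws (hd vs) (\<phi> (tl vs))
     else if i = length vs then \<beta> * act R ws (last vs) (\<phi> (butlast vs))
     else \<phi> (contract mV i vs) ws)"

definition boundary where
  "boundary \<alpha> \<beta> n \<phi> vs ws = (\<Sum>i\<le>n. (-1) ^ i * face \<alpha> \<beta> i \<phi> vs ws)"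

lemma formD:
  assumes "form n m \<phi>"
  shows "ws \<in> tuples W m \<Longrightarrow> multilinear_on V sV n (\<lambda>vs. \<phi> vs ws)"
    "vs \<in> tuples V n \<Longrightarrow> multilinear_on W sW m (\<phi> vs)"
  using assms by (auto simp: form_def)

lemma face_first: "face \<alpha> \<beta> 0 \<phi> vs = (\<lambda>ws. \<alpha> * act L ws (hd vs) (\<phi> (tl vs)))"
  by (simp add: face_def fun_eq_iff)

lemma face_last:
  "vs \<in> tuples V (Suc n) \<Longrightarrow> face \<alpha> \<beta> (Suc n) \<phi> vs = (\<lambda>ws. \<beta> * act R ws (last vs) (\<phi> (butlast vs)))"
  by (simp add: face_def tuples_def fun_eq_iff)

lemma face_inner:
  "vs \<in> tuples V (Suc n) \<Longrightarrow> 0 < i \<Longrightarrow> i \<le> n \<Longrightarrow> face \<alpha> \<beta> i \<phi> vs = \<phi> (contract mV i vs)"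
  by (simp add: face_def tuples_def fun_eq_iff)

lemma face_sum:
  "face \<alpha> \<beta> i (\<lambda>vs ws. \<Sum>j\<in>J. c j * F j vs ws) vs ws = (\<Sum>j\<in>J. c j * face \<alpha> \<beta> i (F j) vs ws)"
  by (simp add: face_def act_sum act_cmult sum_distrib_left mult.left_commute)

lemma multilinear_on_act_parameter:
  assumes "bilinear_action a" "ws \<in> tuples W m"
    and "\<And>qs. qs \<in> tuples W m \<Longrightarrow> multilinear_on U t n (\<lambda>us. F us qs)"
  shows "multilinear_on U t n (\<lambda>us. act a ws v (F us))"
  unfolding multilinear_on_def
  by (intro allI impI linear_on_act[OF assms(1,2)]) (rule multilinear_onD[OF assms(3)])

lemma contract_tuples_V:
  "vs \<in> tuples V (Suc n) \<Longrightarrow> 0 < i \<Longrightarrow> i \<le> n \<Longrightarrow> contract mV i vs \<in> tuples V n"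
  by (rule contract_tuples) (auto simp: A.mul_closed)

lemma tuples_ends:
  "vs \<in> tuples V (Suc n) \<Longrightarrow> hd vs \<in> V \<and> tl vs \<in> tuples V n \<and> last vs \<in> V \<and> butlast vs \<in> tuples V n"
  by (cases vs; cases vs rule: rev_cases) (auto simp: tuples_def dest: in_set_butlastD)

lemma form_face:
  assumes "form n m \<phi>" "i \<le> Suc n"
  shows "form (Suc n) m (face \<alpha> \<beta> i \<phi>)"
proof -
  consider "i = 0" | "i = Suc n" | "0 < i" "i \<le> n" using assms(2) by linarith
  then show ?thesis
  proof cases
    case 1
    show ?thesis
      unfolding form_def 1 face_first
    proof (intro conjI ballI multilinear_on_cmult)
      fix ws assume "ws \<in> tuples W m"
      then show "multilinear_on V sV (Suc n) (\<lambda>vs. act L ws (hd vs) (\<phi> (tl vs)))"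
        by (intro multilinear_on_SucI)
          (simp_all add: act_linear multilinear_on_act_parameter[OF bilinear_action_L] formD[OF assms(1)])
    next
      fix vs assume "vs \<in> tuples V (Suc n)"
      then show "multilinear_on W sW m (\<lambda>ws. act L ws (hd vs) (\<phi> (tl vs)))"
        using tuples_ends by (simp add: multilinear_on_act bilinear_action_L formD(2)[OF assms(1)])
    qed
  next
    case 2
    have *: "multilinear_on V sV (Suc n) (\<lambda>vs. \<beta> * act R ws (last vs) (\<phi> (butlast vs)))"
      if "ws \<in> tuples W m" for ws
      using that by (intro multilinear_on_cmult multilinear_on_Suc_snocI)
          (simp_all add: act_linear multilinear_on_act_parameter[OF bilinear_action_R] formD[OF assms(1)])
    have "multilinear_on V sV (Suc n) (\<lambda>vs. face \<alpha> \<beta> i \<phi> vs ws)" if "ws \<in> tuples W m" for ws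
      unfolding 2 by (rule multilinear_on_cong[OF *[OF that]]) (simp_all add: that face_last A.add_closed A.scale_closed)
    moreover have "multilinear_on W sW m (face \<alpha> \<beta> i \<phi> vs)" if "vs \<in> tuples V (Suc n)" for vs
      unfolding 2 face_last[OF that] using tuples_ends[OF that]
      by (simp add: multilinear_on_cmult multilinear_on_act bilinear_action_R formD(2)[OF assms(1)])
    ultimately show ?thesis by (simp add: form_def)
  next
    case 3
    have *: "multilinear_on V sV (Suc n) (\<lambda>vs. \<phi> (contract mV i vs) ws)" if "ws \<in> tuples W m" for ws
      using 3 that by (intro multilinear_on_contract formD[OF assms(1)])
        (simp_all add: A.mul_closed A.mul_add A.mul_scale)
    have "multilinear_on V sV (Suc n) (\<lambda>vs. face \<alpha> \<beta> i \<phi> vs ws)" if "ws \<in> tuples W m" for ws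
      by (rule multilinear_on_cong[OF *[OF that]]) (simp_all add: 3 that face_inner A.add_closed A.scale_closed)
    moreover have "multilinear_on W sW m (face \<alpha> \<beta> i \<phi> vs)" if "vs \<in> tuples V (Suc n)" for vs
      unfolding face_inner[OF that 3] by (rule formD(2)[OF assms(1) contract_tuples_V[OF that 3]])
    ultimately show ?thesis by (simp add: form_def)
  qed
qed

lemma form_boundary:
  assumes "form n m \<phi>"
  shows "form (Suc n) m (boundary \<alpha> \<beta> (Suc n) \<phi>)"
  unfolding form_def boundary_def
  by (intro conjI ballI multilinear_on_sum multilinear_on_cmult formD) (simp_all add: form_face[OF assms])

text \<open>
  Idempotency of the coefficients enters when both faces are outer faces at the same end: their
  composite carries the square of the coefficient, and a single outer face after a contraction
  carries the coefficient itself.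
\<close>

lemma face_face:
  assumes \<phi>: "form n m \<phi>" and vs: "vs \<in> tuples V (Suc (Suc n))" and ws: "ws \<in> tuples W m"
    and ij: "i < j" "j \<le> Suc (Suc n)" and idem: "\<alpha> * \<alpha> = \<alpha>" "\<beta> * \<beta> = \<beta>"
  shows "face \<alpha> \<beta> j (face \<alpha> \<beta> i \<phi>) vs ws = face \<alpha> \<beta> i (face \<alpha> \<beta> (j - 1) \<phi>) vs ws"
proof -
  note ends = tuples_ends[OF vs]
  consider (first) "i = 0" "j = 1" | (first_inner) "i = 0" "1 < j" "j \<le> Suc n"
    | (outer) "i = 0" "j = Suc (Suc n)" | (inner) "0 < i" "j \<le> Suc n"
    | (inner_last) "0 < i" "i \<le> n" "j = Suc (Suc n)" | (last) "i = Suc n" "j = Suc (Suc n)"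
    using ij by linarith
  then show ?thesis
  proof cases
    case first
    obtain x y us where v: "vs = x # y # us" "x \<in> V" "y \<in> V" "us \<in> tuples V n"
      using vs by (cases vs; cases "tl vs") auto
    have "act L ws x (\<lambda>qs. \<alpha> * act L qs y (\<phi> us)) = \<alpha> * act L ws (mV x y) (\<phi> us)"
      unfolding act_cmult using act_L_act_L[OF formD(2)[OF \<phi> v(4)] ws] v by simp
    moreover have "contract mV (Suc 0) vs = mV x y # us" using v by (simp add: contract_def)
    ultimately show ?thesis
      using v first by (simp add: face_first face_inner[OF vs, unfolded v(1)] idem mult.assoc[symmetric])
  next
    case first_inner
    obtain k where k: "j = Suc k" "0 < k" "k \<le> n" using first_inner by (cases j) auto
    obtain x us where v: "vs = x # us" "us \<in> tuples V (Suc n)" using vs by (cases vs) auto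
    have "face \<alpha> \<beta> j (face \<alpha> \<beta> 0 \<phi>) vs ws = \<alpha> * act L ws x (\<phi> (contract mV k us))"
      using first_inner v k by (simp add: face_inner[OF vs, unfolded v(1)] face_first contract_Suc_Cons)
    also have "\<dots> = face \<alpha> \<beta> 0 (face \<alpha> \<beta> (j - 1) \<phi>) vs ws"
      using v k by (simp add: face_first face_inner[OF v(2)])
    finally show ?thesis using first_inner by simp
  next
    case outer
    have "face \<alpha> \<beta> j (face \<alpha> \<beta> 0 \<phi>) vs ws
        = \<beta> * (\<alpha> * act R ws (last vs) (\<lambda>qs. act L qs (hd (butlast vs)) (\<phi> (tl (butlast vs)))))"
      by (simp add: outer face_last[OF vs] face_first act_cmult)
    also have "\<dots> = \<beta> * (\<alpha> * act L ws (hd vs) (\<lambda>qs. act R qs (last (tl vs)) (\<phi> (butlast (tl vs)))))"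
    proof -
      obtain x us y where v: "vs = x # us @ [y]"
        using vs by (cases vs; cases "tl vs" rule: rev_cases) auto
      then show ?thesis using act_R_act_L[OF ws] vs by (simp add: tuples_def)
    qed
    also have "\<dots> = face \<alpha> \<beta> 0 (face \<alpha> \<beta> (j - 1) \<phi>) vs ws"
      using ends by (simp add: outer face_last face_first act_cmult mult.left_commute)
    finally show ?thesis using outer by simp
  next
    case inner
    have c: "contract mV j vs \<in> tuples V (Suc n)" "contract mV i vs \<in> tuples V (Suc n)"
      using contract_tuples_V[OF vs] inner ij by auto
    have "contract mV i (contract mV j vs) = contract mV (j - 1) (contract mV i vs)"
      by (rule contract_contract[OF vs]) (use inner ij A.mul_assoc in auto)
    then show ?thesis
      using inner ij by (simp add: face_inner[OF vs] face_inner[OF c(1)] face_inner[OF c(2)])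
  next
    case inner_last
    obtain us y where v: "vs = us @ [y]" "us \<in> tuples V (Suc n)" "y \<in> V"
      using vs by (cases vs rule: rev_cases) auto
    have c: "contract mV i vs = contract mV i us @ [y]"
      using v inner_last by (simp add: contract_snoc tuples_def)
    have "face \<alpha> \<beta> j (face \<alpha> \<beta> i \<phi>) vs ws = \<beta> * act R ws y (\<phi> (contract mV i us))"
      using v inner_last by (simp add: face_last[OF vs, unfolded v(1)] face_inner[OF v(2)])
    also have "\<dots> = face \<alpha> \<beta> (Suc n) \<phi> (contract mV i vs) ws"
      using contract_tuples_V[OF vs, of i] inner_last c by (simp add: face_last)
    also have "\<dots> = face \<alpha> \<beta> i (face \<alpha> \<beta> (j - 1) \<phi>) vs ws"
      using inner_last by (simp add: face_inner[OF vs] del: tuples_simps)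
    finally show ?thesis .
  next
    case last
    obtain us x y where v: "vs = us @ [x, y]" "us \<in> tuples V n" "x \<in> V" "y \<in> V"
      using vs by (cases vs rule: rev_cases; cases "butlast vs" rule: rev_cases) (auto simp: tuples_def)
    have c: "contract mV (Suc n) vs = us @ [mV x y]" "contract mV (Suc n) vs \<in> tuples V (Suc n)"
      using v contract_append[of mV us x y "[]"] A.mul_closed by (auto simp: tuples_def)
    have "act R ws y (\<lambda>qs. \<beta> * act R qs x (\<phi> us)) = \<beta> * act R ws (mV x y) (\<phi> us)"
      unfolding act_cmult using act_R_act_R[OF formD(2)[OF \<phi> v(2)] ws] v by simp
    moreover have "us @ [x] \<in> tuples V (Suc n)" using v by simp
    ultimately show ?thesis
      using v c last
      by (simp add: face_last[OF vs, unfolded v(1)] face_last[of "us @ [x]" n] face_last[of "us @ [mV x y]" n]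
          face_inner[OF vs, unfolded v(1)] butlast_append idem mult.assoc[symmetric])
  qed
qed

lemma boundary_boundary:
  assumes \<phi>: "form n m \<phi>" and vs: "vs \<in> tuples V (Suc (Suc n))" and ws: "ws \<in> tuples W m"
    and idem: "\<alpha> * \<alpha> = \<alpha>" "\<beta> * \<beta> = \<beta>"
  shows "boundary \<alpha> \<beta> (Suc (Suc n)) (boundary \<alpha> \<beta> (Suc n) \<phi>) vs ws = 0"
proof -
  have inner: "boundary \<alpha> \<beta> (Suc n) \<phi> = (\<lambda>vs ws. \<Sum>i\<le>Suc n. (-1) ^ i * face \<alpha> \<beta> i \<phi> vs ws)"
    by (simp add: boundary_def fun_eq_iff)
  have "boundary \<alpha> \<beta> (Suc (Suc n)) (boundary \<alpha> \<beta> (Suc n) \<phi>) vs ws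
      = (\<Sum>j\<le>Suc (Suc n). \<Sum>i\<le>Suc n. (-1) ^ (i + j) * face \<alpha> \<beta> j (face \<alpha> \<beta> i \<phi>) vs ws)"
    unfolding boundary_def[of \<alpha> \<beta> "Suc (Suc n)"] inner
    by (simp add: face_sum sum_distrib_left power_add mult_ac del: sum.atMost_Suc)
  also have "\<dots> = 0"
    by (rule presimplicial_sum_zero) (rule face_face[OF \<phi> vs ws _ _ idem])
  finally show ?thesis .
qed

end

context dual_bialgebras
begin

text \<open>
  This lemma and \<open>act_first_L\<close>, \<open>act_last_R\<close>, \<open>act_last_L\<close> compute the composite of an outer face in each
  direction.  The right-hand sides are symmetric in the two directions, up to interchanging finite sums; this is
  why outer faces commute.  The element of \<open>W\<close> that is removed second has been hit by a component of
  \<open>v\<close>, and \<open>linear_R\<close> and \<open>linear_L\<close> turn this into a pairing of components.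
\<close>

lemma act_first_R:
  assumes "w \<in> W" "ws \<in> tuples W m" "v \<in> V"
  shows "act R (w # ws) v (\<lambda>rs. swap.act a vs (hd rs) (\<lambda>us. \<phi> us (tl rs))) =
    D v (\<lambda>x y. swap.D w (\<lambda>p q. pr y p * act R ws x (\<lambda>qs. swap.act a vs q (\<lambda>us. \<phi> us qs))))"
  using assms
  by (auto intro!: D_cong simp: linear_R[OF swap.act_linear] act_swap_D act_cmult)

lemma act_first_L:
  assumes "w \<in> W" "ws \<in> tuples W m" "v \<in> V"
  shows "act L (w # ws) v (\<lambda>rs. swap.act a vs (hd rs) (\<lambda>us. \<phi> us (tl rs))) =
    D v (\<lambda>x y. swap.D w (\<lambda>p q. pr y q * act L ws x (\<lambda>qs. swap.act a vs p (\<lambda>us. \<phi> us qs))))"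
  using assms
  by (auto intro!: D_cong simp: linear_L[OF swap.act_linear] act_swap_D act_cmult)

lemma multilinear_on_swap_act:
  assumes "form n m \<phi>" "vs \<in> tuples V n" "swap.bilinear_action a"
  shows "multilinear_on W sW (Suc m) (\<lambda>rs. swap.act a vs (last rs) (\<lambda>us. \<phi> us (butlast rs)))"
  by (rule multilinear_on_Suc_snocI)
    (simp_all add: swap.act_linear swap.multilinear_on_act_parameter[OF assms(3,2)] formD(2)[OF assms(1)])

lemma act_last_R:
  assumes "form n m \<phi>" "vs \<in> tuples V n" "swap.bilinear_action a"
    and "w \<in> W" "ws \<in> tuples W m" "v \<in> V"
  shows "act R (ws @ [w]) v (\<lambda>rs. swap.act a vs (last rs) (\<lambda>us. \<phi> us (butlast rs))) =
    D v (\<lambda>x y. swap.D w (\<lambda>p q. pr x p * act R ws y (\<lambda>qs. swap.act a vs q (\<lambda>us. \<phi> us qs))))"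
  unfolding act_snoc[OF bilinear_action_R multilinear_on_swap_act[OF assms(1-3)] assms(5,4,6)]
  using assms by (auto intro!: D_cong simp: linear_R[OF swap.act_linear] act_swap_D act_cmult)

lemma act_last_L:
  assumes "form n m \<phi>" "vs \<in> tuples V n" "swap.bilinear_action a"
    and "w \<in> W" "ws \<in> tuples W m" "v \<in> V"
  shows "act L (ws @ [w]) v (\<lambda>rs. swap.act a vs (last rs) (\<lambda>us. \<phi> us (butlast rs))) =
    D v (\<lambda>x y. swap.D w (\<lambda>p q. pr x q * act L ws y (\<lambda>qs. swap.act a vs p (\<lambda>us. \<phi> us qs))))"
  unfolding act_snoc[OF bilinear_action_L multilinear_on_swap_act[OF assms(1-3)] assms(5,4,6)]
  using assms by (auto intro!: D_cong simp: linear_L[OF swap.act_linear] act_swap_D act_cmult)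

lemma D_swap_D: "D v (\<lambda>x y. swap.D w (F x y)) = swap.D w (\<lambda>p q. D v (\<lambda>x y. F x y p q))"
  by (simp add: swap.D_def D_sum D_cmult)

end

context dual_bialgebras
begin

text \<open>
  A form for the pair is a form for the exchanged pair after exchanging its arguments.
\<close>

lemma form_swap: "swap.form m n (\<lambda>ws vs. \<phi> vs ws) \<longleftrightarrow> form n m \<phi>"
  by (auto simp: form_def swap.form_def)

lemma act_last_last:
  assumes \<phi>: "form n m \<phi>" and vs: "vs \<in> tuples V n" "v \<in> V" and ws: "ws \<in> tuples W m" "w \<in> W"
  shows "act R (ws @ [w]) v (\<lambda>rs. swap.act swap.R vs (last rs) (\<lambda>us. \<phi> us (butlast rs))) =
    swap.act swap.R (vs @ [v]) w (\<lambda>rs. act R ws (last rs) (\<phi> (butlast rs)))"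
  unfolding act_last_R[OF \<phi> vs(1) swap.bilinear_action_R ws(2,1) vs(2)]
    swap.act_last_R[OF \<phi>[folded form_swap] ws(1) bilinear_action_R vs(2,1) ws(2)] D_swap_D
  by (simp add: act_swap_act)

lemma act_first_first:
  assumes vs: "vs \<in> tuples V n" "v \<in> V" and ws: "ws \<in> tuples W m" "w \<in> W"
  shows "act L (w # ws) v (\<lambda>rs. swap.act swap.L vs (hd rs) (\<lambda>us. \<phi> us (tl rs))) =
    swap.act swap.L (v # vs) w (\<lambda>rs. act L ws (hd rs) (\<phi> (tl rs)))"
  unfolding act_first_L[OF ws(2,1) vs(2)]
    swap.act_first_L[OF vs(2,1) ws(2), where \<phi> = "\<lambda>ws vs. \<phi> vs ws"] D_swap_D
  by (simp add: act_swap_act)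

lemma act_last_first:
  assumes \<phi>: "form n m \<phi>" and vs: "vs \<in> tuples V n" "v \<in> V" and ws: "ws \<in> tuples W m" "w \<in> W"
  shows "act R (w # ws) v (\<lambda>rs. swap.act swap.L vs (hd rs) (\<lambda>us. \<phi> us (tl rs))) =
    swap.act swap.L (vs @ [v]) w (\<lambda>rs. act R ws (last rs) (\<phi> (butlast rs)))"
  unfolding act_first_R[OF ws(2,1) vs(2)]
    swap.act_last_L[OF \<phi>[folded form_swap] ws(1) bilinear_action_R vs(2,1) ws(2)] D_swap_D
  by (simp add: act_swap_act)

abbreviation coface where
  "coface \<gamma> \<delta> j \<phi> \<equiv> (\<lambda>vs ws. swap.face \<gamma> \<delta> j (\<lambda>ws vs. \<phi> vs ws) ws vs)"

abbreviation coboundary where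
  "coboundary \<gamma> \<delta> m \<phi> \<equiv> (\<lambda>vs ws. swap.boundary \<gamma> \<delta> m (\<lambda>ws vs. \<phi> vs ws) ws vs)"

lemma face_coface_inner:
  assumes \<phi>: "form n m \<phi>" and vs: "vs \<in> tuples V (Suc n)" and ws: "ws \<in> tuples W (Suc m)"
    and ij: "i \<le> Suc n" "0 < j" "j \<le> m"
  shows "face \<alpha> \<beta> i (coface \<gamma> \<delta> j \<phi>) vs ws = coface \<gamma> \<delta> j (face \<alpha> \<beta> i \<phi>) vs ws"
proof -
  note ends = tuples_ends[OF vs]
  have *: "act a ws v (coface \<gamma> \<delta> j \<phi> us) = act a (contract mW j ws) v (\<phi> us)"
    if "bilinear_action a" "multiplicative a" "v \<in> V" "us \<in> tuples V n" for a v us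
    unfolding act_contract[OF that(1,2) formD(2)[OF \<phi> that(4)] ws ij(2,3) that(3)]
    by (rule act_cong[OF that(1) ws]) (simp add: swap.face_inner ij)
  note R = *[OF bilinear_action_R multiplicative_R] and L = *[OF bilinear_action_L multiplicative_L]
  consider "i = 0" | "0 < i" "i \<le> n" | "i = Suc n" using ij by linarith
  then show ?thesis
  proof cases
    case 1
    show ?thesis using L ends by (simp add: 1 face_first swap.face_inner[OF ws ij(2,3)])
  next
    case 2
    then show ?thesis
      by (simp add: face_inner[OF vs] swap.face_inner[OF ws ij(2,3)])
  next
    case 3
    show ?thesis using R ends by (simp add: 3 face_last[OF vs] swap.face_inner[OF ws ij(2,3)])
  qed
qed

end

context dual_bialgebras
begin

lemma face_coface:
  assumes \<phi>: "form n m \<phi>" and vs: "vs \<in> tuples V (Suc n)" and ws: "ws \<in> tuples W (Suc m)"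
    and ij: "i \<le> Suc n" "j \<le> Suc m"
  shows "face \<alpha> \<beta> i (coface \<gamma> \<delta> j \<phi>) vs ws = coface \<gamma> \<delta> j (face \<alpha> \<beta> i \<phi>) vs ws"
proof -
  obtain v us where v: "vs = v # us" "v \<in> V" "us \<in> tuples V n" using vs by (cases vs) auto
  obtain v' us' where v': "vs = us' @ [v']" "v' \<in> V" "us' \<in> tuples V n"
    using vs by (cases vs rule: rev_cases) auto
  obtain w rs where w: "ws = w # rs" "w \<in> W" "rs \<in> tuples W m" using ws by (cases ws) auto
  obtain w' rs' where w': "ws = rs' @ [w']" "w' \<in> W" "rs' \<in> tuples W m"
    using ws by (cases ws rule: rev_cases) auto
  note \<phi>' = \<phi>[folded form_swap]
  consider "0 < j" "j \<le> m" | "0 < i" "i \<le> n" | "i = 0" "j = 0" | "i = 0" "j = Suc m"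
    | "i = Suc n" "j = 0" | "i = Suc n" "j = Suc m"
    using ij by linarith
  then show ?thesis
  proof cases
    case 1
    then show ?thesis using face_coface_inner[OF \<phi> vs ws] ij by blast
  next
    case 2
    then show ?thesis using swap.face_coface_inner[OF \<phi>' ws vs ij(2)] by simp
  next
    case 3
    have "act L ws (hd vs) (\<lambda>qs. swap.act swap.L (tl vs) (hd qs) (\<lambda>us. \<phi> us (tl qs))) =
      swap.act swap.L vs (hd ws) (\<lambda>rs. act L (tl ws) (hd rs) (\<phi> (tl rs)))"
      using act_first_first[OF v(3,2) w(3,2)] v(1) w(1) by simp
    then show ?thesis
      by (simp add: 3 face_first swap.face_first act_cmult swap.act_cmult mult.left_commute)
  next
    case 4
    have "swap.act swap.R vs w' (\<lambda>rs. act L rs' (hd rs) (\<phi> (tl rs))) =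
      act L ws v (\<lambda>qs. swap.act swap.R us (last qs) (\<lambda>us. \<phi> us (butlast qs)))"
      using swap.act_last_first[OF \<phi>' w'(3,2) v(3,2)] v(1) w'(1) by simp
    moreover have "act L ws v (\<lambda>qs. coface \<gamma> \<delta> j \<phi> us qs)
        = act L ws v (\<lambda>qs. \<delta> * swap.act swap.R us (last qs) (\<lambda>us. \<phi> us (butlast qs)))"
      by (rule act_cong[OF bilinear_action_L ws]) (simp add: 4 swap.face_last)
    moreover have "coface \<gamma> \<delta> j (face \<alpha> \<beta> i \<phi>) vs ws
        = \<delta> * swap.act swap.R vs w' (\<lambda>rs. \<alpha> * act L rs' (hd rs) (\<phi> (tl rs)))"
      using w'(1) by (simp add: 4 swap.face_last[OF ws, unfolded w'(1)] face_first)
    ultimately show ?thesis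
      using v(1) by (simp add: 4 face_first act_cmult swap.act_cmult mult.left_commute)
  next
    case 5
    have "act R ws v' (\<lambda>qs. swap.act swap.L us' (hd qs) (\<lambda>us. \<phi> us (tl qs))) =
      swap.act swap.L vs w (\<lambda>ps. act R rs (last ps) (\<phi> (butlast ps)))"
      using act_last_first[OF \<phi> v'(3,2) w(3,2)] v'(1) w(1) by simp
    moreover have "swap.act swap.L vs w (\<lambda>ps. face \<alpha> \<beta> i \<phi> ps rs)
        = swap.act swap.L vs w (\<lambda>ps. \<beta> * act R rs (last ps) (\<phi> (butlast ps)))"
      by (rule swap.act_cong[OF swap.bilinear_action_L vs]) (simp add: 5 face_last)
    moreover have "face \<alpha> \<beta> i (coface \<gamma> \<delta> j \<phi>) vs ws
        = \<beta> * act R ws v' (\<lambda>qs. \<gamma> * swap.act swap.L us' (hd qs) (\<lambda>us. \<phi> us (tl qs)))"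
      using v'(1) by (simp add: 5 face_last[OF vs, unfolded v'(1)] swap.face_first)
    ultimately show ?thesis
      using w(1) by (simp add: 5 swap.face_first act_cmult swap.act_cmult mult.left_commute)
  next
    case 6
    have "act R ws v' (\<lambda>qs. swap.act swap.R us' (last qs) (\<lambda>us. \<phi> us (butlast qs))) =
      swap.act swap.R vs w' (\<lambda>ps. act R rs' (last ps) (\<phi> (butlast ps)))"
      using act_last_last[OF \<phi> v'(3,2) w'(3,2)] v'(1) w'(1) by simp
    moreover have "act R ws v' (\<lambda>qs. coface \<gamma> \<delta> j \<phi> us' qs)
        = act R ws v' (\<lambda>qs. \<delta> * swap.act swap.R us' (last qs) (\<lambda>us. \<phi> us (butlast qs)))"
      by (rule act_cong[OF bilinear_action_R ws]) (simp add: 6 swap.face_last)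
    moreover have "swap.act swap.R vs w' (\<lambda>ps. face \<alpha> \<beta> i \<phi> ps rs')
        = swap.act swap.R vs w' (\<lambda>ps. \<beta> * act R rs' (last ps) (\<phi> (butlast ps)))"
      by (rule swap.act_cong[OF swap.bilinear_action_R vs]) (simp add: 6 face_last)
    moreover have "face \<alpha> \<beta> i (coface \<gamma> \<delta> j \<phi>) vs ws = \<beta> * act R ws v' (coface \<gamma> \<delta> j \<phi> us')"
      using v'(1) by (simp add: 6 face_last[OF vs, unfolded v'(1)])
    moreover have "coface \<gamma> \<delta> j (face \<alpha> \<beta> i \<phi>) vs ws
        = \<delta> * swap.act swap.R vs w' (\<lambda>ps. face \<alpha> \<beta> i \<phi> ps rs')"
      using w'(1) by (simp add: 6 swap.face_last[OF ws, unfolded w'(1)])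
    ultimately show ?thesis
      by (simp add: act_cmult swap.act_cmult mult.left_commute)
  qed
qed

lemma boundary_coboundary:
  assumes \<phi>: "form n m \<phi>" and vs: "vs \<in> tuples V (Suc n)" and ws: "ws \<in> tuples W (Suc m)"
  shows "boundary \<alpha> \<beta> (Suc n) (coboundary \<gamma> \<delta> (Suc m) \<phi>) vs ws
    = coboundary \<gamma> \<delta> (Suc m) (boundary \<alpha> \<beta> (Suc n) \<phi>) vs ws"
proof -
  have "boundary \<alpha> \<beta> (Suc n) (coboundary \<gamma> \<delta> (Suc m) \<phi>) vs ws
      = (\<Sum>i\<le>Suc n. \<Sum>j\<le>Suc m. (-1) ^ i * ((-1) ^ j * face \<alpha> \<beta> i (coface \<gamma> \<delta> j \<phi>) vs ws))"
    by (simp add: boundary_def swap.boundary_def face_sum sum_distrib_left del: sum.atMost_Suc)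
  also have "\<dots> = (\<Sum>j\<le>Suc m. \<Sum>i\<le>Suc n. (-1) ^ j * ((-1) ^ i * coface \<gamma> \<delta> j (face \<alpha> \<beta> i \<phi>) vs ws))"
    by (subst sum.swap, intro sum.cong refl)
      (simp add: face_coface[OF \<phi> vs ws] mult.left_commute)
  also have "\<dots> = coboundary \<gamma> \<delta> (Suc m) (boundary \<alpha> \<beta> (Suc n) \<phi>) vs ws"
    by (simp add: boundary_def swap.boundary_def swap.face_sum sum_distrib_left del: sum.atMost_Suc)
  finally show ?thesis .
qed

end

context dual_bialgebras
begin

lemma face_cong:
  assumes eq: "\<And>us qs. us \<in> tuples V n \<Longrightarrow> qs \<in> tuples W m \<Longrightarrow> \<phi> us qs = \<psi> us qs"
    and vs: "vs \<in> tuples V (Suc n)" and ws: "ws \<in> tuples W m" and "i \<le> Suc n"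
  shows "face \<alpha> \<beta> i \<phi> vs ws = face \<alpha> \<beta> i \<psi> vs ws"
proof -
  have "act a ws v (\<phi> us) = act a ws v (\<psi> us)" if "bilinear_action a" "us \<in> tuples V n" for a v us
    using that eq by (intro act_cong[OF _ ws]) auto
  then show ?thesis
    using tuples_ends[OF vs] contract_tuples_V[OF vs] assms bilinear_action_L bilinear_action_R
    by (auto simp: face_def tuples_length)
qed

lemma boundary_cong:
  assumes "\<And>us qs. us \<in> tuples V n \<Longrightarrow> qs \<in> tuples W m \<Longrightarrow> \<phi> us qs = \<psi> us qs"
    and "vs \<in> tuples V (Suc n)" and "ws \<in> tuples W m"
  shows "boundary \<alpha> \<beta> (Suc n) \<phi> vs ws = boundary \<alpha> \<beta> (Suc n) \<psi> vs ws"
  unfolding boundary_def by (intro sum.cong refl) (simp add: face_cong[OF assms])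

lemma boundary_inner:
  assumes "vs \<in> tuples V (Suc n)"
  shows "boundary 0 0 (Suc n) \<phi> vs ws = (\<Sum>i\<in>{1..<length vs}. (-1) ^ i * \<phi> (contract mV i vs) ws)"
proof -
  have "boundary 0 0 (Suc n) \<phi> vs ws = (\<Sum>i\<in>{1..<Suc n}. (-1) ^ i * face 0 0 i \<phi> vs ws)"
    unfolding boundary_def using assms
    by (intro sum.mono_neutral_right) (auto simp: face_def tuples_length not_le le_Suc_eq)
  also have "\<dots> = (\<Sum>i\<in>{1..<length vs}. (-1) ^ i * \<phi> (contract mV i vs) ws)"
    using assms by (intro sum.cong) (auto simp: face_def tuples_length)
  finally show ?thesis .
qed

text \<open>
  The summands are the transposes of \<open>d\<^sub>b\<^sub>a\<^sub>r\<close>, \<open>\<pi>\<^sup>H\<close> and \<open>\<^sup>H\<pi>\<close>.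
\<close>

lemma boundary_outer:
  assumes "vs \<in> tuples V (Suc n)"
  shows "boundary \<alpha> \<beta> (Suc n) \<phi> vs ws = boundary 0 0 (Suc n) \<phi> vs ws
    + \<beta> * (-1) ^ Suc n * face 1 1 (Suc n) \<phi> vs ws + \<alpha> * face 1 1 0 \<phi> vs ws"
proof -
  have "(\<Sum>i<n. (-1) ^ Suc i * face \<alpha> \<beta> (Suc i) \<phi> vs ws) = (\<Sum>i<n. (-1) ^ Suc i * face 0 0 (Suc i) \<phi> vs ws)"
    using assms by (intro sum.cong refl) (simp add: face_def tuples_length)
  moreover have "face \<alpha> \<beta> (Suc n) \<phi> vs ws = \<beta> * face 1 1 (Suc n) \<phi> vs ws"
    "face 0 0 (Suc n) \<phi> vs ws = 0"
    using assms by (simp_all add: face_last)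
  moreover have "face \<alpha> \<beta> 0 \<phi> vs ws = \<alpha> * face 1 1 0 \<phi> vs ws" "face 0 0 0 \<phi> vs ws = 0"
    by (simp_all add: face_first)
  ultimately show ?thesis
    unfolding boundary_def sum.atMost_Suc sum.atMost_shift by (simp add: algebra_simps)
qed

lemma form_cong:
  assumes \<phi>: "form n m \<phi>"
    and eq: "\<And>vs ws. vs \<in> tuples V n \<Longrightarrow> ws \<in> tuples W m \<Longrightarrow> \<psi> vs ws = \<phi> vs ws"
  shows "form n m \<psi>"
  unfolding form_def
proof (intro conjI ballI)
  fix ws assume "ws \<in> tuples W m"
  with formD(1)[OF \<phi>] eq show "multilinear_on V sV n (\<lambda>vs. \<psi> vs ws)"
    by (blast intro: multilinear_on_cong A.add_closed A.scale_closed)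
next
  fix vs assume "vs \<in> tuples V n"
  with formD(2)[OF \<phi>] eq show "multilinear_on W sW m (\<psi> vs)"
    by (blast intro: multilinear_on_cong B.add_closed B.scale_closed)
qed

text \<open>
  Used to see that the structure maps take values in the tensor spaces: an action is a finite sum.
\<close>

lemma act_in_subspace:
  assumes a: "bilinear_action a"
    and S: "(\<lambda>x. 0) \<in> S" "\<And>f g. f \<in> S \<Longrightarrow> g \<in> S \<Longrightarrow> (\<lambda>x. f x + g x) \<in> S"
      "\<And>c f. f \<in> S \<Longrightarrow> (\<lambda>x. c * f x) \<in> S"
    and "ws \<in> tuples W m" "\<And>qs. qs \<in> tuples W m \<Longrightarrow> X qs \<in> S"
  shows "(\<lambda>x. act a ws v (\<lambda>qs. X qs x)) \<in> S"
  using assms(5,6)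
proof (induction ws arbitrary: m v X)
  case Nil
  then show ?case by (simp add: S)
next
  case (Cons w ws)
  then obtain k where k: "m = Suc k" "w \<in> W" "ws \<in> tuples W k" by (cases m) auto
  have sum: "(\<lambda>x. \<Sum>i\<in>J. f i x) \<in> S" if "\<And>i. i \<in> J \<Longrightarrow> f i \<in> S" for J :: "'i set" and f
    using that by (induction J rule: infinite_finite_induct) (simp_all add: S)
  have X: "X (a (b j) w # qs) \<in> S" if "j \<in> I" "qs \<in> tuples W k" for j qs
    using Cons.prems(2) that b bilinear_actionD(1)[OF a] k by simp
  have "(\<lambda>x. act a ws (b i) (\<lambda>qs. X (a (b j) w # qs) x)) \<in> S" if "j \<in> I" for i j
    by (rule Cons.IH[OF k(3)]) (rule X[OF that])
  then show ?case
    unfolding act.simps D_def by (intro sum S(3)) auto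
qed

end

section \<open>Iterated Sweedler sums as actions\<close>

lemma sweedler_list_flip:
  "sweedler_list (\<lambda>v F. D v (\<lambda>x y. F y x)) vs F = sweedler_list D vs (\<lambda>xs ys. F ys xs)"
  by (induction vs arbitrary: F) simp_all

context dual_bialgebras
begin

text \<open>
  The Sweedler sums of a concrete coproduct agree with \<open>D\<close> on bilinear functions only.
\<close>

definition represents_D :: "('v \<Rightarrow> ('v \<Rightarrow> 'v \<Rightarrow> 'k) \<Rightarrow> 'k) \<Rightarrow> bool" where
  "represents_D S \<longleftrightarrow> (\<forall>v\<in>V. \<forall>F. (\<forall>y\<in>V. linear_on V sV (\<lambda>x. F x y)) \<longrightarrow>
     (\<forall>x\<in>V. linear_on V sV (F x)) \<longrightarrow> S v F = D v F)"

text \<open>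
  Multilinearity on the carrier is all that is known in nested sums, so the function to which \<open>S\<close>
  is applied is allowed to differ from a bilinear one off the carrier.
\<close>

lemma represents_D_cong:
  assumes "represents_D S" "v \<in> V"
    and F: "\<And>y. y \<in> V \<Longrightarrow> linear_on V sV (\<lambda>x. F x y)" "\<And>x. x \<in> V \<Longrightarrow> linear_on V sV (F x)"
    and eq: "\<And>x y. x \<in> V \<Longrightarrow> y \<in> V \<Longrightarrow> G x y = F x y"
  shows "S v G = D v F"
proof -
  have "linear_on V sV (\<lambda>x. G x y)" if "y \<in> V" for y
    by (rule linear_on_cong[OF F(1)[OF that]]) (simp_all add: eq that A.add_closed A.scale_closed)
  moreover have "linear_on V sV (G x)" if "x \<in> V" for x
    by (rule linear_on_cong[OF F(2)[OF that]]) (simp_all add: eq that A.add_closed A.scale_closed)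
  ultimately have "S v G = D v G"
    using assms(1,2) by (simp add: represents_D_def)
  then show ?thesis using D_cong[of G F] eq by simp
qed

lemma iter_cong:
  "(\<And>vs. vs \<in> tuples V k \<Longrightarrow> F vs = G vs) \<Longrightarrow> sweedler_iter D c k v F = sweedler_iter D c k v G"
proof (induction k arbitrary: v F G)
  case (Suc k)
  show ?case
    unfolding sweedler_iter.simps by (intro D_cong Suc.IH Suc.prems) simp
qed simp

lemma iter_cmult: "sweedler_iter D c k v (\<lambda>vs. z * F vs) = z * sweedler_iter D c k v F"
  by (induction k arbitrary: v F) (simp_all add: D_cmult)

lemma linear_on_iter:
  assumes "\<And>vs. vs \<in> tuples V k \<Longrightarrow> linear_on U t (\<lambda>u. F u vs)"
  shows "linear_on U t (\<lambda>u. sweedler_iter D c k v (F u))"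
  using assms
proof (induction k arbitrary: v F)
  case (Suc k)
  show ?case
    unfolding sweedler_iter.simps by (intro linear_on_D Suc.IH Suc.prems) simp
qed (simp add: linear_on_cmult)

lemma iter_linear: "linear_on V sV (\<lambda>v. sweedler_iter D eps k v F)"
  by (cases k) (simp_all add: D_linear linear_on_multc eps_linear)

text \<open>
  The iterated sum peels off the first component, but the reversal in the pairings matches the first
  entry of the tuple with the last component.
\<close>

lemma iter_snoc:
  assumes "multilinear_on V sV (Suc k) F" "v \<in> V"
  shows "sweedler_iter D eps (Suc k) v F
    = D v (\<lambda>x y. sweedler_iter D eps k x (\<lambda>vs. F (vs @ [y])))"
  using assms
proof (induction k arbitrary: v F)
  case 0
  then have "linear_on V sV (\<lambda>x. F [x])" using multilinear_on_hd[of V sV 0 F "[]"] by simp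
  then show ?case using D_eps[OF \<open>v \<in> V\<close>, of "\<lambda>x. F [x]"] by (simp add: mult.commute)
next
  case (Suc k)
  note F = Suc.prems(1)
  have "sweedler_iter D eps (Suc (Suc k)) v F
      = D v (\<lambda>x y. D y (\<lambda>y1 y2. sweedler_iter D eps k y1 (\<lambda>vs. F (x # vs @ [y2]))))"
    unfolding sweedler_iter.simps(2)[of D eps "Suc k"]
    by (intro D_cong) (simp add: Suc.IH multilinear_on_Cons[OF F] del: sweedler_iter.simps)
  also have "\<dots> = D v (\<lambda>x y. D x (\<lambda>x1 x2. sweedler_iter D eps k x2 (\<lambda>vs. F (x1 # vs @ [y]))))"
    using Suc.prems
    by (intro D_coassoc[symmetric] linear_on_iter)
      (auto intro!: multilinear_on_last multilinear_on_Cons[OF F] multilinear_on_hd[OF F])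
  finally show ?case by simp
qed

lemma iter_represents:
  assumes S: "represents_D S" and "multilinear_on V sV k F" "v \<in> V"
  shows "sweedler_iter S eps k v F = sweedler_iter D eps k v F"
  using assms(2,3)
proof (induction k arbitrary: v F)
  case (Suc k)
  note F = Suc.prems(1)
  show ?case
    unfolding sweedler_iter.simps
    by (rule represents_D_cong[OF S \<open>v \<in> V\<close>])
      (auto intro!: linear_on_iter iter_linear multilinear_on_hd[OF F] Suc.IH multilinear_on_Cons[OF F])
qed simp

lemma linear_on_list:
  assumes "vs \<in> tuples V n"
    and "\<And>xs ys. xs \<in> tuples V n \<Longrightarrow> ys \<in> tuples V n \<Longrightarrow> linear_on U t (\<lambda>u. F u xs ys)"
  shows "linear_on U t (\<lambda>u. sweedler_list D vs (F u))"
  using assms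
proof (induction vs arbitrary: n F)
  case (Cons v vs)
  then obtain k where "n = Suc k" "vs \<in> tuples V k" by (cases n) auto
  then show ?case
    unfolding sweedler_list.simps
    by (intro linear_on_D Cons.IH[of k] Cons.prems(2)) simp_all
qed simp

lemma list_represents:
  assumes S: "represents_D S" and "vs \<in> tuples V n"
    and "\<And>ys. ys \<in> tuples V n \<Longrightarrow> multilinear_on V sV n (\<lambda>xs. F xs ys)"
      "\<And>xs. xs \<in> tuples V n \<Longrightarrow> multilinear_on V sV n (F xs)"
    and "\<And>xs ys. xs \<in> tuples V n \<Longrightarrow> ys \<in> tuples V n \<Longrightarrow> G xs ys = F xs ys"
  shows "sweedler_list S vs G = sweedler_list D vs F"
  using assms(2-)
proof (induction vs arbitrary: n F G)
  case (Cons v vs)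
  then obtain k where k: "n = Suc k" "v \<in> V" "vs \<in> tuples V k" by (cases n) auto
  note F = Cons.prems(2,3)[unfolded k(1)]
  show ?case
    unfolding sweedler_list.simps
  proof (rule represents_D_cong[OF S k(2)])
    fix x y assume "x \<in> V" "y \<in> V"
    then show "sweedler_list S vs (\<lambda>xs ys. G (x # xs) (y # ys)) = sweedler_list D vs (\<lambda>xs ys. F (x # xs) (y # ys))"
      using k Cons.prems(4)
      by (intro Cons.IH[of k] multilinear_on_Cons[OF F(1)] multilinear_on_Cons[OF F(2)]) auto
  next
    fix x assume "x \<in> V"
    then show "linear_on V sV (\<lambda>y. sweedler_list D vs (\<lambda>xs ys. F (x # xs) (y # ys)))"
      by (intro linear_on_list[OF k(3)] multilinear_on_hd[OF F(2)]) auto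
  next
    fix y assume "y \<in> V"
    then show "linear_on V sV (\<lambda>x. sweedler_list D vs (\<lambda>xs ys. F (x # xs) (y # ys)))"
      by (intro linear_on_list[OF k(3)] multilinear_on_hd[OF F(1)]) auto
  qed
qed simp

definition pairing_list :: "'w list \<Rightarrow> 'v list \<Rightarrow> 'k" where
  "pairing_list ws vs = (\<Prod>(w, v)\<leftarrow>zip ws vs. pr v w)"

lemma pairing_list_rev:
  "length ws = length vs \<Longrightarrow> pairing_list (rev ws) vs = pairing_list ws (rev vs)"
  using zip_rev[of ws "rev vs"] by (simp add: pairing_list_def rev_map[symmetric])

lemma multilinear_on_pairing_list:
  assumes "ws \<in> tuples W k"
  shows "multilinear_on V sV k (pairing_list ws)"
  using assms
proof (induction ws arbitrary: k)
  case (Cons w ws)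
  then obtain k' where "k = Suc k'" "w \<in> W" "ws \<in> tuples W k'" by (cases k) auto
  with Cons.IH[of k'] show ?case
    by (auto simp: pairing_list_def intro!: multilinear_on_SucI linear_on_multc multilinear_on_cmult pr_left)
qed simp

text \<open>
  The translation between the two descriptions of an action: pairing the components of \<open>v\<close> with one
  half of the coproduct of every entry, against acting on the entries.  \<open>E\<close> is the Sweedler
  sum of \<open>W\<close> for the action \<open>R\<close>, and the sum with exchanged components for \<open>L\<close>.
\<close>

lemma sweedler_list_eq_act:
  assumes E_cong: "\<And>w F G. (\<And>p q. p \<in> W \<Longrightarrow> q \<in> W \<Longrightarrow> F p q = G p q) \<Longrightarrow> E w F = E w G"
    and E_cmult: "\<And>w c F. E w (\<lambda>p q. c * F p q) = c * E w F"
    and E_D: "\<And>w v F. E w (\<lambda>p q. D v (\<lambda>x y. F x y p q)) = D v (\<lambda>x y. E w (F x y))"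
    and E_act: "\<And>w v f. w \<in> W \<Longrightarrow> v \<in> V \<Longrightarrow> linear_on W sW f \<Longrightarrow> E w (\<lambda>p q. pr v p * f q) = f (a v w)"
    and a: "bilinear_action a"
    and "multilinear_on W sW m F" "ws \<in> tuples W m" "v \<in> V"
  shows "sweedler_list E ws (\<lambda>ps qs. sweedler_iter D eps m v (\<lambda>vs. pairing_list (rev ps) vs * F qs))
    = act a ws v F"
proof -
  have list_cong: "sweedler_list E ws F = sweedler_list E ws G"
    if "ws \<in> tuples W m" "\<And>ps qs. ps \<in> tuples W m \<Longrightarrow> qs \<in> tuples W m \<Longrightarrow> F ps qs = G ps qs" for ws F G m
    using that
  proof (induction ws arbitrary: m F G)
    case (Cons w ws)
    then obtain k where k: "m = Suc k" "ws \<in> tuples W k" by (cases m) auto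
    then show ?case
      unfolding sweedler_list.simps by (intro E_cong Cons.IH[of k] Cons.prems(2)) simp_all
  qed simp
  have list_cmult: "sweedler_list E ws (\<lambda>p q. c * F p q) = c * sweedler_list E ws F" for ws c F
    by (induction ws arbitrary: F) (simp_all add: E_cmult)
  have list_D: "sweedler_list E ws (\<lambda>p q. D v (\<lambda>x y. F x y p q)) = D v (\<lambda>x y. sweedler_list E ws (F x y))"
    for ws v F
    by (induction ws arbitrary: F) (simp_all add: E_D)
  show ?thesis
    using assms(6-)
  proof (induction ws arbitrary: m v F)
    case Nil
    then show ?case by (simp add: pairing_list_def)
  next
    case (Cons w ws)
    then obtain k where k: "m = Suc k" "w \<in> W" "ws \<in> tuples W k" by (cases m) auto
    note F = Cons.prems(1)[unfolded k(1)]
    let ?iter = "\<lambda>x q ps qs. sweedler_iter D eps k x (\<lambda>vs. pairing_list (rev ps) vs * F (q # qs))"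
    have step: "sweedler_iter D eps m v (\<lambda>vs. pairing_list (rev (p # ps)) vs * F (q # qs))
        = D v (\<lambda>x y. pr y p * ?iter x q ps qs)"
      if "p \<in> W" "ps \<in> tuples W k" for p ps q qs
    proof -
      have "multilinear_on V sV (Suc k) (\<lambda>vs. pairing_list (rev (p # ps)) vs * F (q # qs))"
        using that by (intro multilinear_on_multc multilinear_on_pairing_list) (auto simp: tuples_def)
      then have "sweedler_iter D eps m v (\<lambda>vs. pairing_list (rev (p # ps)) vs * F (q # qs))
          = D v (\<lambda>x y. sweedler_iter D eps k x (\<lambda>vs. pairing_list (rev (p # ps)) (vs @ [y]) * F (q # qs)))"
        unfolding k(1) by (rule iter_snoc) (rule Cons.prems)
      also have "\<dots> = D v (\<lambda>x y. sweedler_iter D eps k x (\<lambda>vs. pr y p * (pairing_list (rev ps) vs * F (q # qs))))"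
        using that by (intro D_cong iter_cong) (simp add: pairing_list_def tuples_def mult_ac)
      finally show ?thesis by (simp add: iter_cmult)
    qed
    have "sweedler_list E (w # ws) (\<lambda>ps qs. sweedler_iter D eps m v (\<lambda>vs. pairing_list (rev ps) vs * F qs))
        = E w (\<lambda>p q. sweedler_list E ws (\<lambda>ps qs. D v (\<lambda>x y. pr y p * ?iter x q ps qs)))"
      unfolding sweedler_list.simps
      by (intro E_cong list_cong[OF k(3)]) (rule step)
    also have "\<dots> = D v (\<lambda>x y. E w (\<lambda>p q. pr y p * sweedler_list E ws (?iter x q)))"
      by (simp add: list_D E_D list_cmult)
    also have "\<dots> = D v (\<lambda>x y. E w (\<lambda>p q. pr y p * act a ws x (\<lambda>qs. F (q # qs))))"
      by (intro D_cong E_cong arg_cong2[where f = "(*)"] refl Cons.IH multilinear_on_Cons[OF F] k(3))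
    also have "\<dots> = act a (w # ws) v F"
      unfolding act.simps
      by (intro D_cong E_act k(2) linear_on_act[OF a k(3)] multilinear_on_hd[OF F])
    finally show ?case .
  qed
qed

end

context dual_bialgebras
begin

lemma pairing_list_swap: "swap.pairing_list vs ws = pairing_list ws vs"
proof (induction ws arbitrary: vs)
  case (Cons w ws)
  then show ?case by (cases vs) (simp_all add: pairing_list_def swap.pairing_list_def)
qed (simp add: pairing_list_def swap.pairing_list_def)

lemma multilinear_on_iter_pairing:
  "multilinear_on W sW m (\<lambda>ps. sweedler_iter D eps m v (\<lambda>vs. pairing_list (rev ps) vs * c))"
proof -
  have "multilinear_on W sW m (\<lambda>ps. pairing_list (rev ps) vs * c)" if "vs \<in> tuples V m" for vs
  proof (rule multilinear_on_cong)
    show "multilinear_on W sW m (\<lambda>ps. swap.pairing_list (rev vs) ps * c)"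
      using that by (intro multilinear_on_multc swap.multilinear_on_pairing_list) (simp add: tuples_def)
    show "pairing_list (rev ps) vs * c = swap.pairing_list (rev vs) ps * c" if "ps \<in> tuples W m" for ps
      using that \<open>vs \<in> tuples V m\<close> by (simp add: pairing_list_swap pairing_list_rev tuples_def)
  qed (simp_all add: B.add_closed B.scale_closed)
  then show ?thesis
    unfolding multilinear_on_def[of W sW m "\<lambda>ps. sweedler_iter D eps m v (\<lambda>vs. pairing_list (rev ps) vs * c)"]
    by (intro allI impI linear_on_iter) (rule multilinear_onD)
qed

lemma multilinear_on_iter:
  "multilinear_on W sW m F \<Longrightarrow> multilinear_on W sW m (\<lambda>ps. sweedler_iter D eps m v (\<lambda>vs. z vs * F ps))"
  unfolding multilinear_on_def by (auto intro!: linear_on_iter linear_on_cmult)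

lemma sweedler_sum_R:
  assumes SV: "represents_D SV" and SW: "swap.represents_D SW"
    and F: "multilinear_on W sW m F" and ws: "ws \<in> tuples W m" and v: "v \<in> V"
  shows "sweedler_list SW ws (\<lambda>ps qs. sweedler_iter SV eps m v (\<lambda>vs. pairing_list (rev ps) vs * F qs))
    = act R ws v F"
proof -
  have "sweedler_list SW ws (\<lambda>ps qs. sweedler_iter SV eps m v (\<lambda>vs. pairing_list (rev ps) vs * F qs))
      = sweedler_list swap.D ws (\<lambda>ps qs. sweedler_iter D eps m v (\<lambda>vs. pairing_list (rev ps) vs * F qs))"
    by (rule swap.list_represents[OF SW ws multilinear_on_iter_pairing multilinear_on_iter[OF F]])
      (use v in \<open>auto intro!: iter_represents[OF SV] multilinear_on_multc multilinear_on_pairing_list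
        simp: tuples_def\<close>)
  also have "\<dots> = act R ws v F"
    by (rule sweedler_list_eq_act[OF _ _ _ _ bilinear_action_R F ws v])
      (auto intro: swap.D_cong simp: swap.D_cmult D_swap_D linear_R)
  finally show ?thesis .
qed

lemma sweedler_sum_L:
  assumes SV: "represents_D SV" and SW: "swap.represents_D SW"
    and F: "multilinear_on W sW m F" and ws: "ws \<in> tuples W m" and v: "v \<in> V"
  shows "sweedler_list SW ws (\<lambda>ps qs. sweedler_iter SV eps m v (\<lambda>vs. pairing_list (rev qs) vs * F ps))
    = act L ws v F"
proof -
  have "sweedler_list SW ws (\<lambda>ps qs. sweedler_iter SV eps m v (\<lambda>vs. pairing_list (rev qs) vs * F ps))
      = sweedler_list swap.D ws (\<lambda>ps qs. sweedler_iter D eps m v (\<lambda>vs. pairing_list (rev qs) vs * F ps))"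
    by (rule swap.list_represents[OF SW ws multilinear_on_iter[OF F] multilinear_on_iter_pairing])
      (use v in \<open>auto intro!: iter_represents[OF SV] multilinear_on_multc multilinear_on_pairing_list
        simp: tuples_def\<close>)
  also have "\<dots> = sweedler_list (\<lambda>w F. swap.D w (\<lambda>p q. F q p)) ws
      (\<lambda>ps qs. sweedler_iter D eps m v (\<lambda>vs. pairing_list (rev ps) vs * F qs))"
    by (simp add: sweedler_list_flip)
  also have "\<dots> = act L ws v F"
    by (rule sweedler_list_eq_act[OF _ _ _ _ bilinear_action_L F ws v])
      (auto intro: swap.D_cong simp: swap.D_cmult D_swap_D linear_L)
  finally show ?thesis .
qed

end

section \<open>A finite-dimensional bialgebra and its dual\<close>

abbreviation (input) dual_scale :: "'k::field \<Rightarrow> ('h \<Rightarrow> 'k) \<Rightarrow> 'h \<Rightarrow> 'k" where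
  "dual_scale \<equiv> (\<lambda>c l h. c * l h)"

lemma sum_fun_apply: "(\<Sum>i\<in>J. F i) x = (\<Sum>i\<in>J. F i x)"
  by (induction J rule: infinite_finite_induct) simp_all

text \<open>
  Replacing an entry of a list amounts to inserting one between the entries before and after it.
\<close>

lemma multilinear_iff:
  fixes s :: "'k::field \<Rightarrow> 'h::ab_group_add \<Rightarrow> 'h"
  shows "multilinear s (*) n m \<phi> \<longleftrightarrow>
    (\<forall>ls\<in>tuples (dual s) m. multilinear_on UNIV s n (\<lambda>hs. \<phi> hs ls)) \<and>
    (\<forall>hs\<in>tuples UNIV n. multilinear_on (dual s) dual_scale m (\<phi> hs))" (is "_ \<longleftrightarrow> ?form")
proof
  assume \<phi>: "multilinear s (*) n m \<phi>"
  have "linear_on UNIV s (\<lambda>x. \<phi> (us @ x # zs) ls)"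
    if "ls \<in> tuples (dual s) m" "us @ zs \<in> tuples UNIV (n - 1)" "0 < n" for us zs ls
    using \<phi>[unfolded multilinear_def, THEN spec[of _ "us @ undefined # zs"], THEN spec[of _ ls]] that
    by (auto simp: tuples_def linear_on_def dest: spec[of _ "length us"])
  moreover have "linear_on (dual s) dual_scale (\<lambda>x. \<phi> hs (us @ x # zs))"
    if "hs \<in> tuples UNIV n" "us @ zs \<in> tuples (dual s) (m - 1)" "0 < m" for us zs hs
  proof -
    have *: "\<phi> hs (us @ (l + l') # zs) = \<phi> hs (us @ l # zs) + \<phi> hs (us @ l' # zs)"
      "\<phi> hs (us @ dual_scale c l # zs) = c * \<phi> hs (us @ l # zs)"
      if "l \<in> dual s" "l' \<in> dual s" for l l' c
      using \<phi>[unfolded multilinear_def, THEN spec[of _ hs], THEN spec[of _ "us @ l # zs"]] that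
        \<open>hs \<in> tuples UNIV n\<close> \<open>us @ zs \<in> tuples (dual s) (m - 1)\<close> \<open>0 < m\<close>
      by (auto simp: tuples_def dest: spec[of _ "length us"])
    then show ?thesis by (auto simp: linear_on_def)
  qed
  ultimately show ?form by (simp add: multilinear_on_def)
next
  assume \<phi>: ?form
  show "multilinear s (*) n m \<phi>"
    unfolding multilinear_def
  proof (intro allI impI)
    fix hs :: "'h list" and ls :: "('h \<Rightarrow> 'k) list"
    assume len: "length hs = n" "length ls = m" "set ls \<subseteq> dual s"
    then have t: "hs \<in> tuples UNIV n" "ls \<in> tuples (dual s) m" by (auto simp: tuples_def)
    have 1: "linear_on UNIV s (\<lambda>x. \<phi> (hs[i := x]) ls)" if "i < n" for i
      using multilinear_onD[of UNIV s n "\<lambda>hs. \<phi> hs ls" "take i hs" "drop (Suc i) hs"] \<phi> t that len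
      by (auto simp: tuples_def upd_conv_take_nth_drop)
    have "set (take j ls @ drop (Suc j) ls) \<subseteq> dual s" for j
      using len set_take_subset[of j ls] set_drop_subset[of "Suc j" ls] by auto
    then have 2: "linear_on (dual s) dual_scale (\<lambda>x. \<phi> hs (ls[j := x]))" if "j < m" for j
      using multilinear_onD[of "dual s" dual_scale m "\<phi> hs" "take j ls" "drop (Suc j) ls"] \<phi> t that len
      by (auto simp: tuples_def upd_conv_take_nth_drop)
    show "(\<forall>i<n. \<forall>x y. \<phi> (hs[i := x + y]) ls = \<phi> (hs[i := x]) ls + \<phi> (hs[i := y]) ls) \<and>
      (\<forall>i<n. \<forall>c x. \<phi> (hs[i := s c x]) ls = c * \<phi> (hs[i := x]) ls) \<and>
      (\<forall>j<m. \<forall>l\<in>dual s. \<forall>l'\<in>dual s. \<phi> hs (ls[j := l + l']) = \<phi> hs (ls[j := l]) + \<phi> hs (ls[j := l'])) \<and>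
      (\<forall>j<m. \<forall>c. \<forall>l\<in>dual s. \<phi> hs (ls[j := dual_scale c l]) = c * \<phi> hs (ls[j := l]))"
      using 1 2 by (auto simp: linear_on_def)
  qed
qed

text \<open>
  Every tensor is a finite combination of pure ones.  It also vanishes on functions that are not
  multilinear forms, because pure tensors do.
\<close>

lemma tensor_space_sum:
  fixes s :: "'k::field \<Rightarrow> 'h::ab_group_add \<Rightarrow> 'h"
  assumes "x \<in> tensor_space s n m"
  shows "\<exists>N c hs ls. (\<forall>k<N::nat. hs k \<in> tuples UNIV n \<and> ls k \<in> tuples (dual s) m) \<and>
    (\<forall>\<phi>. x \<phi> = (if multilinear s (*) n m \<phi> then \<Sum>k<N. c k * \<phi> (hs k) (ls k) else 0))"
proof -
  interpret T: vector_space "tensor_scale :: 'k \<Rightarrow> ('k, 'h) tensor \<Rightarrow> _"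
    by (rule vector_space_tensor_scale)
  show ?thesis
    using assms unfolding tensor_space_def
  proof (induction rule: T.span_induct_alt)
    case base
    show ?case by (rule exI[of _ 0]) simp
  next
    case (step c x y)
    from step(1) obtain hs ls where x: "x = pure_tensor s hs ls" "hs \<in> tuples UNIV n" "ls \<in> tuples (dual s) m"
      by (auto simp: tuples_def)
    from step(2) obtain N :: nat and c' hs' ls' where y:
      "\<And>k. k < N \<Longrightarrow> hs' k \<in> tuples UNIV n \<and> ls' k \<in> tuples (dual s) m"
      "\<And>\<phi>. y \<phi> = (if multilinear s (*) n m \<phi> then \<Sum>k<N. c' k * \<phi> (hs' k) (ls' k) else 0)"
      by blast
    show ?case
    proof (intro exI[of _ "Suc N"] exI[of _ "c'(N := c)"] exI[of _ "hs'(N := hs)"] exI[of _ "ls'(N := ls)"] conjI allI impI)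
      fix \<phi>
      show "(tensor_scale c x + y) \<phi> = (if multilinear s (*) n m \<phi>
        then \<Sum>k<Suc N. (c'(N := c)) k * \<phi> ((hs'(N := hs)) k) ((ls'(N := ls)) k) else 0)"
        using x(2,3) by (simp add: x(1) y(2) tensor_scale_def pure_tensor_def tuples_def)
    qed (use x y in \<open>auto simp: less_Suc_eq\<close>)
  qed
qed

text \<open>
  The basis is fixed, since dual bases are part of the data of a dual pair.
\<close>

locale finite_dim_bialgebra_basis =
  fixes H :: "('k::field, 'h::ab_group_add) bialgebra" and B :: "'h set"
  assumes basis: "finite_dimensional_vector_space (smult H) B" and bialgebra: "is_bialgebra H"
begin

sublocale VS: finite_dimensional_vector_space "smult H" B by (rule basis)

lemma dual_iff: "l \<in> dual (smult H) \<longleftrightarrow> linear_on UNIV (smult H) l"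
  using VS.vector_space_axioms vector_space_field[where 'k = 'k]
  by (simp add: dual_def Vector_Spaces.linear_iff linear_on_def)

lemmas algebra = bialgebra[unfolded is_bialgebra_def, THEN conjunct1]
  and coalgebra = bialgebra[unfolded is_bialgebra_def, THEN conjunct2, THEN conjunct1]

lemma mul_linear: "linear_on UNIV (smult H) l \<Longrightarrow> linear_on UNIV (smult H) (\<lambda>x. l (mul H x y))"
  "linear_on UNIV (smult H) l \<Longrightarrow> linear_on UNIV (smult H) (\<lambda>y. l (mul H x y))"
  using algebra by (simp_all add: is_algebra_def linear_on_def Vector_Spaces.linear_iff)

definition bilinear :: "('h \<Rightarrow> 'h \<Rightarrow> 'k) \<Rightarrow> bool" where
  "bilinear F \<longleftrightarrow> (\<forall>y. linear_on UNIV (smult H) (\<lambda>x. F x y)) \<and> (\<forall>x. linear_on UNIV (smult H) (F x))"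

lemma sweedler_finite_sum:
  obtains N :: nat and c x y
  where "\<And>F. bilinear F \<Longrightarrow> sweedler H h F = (\<Sum>k<N. c k * F (x k) (y k))"
proof -
  have "comul H h \<in> tensor_space (smult H) 2 0"
    using coalgebra by (auto simp: is_coalgebra_def)
  then obtain N :: nat and c hs and ls :: "nat \<Rightarrow> ('h \<Rightarrow> 'k) list" where
    *: "\<And>\<phi>. multilinear (smult H) (*) 2 0 \<phi> \<Longrightarrow> comul H h \<phi> = (\<Sum>k<N. c k * \<phi> (hs k) (ls k))"
    using tensor_space_sum[of "comul H h" "smult H" 2 0] by metis
  have "multilinear (smult H) (*) 2 0 (\<lambda>hs ls. F (hs ! 0) (hs ! 1))" if "bilinear F" for F
    using that unfolding multilinear_def bilinear_def
    by (auto simp: less_2_cases_iff linear_on_def)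
  then show thesis
    using that[where N = N and c = c and x = "\<lambda>k. hs k ! 0" and y = "\<lambda>k. hs k ! 1"] * by (simp add: sweedler_def)
qed

lemma bilinear_dual: "l \<in> dual (smult H) \<Longrightarrow> l' \<in> dual (smult H) \<Longrightarrow> bilinear (\<lambda>a b. l b * l' a)"
  by (simp add: dual_iff bilinear_def linear_on_cmult linear_on_multc)

lemma sweedler_linear: "linear_on UNIV (smult H) (\<lambda>h. sweedler H h F)"
  using coalgebra
  by (simp add: is_coalgebra_def linear_on_def sweedler_def Vector_Spaces.linear_iff tensor_scale_def)

lemma sweedler_add_cmult:
  assumes "bilinear F" "bilinear G"
  shows "sweedler H h (\<lambda>a b. F a b + G a b) = sweedler H h F + sweedler H h G"
    and "sweedler H h (\<lambda>a b. c * F a b) = c * sweedler H h F"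
proof -
  obtain N :: nat and z x y where *: "\<And>F. bilinear F \<Longrightarrow> sweedler H h F = (\<Sum>k<N. z k * F (x k) (y k))"
    by (rule sweedler_finite_sum[of h]) blast
  have "bilinear (\<lambda>a b. F a b + G a b)" "bilinear (\<lambda>a b. c * F a b)"
    using assms by (simp_all add: bilinear_def linear_on_def algebra_simps)
  with assms show "sweedler H h (\<lambda>a b. F a b + G a b) = sweedler H h F + sweedler H h G"
    "sweedler H h (\<lambda>a b. c * F a b) = c * sweedler H h F"
    by (simp_all add: * distrib_left sum.distrib sum_distrib_left mult.left_commute)
qed

lemma dual_mul_closed: "dual_mul H l l' \<in> dual (smult H)"
  by (simp add: dual_iff dual_mul_def sweedler_linear)

lemma dual_mul_assoc:
  assumes l: "l \<in> dual (smult H)" "l' \<in> dual (smult H)" "l'' \<in> dual (smult H)"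
  shows "dual_mul H (dual_mul H l l') l'' = dual_mul H l (dual_mul H l' l'')"
proof
  fix h
  define \<phi> where "\<phi> = (\<lambda>hs (ls :: ('h \<Rightarrow> 'k) list). l'' (hs ! 0) * l' (hs ! 1) * l (hs ! 2))"
  have "multilinear (smult H) (*) 3 0 \<phi>"
    using l unfolding multilinear_def \<phi>_def
    by (auto simp: dual_iff linear_on_def numeral_3_eq_3 less_Suc_eq nth_list_update algebra_simps)
  then have \<phi>: "pure H [a, c, d] [] \<phi> = l'' a * l' c * l d" for a c d
    by (simp add: pure_tensor_def \<phi>_def numeral_3_eq_3)
  have 1: "sweedler H b (\<lambda>c d. l'' a * l' c * l d) = sweedler H b (\<lambda>c d. l d * l' c) * l'' a" for a b
    using sweedler_add_cmult(2)[OF bilinear_dual[OF l(1,2)] bilinear_dual[OF l(1,2)], of b "l'' a"] by (simp add: mult_ac)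
  have 2: "sweedler H a (\<lambda>c d. l'' c * l' d * l b) = l b * sweedler H a (\<lambda>c d. l' d * l'' c)" for a b
    using sweedler_add_cmult(2)[OF bilinear_dual[OF l(2,3)] bilinear_dual[OF l(2,3)], of a "l b"] by (simp add: mult_ac)
  have "dual_mul H (dual_mul H l l') l'' h = sweedler H h (\<lambda>a b. sweedler H b (\<lambda>c d. pure H [a, c, d] [] \<phi>))"
    by (simp add: dual_mul_def \<phi> 1)
  also have "\<dots> = sweedler H h (\<lambda>a b. sweedler H a (\<lambda>c d. pure H [c, d, b] [] \<phi>))"
    using coalgebra by (simp add: is_coalgebra_def)
  also have "\<dots> = dual_mul H l (dual_mul H l' l'') h"
    by (simp add: dual_mul_def \<phi> 2)
  finally show "dual_mul H (dual_mul H l l') l'' h = dual_mul H l (dual_mul H l' l'') h" .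
qed

lemma dual_mul_counit:
  assumes "l \<in> dual (smult H)"
  shows "dual_mul H (counit H) l = l" "dual_mul H l (counit H) = l"
proof -
  have "multilinear (smult H) (*) 1 0 (\<lambda>hs (ls :: ('h \<Rightarrow> 'k) list). l (hs ! 0))"
    using assms by (auto simp: multilinear_def dual_iff linear_on_def)
  then have *: "pure H [h] [] (\<lambda>hs ls. l (hs ! 0)) = l h" for h
    by (simp add: pure_tensor_def)
  have "sweedler H h (\<lambda>a b. counit H a * pure H [b] [] \<phi>) = pure H [h] [] \<phi>"
    "sweedler H h (\<lambda>a b. counit H b * pure H [a] [] \<phi>) = pure H [h] [] \<phi>" for h \<phi>
    using coalgebra by (simp_all add: is_coalgebra_def)
  from this[where \<phi> = "\<lambda>hs ls. l (hs ! 0)"]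
  show "dual_mul H (counit H) l = l" "dual_mul H l (counit H) = l"
    by (simp_all add: dual_mul_def * mult.commute)
qed

lemma dual_mul_linear:
  assumes l: "l \<in> dual (smult H)" "l' \<in> dual (smult H)" "l'' \<in> dual (smult H)"
  shows "dual_mul H (l + l') l'' = dual_mul H l l'' + dual_mul H l' l''"
    "dual_mul H l'' (l + l') = dual_mul H l'' l + dual_mul H l'' l'"
    "dual_mul H (dual_scale c l) l'' = dual_scale c (dual_mul H l l'')"
    "dual_mul H l'' (dual_scale c l) = dual_scale c (dual_mul H l'' l)"
proof -
  note b = bilinear_dual[OF l(1,3)] bilinear_dual[OF l(2,3)] bilinear_dual[OF l(3,1)] bilinear_dual[OF l(3,2)]
  show "dual_mul H (l + l') l'' = dual_mul H l l'' + dual_mul H l' l''"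
    using sweedler_add_cmult(1)[OF b(1,2)] by (simp add: dual_mul_def fun_eq_iff distrib_right)
  show "dual_mul H l'' (l + l') = dual_mul H l'' l + dual_mul H l'' l'"
    using sweedler_add_cmult(1)[OF b(3,4)] by (simp add: dual_mul_def fun_eq_iff distrib_left)
  show "dual_mul H (dual_scale c l) l'' = dual_scale c (dual_mul H l l'')"
    using sweedler_add_cmult(2)[OF b(1,1)] by (simp add: dual_mul_def fun_eq_iff mult.assoc)
  show "dual_mul H l'' (dual_scale c l) = dual_scale c (dual_mul H l'' l)"
    using sweedler_add_cmult(2)[OF b(3,3)] by (simp add: dual_mul_def fun_eq_iff mult.left_commute)
qed

definition coord :: "'h \<Rightarrow> 'h \<Rightarrow> 'k" where
  "coord b h = VS.representation B h b"

lemma coord_sum: "(\<Sum>b\<in>B. smult H (coord b h) b) = h"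
  unfolding coord_def using VS.sum_representation_eq[OF VS.independent_Basis, of h B]
    VS.finite_Basis VS.span_Basis by auto

lemma coord_dual: "coord b \<in> dual (smult H)"
  by (simp add: dual_iff linear_on_def coord_def VS.representation_add VS.representation_scale
      VS.independent_Basis VS.span_Basis)

lemma dual_coord_sum:
  assumes "l \<in> dual (smult H)"
  shows "(\<Sum>b\<in>B. dual_scale (l b) (coord b)) = l"
proof
  fix h
  interpret l: Vector_Spaces.linear "smult H" "(*)" l using assms by (simp add: dual_def)
  have "l h = l (\<Sum>b\<in>B. smult H (coord b h) b)" by (simp add: coord_sum)
  also have "\<dots> = (\<Sum>b\<in>B. dual_scale (l b) (coord b)) h"
    by (simp add: l.sum l.scale sum_fun_apply mult.commute)
  finally show "(\<Sum>b\<in>B. dual_scale (l b) (coord b)) h = l h" by simp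
qed

sublocale dual_pair UNIV "smult H" "mul H" "one_of H" "dual (smult H)" dual_scale "dual_mul H" "counit H"
  "\<lambda>h l. l h" B "\<lambda>b. b" coord
proof
  show "smult H c x \<in> UNIV" for c x by simp
  show "l + l' \<in> dual (smult H)" if "l \<in> dual (smult H)" "l' \<in> dual (smult H)" for l l'
    using that by (simp add: dual_iff linear_on_def algebra_simps)
  show "dual_scale c l \<in> dual (smult H)" if "l \<in> dual (smult H)" for c l
    using that by (simp add: dual_iff linear_on_def algebra_simps)
  show "0 \<in> dual (smult H)" by (simp add: dual_iff linear_on_def)
  show "dual_mul H l l' \<in> dual (smult H)" for l l' by (rule dual_mul_closed)
  show "coord b \<in> dual (smult H)" for b by (rule coord_dual)
  show "counit H \<in> dual (smult H)"
    using coalgebra by (simp add: is_coalgebra_def dual_def)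
qed (use algebra in \<open>simp_all add: is_algebra_def Vector_Spaces.linear_iff dual_mul_assoc
    dual_mul_counit dual_mul_linear VS.finite_Basis coord_sum dual_coord_sum dual_iff
    linear_on_def\<close>)

text \<open>
  Both sides are linear in the coproduct, and by bilinearity \<open>F\<close> may be replaced by its expansion in
  the basis; what remains is the definition of the product on the dual.
\<close>

lemma sweedler_eq_D: assumes "bilinear F" shows "sweedler H h F = D h F"
proof -
  obtain N :: nat and c x y where *: "\<And>F. bilinear F \<Longrightarrow> sweedler H h F = (\<Sum>k<N. c k * F (x k) (y k))"
    by (rule sweedler_finite_sum[of h]) blast
  have F: "(\<Sum>i\<in>B. \<Sum>j\<in>B. coord i a * coord j b * F i j) = F a b" for a b
  proof -
    have "(\<Sum>i\<in>B. coord i a * (\<Sum>j\<in>B. coord j b * F i j)) = (\<Sum>i\<in>B. coord i a * F i b)"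
      using linear_expand[of "F i" b for i] assms by (simp add: bilinear_def)
    also have "\<dots> = F a b"
      using linear_expand[of "\<lambda>a. F a b" a] assms by (simp add: bilinear_def)
    finally show ?thesis by (simp add: sum_distrib_left mult.assoc)
  qed
  have "D h F = (\<Sum>i\<in>B. \<Sum>j\<in>B. \<Sum>k<N. c k * (coord i (x k) * coord j (y k) * F i j))"
    unfolding D_def dual_mul_def *[OF bilinear_dual[OF coord_dual coord_dual]]
    by (simp add: sum_distrib_left mult_ac)
  also have "\<dots> = (\<Sum>k<N. c k * (\<Sum>i\<in>B. \<Sum>j\<in>B. coord i (x k) * coord j (y k) * F i j))"
    unfolding sum_distrib_left by (subst sum.swap[of _ "{..<N}"], subst sum.swap[of _ "{..<N}"]) simp
  finally show ?thesis by (simp add: *[OF assms] F)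
qed

text \<open>
  As for \<open>sweedler_eq_D\<close>.  The defining property of the coproduct on the dual only concerns
  products of evaluations at elements of \<open>H\<close>, and the expansion of \<open>F\<close> in the dual basis reduces
  every bilinear form to these.
\<close>

lemma dual_sweedler_eq_D:
  assumes l: "l \<in> dual (smult H)"
    and F: "\<And>q. q \<in> dual (smult H) \<Longrightarrow> linear_on (dual (smult H)) dual_scale (\<lambda>p. F p q)"
      "\<And>p. p \<in> dual (smult H) \<Longrightarrow> linear_on (dual (smult H)) dual_scale (F p)"
  shows "dual_sweedler H l F = swap.D l F"
proof -
  have t: "dual_comul H l \<in> tensor_space (smult H) 0 2"
    "l (mul H h h') = dual_comul H l (\<lambda>hs ls. (ls ! 0) h' * (ls ! 1) h)" for h h'
    using theI'[OF dual_comul_exists_unique[OF basis algebra l]] unfolding dual_comul_def[symmetric]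
    by blast+
  obtain N :: nat and c and hs :: "nat \<Rightarrow> 'h list" and ls where
    mem: "\<And>k. k < N \<Longrightarrow> ls k \<in> tuples (dual (smult H)) 2" and
    sum: "\<And>\<phi>. multilinear (smult H) (*) 0 2 \<phi> \<Longrightarrow> dual_comul H l \<phi> = (\<Sum>k<N. c k * \<phi> (hs k) (ls k))"
    using tensor_space_sum[OF t(1)] by metis
  have bil: "dual_comul H l (\<lambda>hs ls. G (ls ! 0) (ls ! 1)) = (\<Sum>k<N. c k * G (ls k ! 0) (ls k ! 1))"
    if "\<And>q. q \<in> dual (smult H) \<Longrightarrow> linear_on (dual (smult H)) dual_scale (\<lambda>p. G p q)"
      "\<And>p. p \<in> dual (smult H) \<Longrightarrow> linear_on (dual (smult H)) dual_scale (G p)" for G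
  proof (rule sum)
    show "multilinear (smult H) (*) 0 2 (\<lambda>hs ls. G (ls ! 0) (ls ! 1))"
      unfolding multilinear_iff
    proof (intro conjI ballI)
      fix hs
      show "multilinear_on (dual (smult H)) dual_scale 2 (\<lambda>ls. G (ls ! 0) (ls ! 1))"
        unfolding numeral_2_eq_2
        by (intro multilinear_on_SucI)
          (auto simp: tuples_def length_Suc_conv that)
    qed simp
  qed
  have ev: "l (mul H h h') = (\<Sum>k<N. c k * ((ls k ! 0) h' * (ls k ! 1) h))" for h h'
    unfolding t(2) by (rule bil) (simp_all add: linear_on_def algebra_simps)
  have nth: "ls k ! 0 \<in> dual (smult H)" "ls k ! 1 \<in> dual (smult H)" if "k < N" for k
    using mem[OF that] by (auto simp: tuples_def)
  have F': "(\<Sum>i\<in>B. \<Sum>j\<in>B. p i * q j * F (coord i) (coord j)) = F p q"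
    if "p \<in> dual (smult H)" "q \<in> dual (smult H)" for p q
  proof -
    have "(\<Sum>i\<in>B. p i * (\<Sum>j\<in>B. q j * F (coord i) (coord j))) = (\<Sum>i\<in>B. p i * F (coord i) q)"
      using linear_expand_right[of "F (coord i)" q for i] F(2) coord_dual that by simp
    also have "\<dots> = F p q"
      using linear_expand_right[of "\<lambda>p. F p q" p] F(1) that by simp
    finally show ?thesis by (simp add: sum_distrib_left mult.assoc)
  qed
  have "swap.D l F = (\<Sum>i\<in>B. \<Sum>j\<in>B. \<Sum>k<N. c k * ((ls k ! 0) i * (ls k ! 1) j * F (coord i) (coord j)))"
    unfolding swap.D_def ev by (simp add: sum_distrib_right mult.assoc)
  also have "\<dots> = (\<Sum>k<N. c k * (\<Sum>i\<in>B. \<Sum>j\<in>B. (ls k ! 0) i * (ls k ! 1) j * F (coord i) (coord j)))"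
    unfolding sum_distrib_left by (subst sum.swap[of _ "{..<N}"], subst sum.swap[of _ "{..<N}"]) simp
  also have "\<dots> = dual_sweedler H l F"
    using nth bil[OF F] by (simp add: F' dual_sweedler_def)
  finally show ?thesis by simp
qed

sublocale dual_bialgebras UNIV "smult H" "mul H" "one_of H" "dual (smult H)" dual_scale "dual_mul H" "counit H"
  "\<lambda>h l. l h" B "\<lambda>b. b" coord
proof
  fix x y l l' assume l: "l \<in> dual (smult H)" "l' \<in> dual (smult H)"
  define \<phi> where "\<phi> = (\<lambda>hs (ls :: ('h \<Rightarrow> 'k) list). l (hs ! 1) * l' (hs ! 0))"
  have "multilinear (smult H) (*) 2 0 \<phi>"
    using l unfolding multilinear_def \<phi>_def
    by (auto simp: dual_iff linear_on_def less_2_cases_iff algebra_simps)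
  then have \<phi>: "pure H [a, b] [] \<phi> = l b * l' a" for a b
    by (simp add: pure_tensor_def \<phi>_def numeral_2_eq_2)
  have inner: "bilinear (\<lambda>c d. l (mul H b d) * l' (mul H a c))" for a b
    using l by (simp add: bilinear_def dual_iff linear_on_cmult linear_on_multc mul_linear)
  \<comment> \<open>The inner sum has to be replaced first: bilinearity of the outer integrand is only known for \<open>D\<close>.\<close>
  have outer: "bilinear (\<lambda>a b. D y (\<lambda>c d. l (mul H b d) * l' (mul H a c)))"
    using l by (auto simp: bilinear_def dual_iff intro!: linear_on_D linear_on_cmult linear_on_multc mul_linear)
  have "dual_mul H l l' (mul H x y) = comul H (mul H x y) \<phi>"
    by (simp add: dual_mul_def sweedler_def \<phi>_def)
  also have "\<dots> = sweedler H x (\<lambda>a b. sweedler H y (\<lambda>c d. pure H [mul H a c, mul H b d] [] \<phi>))"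
    using bialgebra by (simp add: is_bialgebra_def)
  also have "\<dots> = D x (\<lambda>a b. D y (\<lambda>c d. l (mul H b d) * l' (mul H a c)))"
    by (simp add: \<phi> sweedler_eq_D[OF inner] sweedler_eq_D[OF outer])
  finally show "dual_mul H l l' (mul H x y) = D x (\<lambda>a b. D y (\<lambda>c d. l (mul H b d) * l' (mul H a c)))" .
  have "pure H [one_of H, one_of H] [] \<phi> = dual_mul H l l' (one_of H)"
    using bialgebra by (simp add: is_bialgebra_def dual_mul_def sweedler_def \<phi>_def)
  then show "dual_mul H l l' (one_of H) = l (one_of H) * l' (one_of H)"
    by (simp add: \<phi>)
next
  fix x y
  show "counit H (mul H x y) = counit H x * counit H y"
    using bialgebra by (simp add: is_bialgebra_def)
qed

lemma represents_sweedler: "represents_D (sweedler H)"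
  unfolding represents_D_def using sweedler_eq_D by (simp add: bilinear_def)

lemma represents_dual_sweedler: "swap.represents_D (dual_sweedler H)"
  unfolding swap.represents_D_def using dual_sweedler_eq_D by blast

end

section \<open>The structure maps as transposes of faces\<close>

context finite_dim_bialgebra_basis
begin

abbreviation T :: "nat \<Rightarrow> nat \<Rightarrow> ('k, 'h) tensor set" where
  "T n m \<equiv> tensor_space (smult H) n m"

lemma form_iff: "form n m \<phi> \<longleftrightarrow> multilinear (smult H) (*) n m \<phi>"
  by (simp add: form_def multilinear_iff)

lemma subspace_T: "module.subspace tensor_scale (T n m)"
proof -
  interpret TS: vector_space "tensor_scale :: 'k \<Rightarrow> ('k, 'h) tensor \<Rightarrow> _"
    by (rule vector_space_tensor_scale)
  show ?thesis unfolding tensor_space_def by (rule TS.subspace_span)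
qed

lemma T_zero: "0 \<in> T n m" and T_add: "x \<in> T n m \<Longrightarrow> y \<in> T n m \<Longrightarrow> x + y \<in> T n m"
  and T_scale: "x \<in> T n m \<Longrightarrow> tensor_scale c x \<in> T n m"
proof -
  interpret TS: vector_space "tensor_scale :: 'k \<Rightarrow> ('k, 'h) tensor \<Rightarrow> _"
    by (rule vector_space_tensor_scale)
  note subspace_T[of n m]
  then show "0 \<in> T n m" "x \<in> T n m \<Longrightarrow> y \<in> T n m \<Longrightarrow> x + y \<in> T n m"
    "x \<in> T n m \<Longrightarrow> tensor_scale c x \<in> T n m"
    by (simp_all add: TS.subspace_def)
qed

lemma T_sum: "(\<And>i. i \<in> J \<Longrightarrow> f i \<in> T n m) \<Longrightarrow> sum f J \<in> T n m"
  by (induction J rule: infinite_finite_induct) (simp_all add: T_zero T_add)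

lemma pure_in_T: "hs \<in> tuples UNIV n \<Longrightarrow> ls \<in> tuples (dual (smult H)) m \<Longrightarrow> pure H hs ls \<in> T n m"
proof -
  interpret TS: vector_space "tensor_scale :: 'k \<Rightarrow> ('k, 'h) tensor \<Rightarrow> _"
    by (rule vector_space_tensor_scale)
  show "hs \<in> tuples UNIV n \<Longrightarrow> ls \<in> tuples (dual (smult H)) m \<Longrightarrow> pure H hs ls \<in> T n m"
    unfolding tensor_space_def by (rule TS.span_base) (auto simp: tuples_def)
qed

lemma pure_form: "form n m (\<lambda>hs ls. pure H hs ls \<phi>)"
  using pure_tensor_multilinear[of "smult H" n m]
  by (simp add: form_iff multilinear_def tensor_scale_def)

lemma pure_eval:
  "form n m \<phi> \<Longrightarrow> hs \<in> tuples UNIV n \<Longrightarrow> ls \<in> tuples (dual (smult H)) m \<Longrightarrow> pure H hs ls \<phi> = \<phi> hs ls"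
  by (simp add: form_iff pure_tensor_def tuples_length)

lemma T_eval:
  assumes "x \<in> T n m"
  obtains N :: nat and c hs ls where
    "\<And>k. k < N \<Longrightarrow> hs k \<in> tuples UNIV n" "\<And>k. k < N \<Longrightarrow> ls k \<in> tuples (dual (smult H)) m"
    "\<And>\<phi>. form n m \<phi> \<Longrightarrow> x \<phi> = (\<Sum>k<N. c k * \<phi> (hs k) (ls k))"
proof -
  obtain N :: nat and c hs ls where "\<forall>k<N. hs k \<in> tuples UNIV n \<and> ls k \<in> tuples (dual (smult H)) m"
    and "\<forall>\<phi>. x \<phi> = (if multilinear (smult H) (*) n m \<phi> then \<Sum>k<N. c k * \<phi> (hs k) (ls k) else 0)"
    using tensor_space_sum[OF assms] by blast
  then show thesis by (intro that[of N hs ls c]) (simp_all add: form_iff)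
qed

lemma T_not_form:
  assumes "x \<in> T n m" "\<not> form n m \<phi>"
  shows "x \<phi> = 0"
  using tensor_space_sum[OF assms(1)] assms(2) by (auto simp: form_iff)

lemma T_eqI:
  assumes "x \<in> T n m" "y \<in> T n m" "\<And>\<phi>. form n m \<phi> \<Longrightarrow> x \<phi> = y \<phi>"
  shows "x = y"
proof
  fix \<phi> show "x \<phi> = y \<phi>"
    using assms T_not_form[of x n m \<phi>] T_not_form[of y n m \<phi>] by (cases "form n m \<phi>") auto
qed

lemma T_combination:
  assumes x: "x \<in> T n m" and "form n m \<phi>" "form n m \<phi>'" "form n m \<phi>''" "form n m \<psi>"
    and eq: "\<And>hs ls. hs \<in> tuples UNIV n \<Longrightarrow> ls \<in> tuples (dual (smult H)) m \<Longrightarrow>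
      \<psi> hs ls = \<phi> hs ls + c' * \<phi>' hs ls + c'' * \<phi>'' hs ls"
  shows "x \<psi> = x \<phi> + c' * x \<phi>' + c'' * x \<phi>''"
proof -
  obtain N :: nat and c hs ls where *: "\<And>k. k < N \<Longrightarrow> hs k \<in> tuples UNIV n"
    "\<And>k. k < N \<Longrightarrow> ls k \<in> tuples (dual (smult H)) m"
    "\<And>\<phi>. form n m \<phi> \<Longrightarrow> x \<phi> = (\<Sum>k<N. c k * \<phi> (hs k) (ls k))"
    by (rule T_eval[OF x]) (rule that; simp)
  have "x \<psi> = (\<Sum>k<N. c k * (\<phi> (hs k) (ls k) + c' * \<phi>' (hs k) (ls k) + c'' * \<phi>'' (hs k) (ls k)))"
    unfolding *(3)[OF assms(5)] by (intro sum.cong refl) (simp add: eq *)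
  also have "\<dots> = x \<phi> + c' * x \<phi>' + c'' * x \<phi>''"
    unfolding *(3)[OF assms(2)] *(3)[OF assms(3)] *(3)[OF assms(4)]
    by (simp add: distrib_left sum.distrib sum_distrib_left mult.left_commute)
  finally show ?thesis .
qed

lemma T_vanish:
  assumes x: "x \<in> T n m" and "\<And>hs ls. hs \<in> tuples UNIV n \<Longrightarrow> ls \<in> tuples (dual (smult H)) m \<Longrightarrow> \<phi> hs ls = 0"
  shows "x \<phi> = 0"
proof -
  have "form n m (\<lambda>hs ls. 0)" by (simp add: form_def multilinear_on_def linear_on_def)
  then have \<phi>: "form n m \<phi>" by (rule form_cong) (rule assms(2))
  obtain N :: nat and c hs ls where *: "\<And>k. k < N \<Longrightarrow> hs k \<in> tuples UNIV n"
    "\<And>k. k < N \<Longrightarrow> ls k \<in> tuples (dual (smult H)) m"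
    "\<And>\<phi>. form n m \<phi> \<Longrightarrow> x \<phi> = (\<Sum>k<N. c k * \<phi> (hs k) (ls k))"
    by (rule T_eval[OF x]) (rule that; simp)
  show ?thesis unfolding *(3)[OF \<phi>] by (intro sum.neutral ballI) (simp add: assms(2) *)
qed

text \<open>
  \<open>g\<close> is the transpose of \<open>d\<close>, in the sense that \<open>(d x) \<phi> = x (g \<phi>)\<close>.
\<close>

definition is_transpose where
  "is_transpose n m n' m' d g \<longleftrightarrow> (\<forall>x\<in>T n m. d x \<in> T n' m' \<and> (\<forall>\<phi>. form n' m' \<phi> \<longrightarrow> form n m (g \<phi>) \<and> d x \<phi> = x (g \<phi>)))"

text \<open>
  Since \<open>pure H hs ls \<phi>\<close> is \<open>\<phi> hs ls\<close> for a form \<open>\<phi>\<close>, a formula for the images of pure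
  tensors can be read as a formula for the transpose.  Keeping \<open>pure\<close> in the first assumption lets it hold for all
  \<open>\<phi>\<close>: as a function of \<open>hs\<close> and \<open>ls\<close>, \<open>pure H hs ls \<phi>\<close> is a form in any case.
\<close>

lemma transpose_linear_ext:
  assumes f: "\<And>hs ls \<phi>. hs \<in> tuples UNIV n \<Longrightarrow> ls \<in> tuples (dual (smult H)) m \<Longrightarrow>
      f hs ls \<phi> = g (\<lambda>hs ls. pure H hs ls \<phi>) hs ls"
    and mem: "\<And>hs ls. hs \<in> tuples UNIV n \<Longrightarrow> ls \<in> tuples (dual (smult H)) m \<Longrightarrow> f hs ls \<in> T n' m'"
    and g_form: "\<And>\<phi>. form n' m' \<phi> \<Longrightarrow> form n m (g \<phi>)"
    and g_cong: "\<And>\<phi> \<psi> hs ls. (\<And>hs ls. hs \<in> tuples UNIV n' \<Longrightarrow> ls \<in> tuples (dual (smult H)) m' \<Longrightarrow> \<phi> hs ls = \<psi> hs ls) \<Longrightarrow>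
      hs \<in> tuples UNIV n \<Longrightarrow> ls \<in> tuples (dual (smult H)) m \<Longrightarrow> g \<phi> hs ls = g \<psi> hs ls"
  shows "is_transpose n m n' m' (linear_ext f) g"
  unfolding is_transpose_def
proof (intro ballI conjI allI impI)
  fix x assume x: "x \<in> T n m"
  obtain N :: nat and c hs ls where *: "\<And>k. k < N \<Longrightarrow> hs k \<in> tuples UNIV n"
    "\<And>k. k < N \<Longrightarrow> ls k \<in> tuples (dual (smult H)) m"
    "\<And>\<phi>. form n m \<phi> \<Longrightarrow> x \<phi> = (\<Sum>k<N. c k * \<phi> (hs k) (ls k))"
    by (rule T_eval[OF x]) (rule that; simp)
  have form: "form n m (\<lambda>hs ls. f hs ls \<phi>)" for \<phi>
    by (rule form_cong[OF g_form[OF pure_form]]) (rule f)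
  have sum: "linear_ext f x \<phi> = (\<Sum>k<N. c k * f (hs k) (ls k) \<phi>)" for \<phi>
    unfolding linear_ext_def using *(3)[OF form] .
  then have "linear_ext f x = (\<Sum>k<N. tensor_scale (c k) (f (hs k) (ls k)))"
    by (simp add: fun_eq_iff sum_fun_apply tensor_scale_def)
  then show "linear_ext f x \<in> T n' m'"
    using * by (auto intro!: T_sum T_scale mem)
  fix \<phi> assume \<phi>: "form n' m' \<phi>"
  show "form n m (g \<phi>)" by (rule g_form[OF \<phi>])
  have "f hs ls \<phi> = g \<phi> hs ls" if "hs \<in> tuples UNIV n" "ls \<in> tuples (dual (smult H)) m" for hs ls
    unfolding f[OF that] by (rule g_cong) (simp_all add: pure_eval[OF \<phi>] that)
  then show "linear_ext f x \<phi> = x (g \<phi>)"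
    unfolding sum *(3)[OF g_form[OF \<phi>]] using * by simp
qed

lemma linear_ext_zero:
  assumes "x \<in> T n m" "\<And>hs ls. hs \<in> tuples UNIV n \<Longrightarrow> ls \<in> tuples (dual (smult H)) m \<Longrightarrow> f hs ls = 0"
  shows "linear_ext f x = 0"
  unfolding linear_ext_def zero_fun_def
  by (rule ext, rule T_vanish[OF assms(1)]) (simp add: assms(2))

lemma eps_eq: "eps = counit H"
  by (simp add: eps_def fun_eq_iff)

lemma swap_eps_eq: "swap.eps = dual_counit H"
  by (simp add: swap.eps_def dual_counit_def fun_eq_iff)

lemma pairing_eq: "pairing ls hs = pairing_list ls hs"
  by (simp add: pairing_def pairing_list_def)

lemma T_subspace_fun:
  "(\<lambda>\<phi>. 0) \<in> T n m" "x \<in> T n m \<Longrightarrow> y \<in> T n m \<Longrightarrow> (\<lambda>\<phi>. x \<phi> + y \<phi>) \<in> T n m"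
  "x \<in> T n m \<Longrightarrow> (\<lambda>\<phi>. c * x \<phi>) \<in> T n m"
  using T_zero T_add[of x n m y] T_scale[of x n m c]
  by (simp_all add: zero_fun_def plus_fun_def tensor_scale_def)

lemma transpose_d_bar: "is_transpose (Suc n) m n m (d_bar H) (boundary 0 0 (Suc n))"
  unfolding d_bar_def
proof (rule transpose_linear_ext)
  fix hs :: "'h list" and ls :: "('h \<Rightarrow> 'k) list" assume t: "hs \<in> tuples UNIV (Suc n)" "ls \<in> tuples (dual (smult H)) m"
  show "(\<Sum>i\<in>{1..<length hs}. tensor_scale ((-1) ^ i) (pure H (contract (mul H) i hs) ls)) \<phi>
      = boundary 0 0 (Suc n) (\<lambda>hs ls. pure H hs ls \<phi>) hs ls" for \<phi>
    by (simp add: boundary_inner[OF t(1)] sum_fun_apply tensor_scale_def)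
  show "(\<Sum>i\<in>{1..<length hs}. tensor_scale ((-1) ^ i) (pure H (contract (mul H) i hs) ls)) \<in> T n m"
    using t by (intro T_sum T_scale pure_in_T contract_tuples_V) (auto simp: tuples_length)
qed (auto intro: form_boundary boundary_cong)

lemma transpose_d_cob: "is_transpose n (Suc m) n m (d_cob H) (coboundary 0 0 (Suc m))"
  unfolding d_cob_def
proof (rule transpose_linear_ext)
  fix hs :: "'h list" and ls :: "('h \<Rightarrow> 'k) list" assume t: "hs \<in> tuples UNIV n" "ls \<in> tuples (dual (smult H)) (Suc m)"
  show "(\<Sum>i\<in>{1..<length ls}. tensor_scale ((-1) ^ i) (pure H hs (contract (dual_mul H) i ls))) \<phi>
      = coboundary 0 0 (Suc m) (\<lambda>hs ls. pure H hs ls \<phi>) hs ls" for \<phi>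
    by (simp add: swap.boundary_inner[OF t(2)] sum_fun_apply tensor_scale_def)
  show "(\<Sum>i\<in>{1..<length ls}. tensor_scale ((-1) ^ i) (pure H hs (contract (dual_mul H) i ls))) \<in> T n m"
    using t by (intro T_sum T_scale pure_in_T swap.contract_tuples_V) (auto simp: tuples_length)
qed (auto intro: swap.form_boundary swap.boundary_cong simp: form_swap[symmetric])

lemma transpose_pi_R: "is_transpose (Suc n) m n m (pi_R H) (face 1 1 (Suc n))"
  unfolding pi_R_def
proof (rule transpose_linear_ext)
  fix hs :: "'h list" and ls :: "('h \<Rightarrow> 'k) list" assume t: "hs \<in> tuples UNIV (Suc n)" "ls \<in> tuples (dual (smult H)) m"
  let ?f = "if hs = [] then 0 else (\<lambda>\<phi>. sweedler_list (dual_sweedler H) ls (\<lambda>ps qs.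
       sweedler_iter (sweedler H) (counit H) (length ls) (last hs) (\<lambda>as.
         pairing (rev ps) as * pure H (butlast hs) qs \<phi>)))"
  have f: "?f = (\<lambda>\<phi>. act R ls (last hs) (\<lambda>qs. pure H (butlast hs) qs \<phi>))"
    using t sweedler_sum_R[OF represents_sweedler represents_dual_sweedler
        formD(2)[OF pure_form] t(2), of "butlast hs" n "last hs"] tuples_ends[OF t(1)]
    by (auto simp: eps_eq pairing_eq tuples_length)
  show "?f \<phi> = face 1 1 (Suc n) (\<lambda>hs ls. pure H hs ls \<phi>) hs ls" for \<phi>
    unfolding f by (simp add: face_last[OF t(1)])
  show "?f \<in> T n m"
    unfolding f using t tuples_ends[OF t(1)]
    by (intro act_in_subspace[OF bilinear_action_R _ _ _ t(2)] T_subspace_fun pure_in_T) auto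
qed (auto intro: form_face face_cong)

lemma transpose_pi_L: "is_transpose (Suc n) m n m (pi_L H) (face 1 1 0)"
  unfolding pi_L_def
proof (rule transpose_linear_ext)
  fix hs :: "'h list" and ls :: "('h \<Rightarrow> 'k) list" assume t: "hs \<in> tuples UNIV (Suc n)" "ls \<in> tuples (dual (smult H)) m"
  let ?f = "if hs = [] then 0 else (\<lambda>\<phi>. sweedler_list (dual_sweedler H) ls (\<lambda>ps qs.
       sweedler_iter (sweedler H) (counit H) (length ls) (hd hs) (\<lambda>as.
         pairing (rev qs) as * pure H (tl hs) ps \<phi>)))"
  have f: "?f = (\<lambda>\<phi>. act L ls (hd hs) (\<lambda>qs. pure H (tl hs) qs \<phi>))"
    using t sweedler_sum_L[OF represents_sweedler represents_dual_sweedler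
        formD(2)[OF pure_form] t(2), of "tl hs" n "hd hs"] tuples_ends[OF t(1)]
    by (auto simp: eps_eq pairing_eq tuples_length)
  show "?f \<phi> = face 1 1 0 (\<lambda>hs ls. pure H hs ls \<phi>) hs ls" for \<phi>
    unfolding f by (simp add: face_first)
  show "?f \<in> T n m"
    unfolding f using t tuples_ends[OF t(1)]
    by (intro act_in_subspace[OF bilinear_action_L _ _ _ t(2)] T_subspace_fun pure_in_T) auto
qed (auto intro: form_face face_cong)

lemma transpose_pi_R_dual: "is_transpose n (Suc m) n m (pi_R_dual H) (coface 1 1 (Suc m))"
  unfolding pi_R_dual_def
proof (rule transpose_linear_ext)
  fix hs :: "'h list" and ls :: "('h \<Rightarrow> 'k) list" assume t: "hs \<in> tuples UNIV n" "ls \<in> tuples (dual (smult H)) (Suc m)"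
  let ?f = "if ls = [] then 0 else (\<lambda>\<phi>. sweedler_list (sweedler H) hs (\<lambda>as bs.
       sweedler_iter (dual_sweedler H) (dual_counit H) (length hs) (last ls) (\<lambda>ps.
         pairing ps (rev as) * pure H bs (butlast ls) \<phi>)))"
  have f: "?f = (\<lambda>\<phi>. swap.act swap.R hs (last ls) (\<lambda>bs. pure H bs (butlast ls) \<phi>))"
    using t swap.sweedler_sum_R[OF represents_dual_sweedler represents_sweedler
        formD(1)[OF pure_form] t(1), of "butlast ls" m "last ls"] swap.tuples_ends[OF t(2)]
    by (auto simp: swap_eps_eq pairing_eq pairing_list_swap tuples_length)
  show "?f \<phi> = coface 1 1 (Suc m) (\<lambda>hs ls. pure H hs ls \<phi>) hs ls" for \<phi>
    unfolding f by (simp add: swap.face_last[OF t(2)])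
  show "?f \<in> T n m"
    unfolding f using t swap.tuples_ends[OF t(2)]
    by (intro swap.act_in_subspace[OF swap.bilinear_action_R _ _ _ t(1)] T_subspace_fun pure_in_T) auto
qed (auto intro: swap.form_face swap.face_cong simp: form_swap[symmetric])

lemma transpose_pi_L_dual: "is_transpose n (Suc m) n m (pi_L_dual H) (coface 1 1 0)"
  unfolding pi_L_dual_def
proof (rule transpose_linear_ext)
  fix hs :: "'h list" and ls :: "('h \<Rightarrow> 'k) list" assume t: "hs \<in> tuples UNIV n" "ls \<in> tuples (dual (smult H)) (Suc m)"
  let ?f = "if ls = [] then 0 else (\<lambda>\<phi>. sweedler_list (sweedler H) hs (\<lambda>as bs.
       sweedler_iter (dual_sweedler H) (dual_counit H) (length hs) (hd ls) (\<lambda>ps.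
         pairing ps (rev bs) * pure H as (tl ls) \<phi>)))"
  have f: "?f = (\<lambda>\<phi>. swap.act swap.L hs (hd ls) (\<lambda>bs. pure H bs (tl ls) \<phi>))"
    using t swap.sweedler_sum_L[OF represents_dual_sweedler represents_sweedler
        formD(1)[OF pure_form] t(1), of "tl ls" m "hd ls"] swap.tuples_ends[OF t(2)]
    by (auto simp: swap_eps_eq pairing_eq pairing_list_swap tuples_length)
  show "?f \<phi> = coface 1 1 0 (\<lambda>hs ls. pure H hs ls \<phi>) hs ls" for \<phi>
    unfolding f by (simp add: swap.face_first)
  show "?f \<in> T n m"
    unfolding f using t swap.tuples_ends[OF t(2)]
    by (intro swap.act_in_subspace[OF swap.bilinear_action_L _ _ _ t(1)] T_subspace_fun pure_in_T) auto
qed (auto intro: swap.form_face swap.face_cong simp: form_swap[symmetric])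

end

section \<open>The bicomplexes\<close>

lemma linear_ext_add: "linear_ext f (x + y) = linear_ext f x + linear_ext f y"
  and linear_ext_scale: "linear_ext f (tensor_scale c x) = tensor_scale c (linear_ext f x)"
  by (simp_all add: linear_ext_def tensor_scale_def fun_eq_iff)

lemma tensor_scale_simps:
  "tensor_scale c (x + y) = tensor_scale c x + tensor_scale c y"
  "tensor_scale c (tensor_scale c' x) = tensor_scale (c * c') x"
  "tensor_scale 0 x = 0" "tensor_scale 1 x = x" "tensor_scale c 0 = 0"
  by (simp_all add: tensor_scale_def fun_eq_iff algebra_simps)

context finite_dim_bialgebra_basis
begin

text \<open>
  The four differentials of each direction at once; \<open>n\<close> and \<open>m\<close> are the degrees of the source,
  which enter through the signs.
\<close>

definition d :: "'k \<Rightarrow> 'k \<Rightarrow> nat \<Rightarrow> ('k, 'h) tensor \<Rightarrow> ('k, 'h) tensor" where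
  "d \<alpha> \<beta> n x = d_bar H x + tensor_scale (\<beta> * (-1) ^ n) (pi_R H x) + tensor_scale \<alpha> (pi_L H x)"

definition d' :: "'k \<Rightarrow> 'k \<Rightarrow> nat \<Rightarrow> nat \<Rightarrow> ('k, 'h) tensor \<Rightarrow> ('k, 'h) tensor" where
  "d' \<gamma> \<delta> n m x = tensor_scale ((-1) ^ n) (d_cob H x)
     + tensor_scale (\<gamma> * (-1) ^ n) (pi_L_dual H x) + tensor_scale (\<delta> * (-1) ^ (n + m)) (pi_R_dual H x)"

lemma d_linear: "d \<alpha> \<beta> n (x + y) = d \<alpha> \<beta> n x + d \<alpha> \<beta> n y"
  "d \<alpha> \<beta> n (tensor_scale c x) = tensor_scale c (d \<alpha> \<beta> n x)"
  by (simp_all add: d_def d_bar_def pi_R_def pi_L_def linear_ext_add linear_ext_scale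
      tensor_scale_simps mult.commute)

lemma d'_linear: "d' \<gamma> \<delta> n m (x + y) = d' \<gamma> \<delta> n m x + d' \<gamma> \<delta> n m y"
  "d' \<gamma> \<delta> n m (tensor_scale c x) = tensor_scale c (d' \<gamma> \<delta> n m x)"
  by (simp_all add: d'_def d_cob_def pi_R_dual_def pi_L_dual_def linear_ext_add linear_ext_scale
      tensor_scale_simps mult.commute)

lemma d_zero: "d \<alpha> \<beta> n 0 = 0" and d'_zero: "d' \<gamma> \<delta> n m 0 = 0"
  using d_linear(2)[of \<alpha> \<beta> n 0 0] d'_linear(2)[of \<gamma> \<delta> n m 0 0] by (simp_all add: tensor_scale_simps)

lemma d_bottom:
  assumes "x \<in> T 0 m"
  shows "d \<alpha> \<beta> n x = 0"
proof -
  have "linear_ext f x = 0" if "\<And>ls. f [] ls = 0" for f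
    by (rule linear_ext_zero[OF assms]) (simp add: that)
  then show ?thesis by (simp add: d_def d_bar_def pi_R_def pi_L_def tensor_scale_simps)
qed

lemma d'_bottom:
  assumes "x \<in> T n 0"
  shows "d' \<gamma> \<delta> n' m x = 0"
proof -
  have "linear_ext f x = 0" if "\<And>hs. f hs [] = 0" for f
    by (rule linear_ext_zero[OF assms]) (simp add: that)
  then show ?thesis by (simp add: d'_def d_cob_def pi_R_dual_def pi_L_dual_def tensor_scale_simps)
qed

lemma transposeD:
  assumes "is_transpose n m n' m' f g" "x \<in> T n m"
  shows "f x \<in> T n' m'" "form n' m' \<phi> \<Longrightarrow> form n m (g \<phi>)" "form n' m' \<phi> \<Longrightarrow> f x \<phi> = x (g \<phi>)"
  using assms by (auto simp: is_transpose_def)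

lemma transpose_d: "is_transpose (Suc n) m n m (d \<alpha> \<beta> (Suc n)) (boundary \<alpha> \<beta> (Suc n))"
  unfolding is_transpose_def
proof (intro ballI conjI allI impI)
  fix x assume x: "x \<in> T (Suc n) m"
  note bar = transposeD[OF transpose_d_bar x]
    and R = transposeD[OF transpose_pi_R x] and L = transposeD[OF transpose_pi_L x]
  show "d \<alpha> \<beta> (Suc n) x \<in> T n m"
    unfolding d_def by (intro T_add T_scale bar R L)
  fix \<phi> assume \<phi>: "form n m \<phi>"
  show "form (Suc n) m (boundary \<alpha> \<beta> (Suc n) \<phi>)" by (rule form_boundary[OF \<phi>])
  have "x (boundary \<alpha> \<beta> (Suc n) \<phi>) = x (boundary 0 0 (Suc n) \<phi>)
      + (\<beta> * (-1) ^ Suc n) * x (face 1 1 (Suc n) \<phi>) + \<alpha> * x (face 1 1 0 \<phi>)"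
    by (rule T_combination[OF x bar(2)[OF \<phi>] R(2)[OF \<phi>] L(2)[OF \<phi>] form_boundary[OF \<phi>]])
      (rule boundary_outer)
  then show "d \<alpha> \<beta> (Suc n) x \<phi> = x (boundary \<alpha> \<beta> (Suc n) \<phi>)"
    by (simp add: d_def tensor_scale_def bar(3)[OF \<phi>] R(3)[OF \<phi>] L(3)[OF \<phi>])
qed

lemma form_coboundary: "form n m \<phi> \<Longrightarrow> form n (Suc m) (coboundary \<gamma> \<delta> (Suc m) \<phi>)"
  using swap.form_boundary[of m n "\<lambda>ws vs. \<phi> vs ws" \<gamma> \<delta>] form_swap[of m n "coboundary \<gamma> \<delta> (Suc m) \<phi>"]
    form_swap[of m n \<phi>] form_swap[of "Suc m" n "coboundary \<gamma> \<delta> (Suc m) \<phi>"] by simp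

lemma d'_transpose:
  assumes x: "x \<in> T n (Suc m)"
  shows "d' \<gamma> \<delta> n' (Suc m) x \<in> T n m"
    and "form n m \<phi> \<Longrightarrow> d' \<gamma> \<delta> n' (Suc m) x \<phi> = (-1) ^ n' * x (coboundary \<gamma> \<delta> (Suc m) \<phi>)"
proof -
  note cob = transposeD[OF transpose_d_cob x]
    and R = transposeD[OF transpose_pi_R_dual x] and L = transposeD[OF transpose_pi_L_dual x]
  show "d' \<gamma> \<delta> n' (Suc m) x \<in> T n m"
    unfolding d'_def by (intro T_add T_scale cob R L)
  assume \<phi>: "form n m \<phi>"
  have *: "x (coboundary \<gamma> \<delta> (Suc m) \<phi>) = x (coboundary 0 0 (Suc m) \<phi>)
      + (\<delta> * (-1) ^ Suc m) * x (coface 1 1 (Suc m) \<phi>) + \<gamma> * x (coface 1 1 0 \<phi>)"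
    by (rule T_combination[OF x cob(2)[OF \<phi>] R(2)[OF \<phi>] L(2)[OF \<phi>] form_coboundary[OF \<phi>]])
      (rule swap.boundary_outer)
  show "d' \<gamma> \<delta> n' (Suc m) x \<phi> = (-1) ^ n' * x (coboundary \<gamma> \<delta> (Suc m) \<phi>)"
    unfolding *
    by (simp add: d'_def tensor_scale_def cob(3)[OF \<phi>] R(3)[OF \<phi>] L(3)[OF \<phi>] power_add algebra_simps)
qed

text \<open>
  Only degrees \<open>n \<ge> 2\<close> need the cancellation of faces; in lower degrees the target is zero.
\<close>

lemma d_d:
  assumes x: "x \<in> T n m" and idem: "\<alpha> * \<alpha> = \<alpha>" "\<beta> * \<beta> = \<beta>"
  shows "d \<alpha> \<beta> (n - 1) (d \<alpha> \<beta> n x) = 0"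
proof (cases n)
  case 0
  then show ?thesis using x by (simp add: d_bottom d_zero)
next
  case (Suc k)
  note dx = transposeD[OF transpose_d x[unfolded Suc]]
  show ?thesis
  proof (cases k)
    case 0
    then show ?thesis using d_bottom[of _ m] dx(1) Suc by simp
  next
    case k: (Suc l)
    note ddx = transposeD[OF transpose_d dx(1)[unfolded k]]
    have "d \<alpha> \<beta> (Suc l) (d \<alpha> \<beta> (Suc (Suc l)) x) = 0"
    proof (rule T_eqI[OF _ T_zero])
      show "d \<alpha> \<beta> (Suc l) (d \<alpha> \<beta> (Suc (Suc l)) x) \<in> T l m" using ddx(1) k by simp
      fix \<phi> assume \<phi>: "form l m \<phi>"
      have "d \<alpha> \<beta> (Suc l) (d \<alpha> \<beta> (Suc (Suc l)) x) \<phi>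
          = x (boundary \<alpha> \<beta> (Suc (Suc l)) (boundary \<alpha> \<beta> (Suc l) \<phi>))"
        using ddx(3)[OF \<phi>] dx(3) form_boundary[OF \<phi>] k by simp
      also have "\<dots> = 0"
        by (rule T_vanish[OF x[unfolded Suc k]]) (rule boundary_boundary[OF \<phi> _ _ idem])
      finally show "d \<alpha> \<beta> (Suc l) (d \<alpha> \<beta> (Suc (Suc l)) x) \<phi> = 0 \<phi>" by simp
    qed
    then show ?thesis using Suc k by simp
  qed
qed

lemma d'_d':
  assumes x: "x \<in> T n m" and idem: "\<gamma> * \<gamma> = \<gamma>" "\<delta> * \<delta> = \<delta>"
  shows "d' \<gamma> \<delta> n (m - 1) (d' \<gamma> \<delta> n m x) = 0"
proof (cases m)
  case 0
  then show ?thesis using x by (simp add: d'_bottom d'_zero)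
next
  case (Suc k)
  note dx = d'_transpose[OF x[unfolded Suc]]
  show ?thesis
  proof (cases k)
    case 0
    then show ?thesis using d'_bottom[of _ n] dx(1) Suc by simp
  next
    case k: (Suc l)
    note ddx = d'_transpose[OF dx(1)[unfolded k]]
    have "d' \<gamma> \<delta> n (Suc l) (d' \<gamma> \<delta> n (Suc (Suc l)) x) = 0"
    proof (rule T_eqI[OF ddx(1) T_zero])
      fix \<phi> assume \<phi>: "form n l \<phi>"
      have "x (coboundary \<gamma> \<delta> (Suc (Suc l)) (coboundary \<gamma> \<delta> (Suc l) \<phi>)) = 0"
        by (rule T_vanish[OF x[unfolded Suc k]])
          (rule swap.boundary_boundary[OF \<phi>[folded form_swap] _ _ idem])
      then show "d' \<gamma> \<delta> n (Suc l) (d' \<gamma> \<delta> n (Suc (Suc l)) x) \<phi> = 0 \<phi>"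
        using ddx(2)[OF \<phi>] dx(2)[of "coboundary \<gamma> \<delta> (Suc l) \<phi>"] form_coboundary[OF \<phi>] k by simp
    qed
    then show ?thesis using Suc k by simp
  qed
qed

text \<open>
  The boundaries of the two directions commute; \<open>d'\<close> carries the sign \<open>(-1)\<^sup>n\<close> in one composite
  and \<open>(-1)\<^sup>n\<^sup>-\<^sup>1\<close> in the other.
\<close>

lemma d_d'_anticommute:
  assumes x: "x \<in> T n m"
  shows "d \<alpha> \<beta> n (d' \<gamma> \<delta> n m x) + d' \<gamma> \<delta> (n - 1) m (d \<alpha> \<beta> n x) = 0"
proof (cases n)
  case 0
  have "d' \<gamma> \<delta> 0 m x \<in> T 0 (m - 1)"
    using x 0 d'_transpose(1) d'_bottom T_zero by (cases m) auto
  then show ?thesis using x 0 by (simp add: d_bottom d'_zero)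
next
  case n: (Suc n')
  note dx = transposeD[OF transpose_d x[unfolded n]]
  show ?thesis
  proof (cases m)
    case 0
    then show ?thesis using d'_bottom[of _ n'] d'_bottom[of x n] x dx(1) n by (simp add: d_zero)
  next
    case m: (Suc m')
    note d'x = d'_transpose[OF x[unfolded m]]
    note x' = x[unfolded n m]
    note dd'x = transposeD[OF transpose_d d'x(1)[unfolded n]]
    note d'dx = d'_transpose[OF dx(1)[unfolded m]]
    have "d \<alpha> \<beta> (Suc n') (d' \<gamma> \<delta> (Suc n') (Suc m') x) + d' \<gamma> \<delta> n' (Suc m') (d \<alpha> \<beta> (Suc n') x) = 0"
    proof (rule T_eqI[OF T_add[OF dd'x(1) d'dx(1)] T_zero])
      fix \<phi> assume \<phi>: "form n' m' \<phi>"
      have "x (coboundary \<gamma> \<delta> (Suc m') (boundary \<alpha> \<beta> (Suc n') \<phi>))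
          = x (boundary \<alpha> \<beta> (Suc n') (coboundary \<gamma> \<delta> (Suc m') \<phi>))"
      proof -
        note fb = form_coboundary[OF form_boundary[OF \<phi>]] and fc = form_boundary[OF form_coboundary[OF \<phi>]]
        have "x (coboundary \<gamma> \<delta> (Suc m') (boundary \<alpha> \<beta> (Suc n') \<phi>))
            = x (boundary \<alpha> \<beta> (Suc n') (coboundary \<gamma> \<delta> (Suc m') \<phi>))
              + 0 * x (boundary \<alpha> \<beta> (Suc n') (coboundary \<gamma> \<delta> (Suc m') \<phi>))
              + 0 * x (boundary \<alpha> \<beta> (Suc n') (coboundary \<gamma> \<delta> (Suc m') \<phi>))"
          by (rule T_combination[OF x' fc fc fc fb]) (simp add: boundary_coboundary[OF \<phi>])
        then show ?thesis by simp
      qed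
      then show "(d \<alpha> \<beta> (Suc n') (d' \<gamma> \<delta> (Suc n') (Suc m') x)
          + d' \<gamma> \<delta> n' (Suc m') (d \<alpha> \<beta> (Suc n') x)) \<phi> = 0 \<phi>"
        using dd'x(3)[OF \<phi>] d'x(2)[of "boundary \<alpha> \<beta> (Suc n') \<phi>"] form_boundary[OF \<phi>]
          d'dx(2)[OF \<phi>] dx(3)[of "coboundary \<gamma> \<delta> (Suc m') \<phi>"] form_coboundary[OF \<phi>] n m by simp
    qed
    then show ?thesis using n m by simp
  qed
qed

theorem bicomplex_d_d':
  assumes "\<alpha> * \<alpha> = \<alpha>" "\<beta> * \<beta> = \<beta>" "\<gamma> * \<gamma> = \<gamma>" "\<delta> * \<delta> = \<delta>"
  shows "bicomplex tensor_scale T (\<lambda>n m. d \<alpha> \<beta> n) (d' \<gamma> \<delta>)"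
  unfolding bicomplex_def
proof (intro conjI allI ballI)
  fix n m
  show "graded_map tensor_scale (T n m) (if n = 0 then {0} else T (n - 1) m) (d \<alpha> \<beta> n)"
    using d_bottom transposeD(1)[OF transpose_d]
    by (cases n) (auto simp: graded_map_def d_linear)
  show "graded_map tensor_scale (T n m) (if m = 0 then {0} else T n (m - 1)) (d' \<gamma> \<delta> n m)"
    using d'_bottom d'_transpose(1)
    by (cases m) (auto simp: graded_map_def d'_linear)
  fix x assume x: "x \<in> T n m"
  show "d \<alpha> \<beta> (n - 1) (d \<alpha> \<beta> n x) = 0" by (rule d_d[OF x assms(1,2)])
  show "d' \<gamma> \<delta> n (m - 1) (d' \<gamma> \<delta> n m x) = 0" by (rule d'_d'[OF x assms(3,4)])
  show "d \<alpha> \<beta> n (d' \<gamma> \<delta> n m x) + d' \<gamma> \<delta> (n - 1) m (d \<alpha> \<beta> n x) = 0"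
    by (rule d_d'_anticommute[OF x])
qed (simp_all add: vector_space_tensor_scale subspace_T)

end

theorem proposition6p12:
  fixes H :: "('k::field, 'h::ab_group_add) bialgebra"
  assumes "finite_dim_bialgebra H"
  shows
    "bicomplex tensor_scale (tensor_space (smult H))
       (\<lambda>n m x. d_bar H x)
       (\<lambda>n m x. tensor_scale ((-1) ^ n) (d_cob H x))
     \<and> bicomplex tensor_scale (tensor_space (smult H))
       (\<lambda>n m x. d_bar H x + tensor_scale ((-1) ^ n) (pi_R H x))
       (\<lambda>n m x. tensor_scale ((-1) ^ n) (d_cob H x) + tensor_scale ((-1) ^ n) (pi_L_dual H x))
     \<and> bicomplex tensor_scale (tensor_space (smult H))
       (\<lambda>n m x. d_bar H x + pi_L H x)
       (\<lambda>n m x. tensor_scale ((-1) ^ n) (d_cob H x) + tensor_scale ((-1) ^ (n + m)) (pi_R_dual H x))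
     \<and> bicomplex tensor_scale (tensor_space (smult H))
       (\<lambda>n m x. d_bar H x + tensor_scale ((-1) ^ n) (pi_R H x) + pi_L H x)
       (\<lambda>n m x. tensor_scale ((-1) ^ n) (d_cob H x) + tensor_scale ((-1) ^ n) (pi_L_dual H x)
          + tensor_scale ((-1) ^ (n + m)) (pi_R_dual H x))"
proof -
  obtain B where "finite_dimensional_vector_space (smult H) B" "is_bialgebra H"
    using assms by (auto simp: finite_dim_bialgebra_def)
  then interpret finite_dim_bialgebra_basis H B by (rule finite_dim_bialgebra_basis.intro)
  note unfolded = bicomplex_d_d'[unfolded d_def[abs_def] d'_def[abs_def]]
  show ?thesis
    using unfolded[of 0 0 0 0] unfolded[of 0 1 1 0] unfolded[of 1 0 0 1] unfolded[of 1 1 1 1]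
    by (simp add: tensor_scale_simps)
qed

end
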